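(* Let $\mathbb{K}$ be a field and let $I\subset S=\mathbb{K}[x_1,x_2,x_3]$ be an equigenerated monomial ideal. Then $\operatorname{reg}(\overline{I})\le \operatorname{reg}(I)$.
   Context: $S$ carries the standard grading ($\deg x_i=1$). A monomial ideal is equigenerated (of degree $d$) if all its minimal monomial generators have the same degree $d$. For an ideal $I$, $\overline{I}$ denotes its integral closure in $S$. For a finitely generated graded $S$-module $M$, $\operatorname{reg}(M)$ is the Castelnuovo–Mumford regularity, $\operatorname{reg}(M)=\max\{j-i\mid \beta_{i,j}(M)\neq 0\}$, where $\beta_{i,j}(M)$ are the graded Betti numbers of the minimal graded free resolution of $M$ over $S$; $\operatorname{reg}(I)$ is the regularity of $I$ viewed as a graded $S$-module. *)

theory Defs
  imports "HOL-Library.Poly_Mapping" "HOL-Library.Numeral_Type" "Jordan_Normal_Form.Matrix"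
begin

text \<open>
  The polynomial ring over \<open>'k\<close> with variables indexed by the finite type \<open>'x\<close> is the type of
  finitely supported functions from exponent vectors to coefficients; its product is convolution.
  HOL-Algebra also has a locale \<open>module\<close>; \<open>Modules.module\<close> is the type-class based one, and for
  the scaling \<open>(*)\<close> its submodules are the ideals of the ring.
\<close>

type_synonym ('x, 'k) mpoly = "('x \<Rightarrow>\<^sub>0 nat) \<Rightarrow>\<^sub>0 'k"

abbreviation ideal_generated :: "'r::comm_ring_1 set \<Rightarrow> 'r set" where
  "ideal_generated \<equiv> Modules.module.span (*)"

text \<open>Degrees are integers so that twists \<open>S(-b)\<close> and differences of degrees need no truncation; 0 is
  homogeneous of every degree, and nothing else is homogeneous of a negative degree.\<close>

definition homogeneous :: "int \<Rightarrow> ('x::finite, 'k::zero) mpoly \<Rightarrow> bool" where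
  "homogeneous d p \<longleftrightarrow>
     (\<forall>m \<in> Poly_Mapping.keys p. (\<Sum>x\<in>UNIV. int (Poly_Mapping.lookup m x)) = d)"

definition monomials :: "('x::finite, 'k::zero_neq_one) mpoly set" where
  "monomials = range (\<lambda>m. Poly_Mapping.single m 1)"

definition monomial_ideal :: "('x::finite, 'k::field) mpoly set \<Rightarrow> bool" where
  "monomial_ideal I \<longleftrightarrow> (\<exists>A \<subseteq> monomials. I = ideal_generated A)"

definition minimal_monomial_generators ::
    "('x::finite, 'k::field) mpoly set \<Rightarrow> ('x, 'k) mpoly set" where
  "minimal_monomial_generators I =
     {u \<in> monomials \<inter> I. \<forall>v \<in> monomials \<inter> I. v dvd u \<longrightarrow> v = u}"

definition equigenerated :: "('x::finite, 'k::field) mpoly set \<Rightarrow> bool" where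
  "equigenerated I \<longleftrightarrow> (\<exists>d. \<forall>u \<in> minimal_monomial_generators I. homogeneous d u)"

definition ideal_power :: "'r::comm_ring_1 set \<Rightarrow> nat \<Rightarrow> 'r set" where
  "ideal_power I n = ideal_generated {(\<Prod>k<n. f k) | f. \<forall>k<n. f k \<in> I}"

definition integral_closure :: "'r::comm_ring_1 set \<Rightarrow> 'r set" where
  "integral_closure I =
     {f. \<exists>n a. n > 0 \<and> (\<forall>i\<in>{1..n}. a i \<in> ideal_power I i) \<and>
               f ^ n + (\<Sum>i=1..n. a i * f ^ (n - i)) = 0}"

text \<open>
  A graded module is given by its carrier \<open>M\<close> inside a type \<open>'m\<close>, the scaling \<open>scl\<close> and its graded
  components \<open>gr j \<subseteq> M\<close>. A minimal graded free resolution
  \[\cdots \to F_2 \to F_1 \to F_0 \to M \to 0\]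
  has \<open>F\<^sub>i = \<Oplus>\<^sub>r S(-b\<^sub>i\<^sub>,\<^sub>r)\<close>, where \<open>b i\<close> is the list of the \<open>b\<^sub>i\<^sub>,\<^sub>r\<close>, the degrees of a basis of \<open>F\<^sub>i\<close>.
  The list \<open>g\<close> contains the images in \<open>M\<close> of the basis elements of \<open>F\<^sub>0\<close>, and \<open>D i\<close> is the matrix of
  \<open>F\<^sub>i\<^sub>+\<^sub>1 \<rightarrow> F\<^sub>i\<close>. All maps have degree 0, which for \<open>D i\<close> fixes the degree of every entry. Minimality,
  \<open>D i F\<^sub>i\<^sub>+\<^sub>1 \<subseteq> (x\<^sub>1,\<dots>,x\<^sub>n) F\<^sub>i\<close>, says that no entry has a constant term.
\<close>

definition augmentation ::
    "('r::comm_ring_1 \<Rightarrow> 'm::ab_group_add \<Rightarrow> 'm) \<Rightarrow> 'm list \<Rightarrow> 'r vec \<Rightarrow> 'm" where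
  "augmentation scl g v = (\<Sum>r<length g. scl (v $ r) (g ! r))"

definition minimal_graded_free_resolution ::
    "(('x::finite, 'k::field) mpoly \<Rightarrow> 'm::ab_group_add \<Rightarrow> 'm) \<Rightarrow> 'm set \<Rightarrow> (int \<Rightarrow> 'm set) \<Rightarrow>
     (nat \<Rightarrow> int list) \<Rightarrow> 'm list \<Rightarrow> (nat \<Rightarrow> ('x, 'k) mpoly mat) \<Rightarrow> bool" where
  "minimal_graded_free_resolution scl M gr b g D \<longleftrightarrow>
     length g = length (b 0) \<and>
     (\<forall>r < length (b 0). g ! r \<in> gr (b 0 ! r)) \<and>
     (\<forall>i. D i \<in> carrier_mat (length (b i)) (length (b (Suc i)))) \<and>
     (\<forall>i. \<forall>r < length (b i). \<forall>c < length (b (Suc i)).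
        homogeneous (b (Suc i) ! c - b i ! r) (D i $$ (r, c))) \<and>
     augmentation scl g ` carrier_vec (length (b 0)) = M \<and>
     {v \<in> carrier_vec (length (b 0)). augmentation scl g v = 0} =
       (*\<^sub>v) (D 0) ` carrier_vec (length (b 1)) \<and>
     (\<forall>i. {v \<in> carrier_vec (length (b (Suc i))). D i *\<^sub>v v = 0\<^sub>v (length (b i))} =
        (*\<^sub>v) (D (Suc i)) ` carrier_vec (length (b (Suc (Suc i))))) \<and>
     (\<forall>i. \<forall>r < length (b i). \<forall>c < length (b (Suc i)). Poly_Mapping.lookup (D i $$ (r, c)) 0 = 0)"

text \<open>The minimal graded free resolution of a finitely generated graded module exists and is unique up
  to isomorphism, so the choice made here does not affect the graded Betti numbers.\<close>

definition graded_betti ::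
    "(('x::finite, 'k::field) mpoly \<Rightarrow> 'm::ab_group_add \<Rightarrow> 'm) \<Rightarrow> 'm set \<Rightarrow> (int \<Rightarrow> 'm set) \<Rightarrow>
     nat \<Rightarrow> int \<Rightarrow> nat" where
  "graded_betti scl M gr i j =
     count_list ((SOME b. \<exists>g D. minimal_graded_free_resolution scl M gr b g D) i) j"

text \<open>By Hilbert's syzygy theorem only finitely many graded Betti numbers are nonzero, and some is unless
  \<open>M = {0}\<close>; the regularity of the zero module is left unspecified.\<close>

definition regularity ::
    "(('x::finite, 'k::field) mpoly \<Rightarrow> 'm::ab_group_add \<Rightarrow> 'm) \<Rightarrow> 'm set \<Rightarrow> (int \<Rightarrow> 'm set) \<Rightarrow> int" where
  "regularity scl M gr = Max {j - int i | i j. graded_betti scl M gr i j \<noteq> 0}"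

definition ideal_regularity :: "('x::finite, 'k::field) mpoly set \<Rightarrow> int" where
  "ideal_regularity I = regularity (*) I (\<lambda>j. {f \<in> I. homogeneous j f})"

end

theory Submission
  imports Defs "HOL-Library.Function_Algebras" "HOL-Analysis.Analysis" "Jordan_Normal_Form.Determinant"
begin

text \<open>
  Let \<open>I\<close> be generated by monomials of degree \<open>d\<close>, with set of exponents \<open>A\<close> and convex hull
  \<open>P = conv A\<close>, a lattice polygon in the plane \<open>deg = d\<close>. The monomials of the integral closure of \<open>I\<close>
  are the lattice points of \<open>P + \<real>\<^sub>\<ge>\<^sub>0\<^sup>3\<close>. Clearly \<open>reg I \<ge> d\<close>. Elementary convex geometry shows that
  the multigraded Betti numbers of the integral closure always give regularity at most \<open>d + 1\<close>: its generators
  have degree at most \<open>d + 1\<close>, because a lattice polygon cannot lie inside a unit triangle; its first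
  syzygies have degree at most \<open>d + 2\<close>, by moving along a segment in \<open>P\<close>; and its socle degrees are
  less than \<open>d\<close>, by minimising \<open>max\<^sub>i (p\<^sub>i - c\<^sub>i)\<close> over \<open>p \<in> P\<close>. If \<open>reg I = d\<close>, then the first
  syzygies of \<open>I\<close> are linear, so that \<open>A\<close> is connected by unit steps in the triangular lattice. Then the
  generators and first syzygies of the integral closure have degrees \<open>d\<close> and \<open>d + 1\<close>, so its regularity is
  \<open>d\<close> as well.

  Betti numbers are read off any minimal resolution from Koszul homology: if the Koszul homology of a
  graded module \<open>Z\<close> vanishes in homological degree \<open>i\<close> and internal degree \<open>j\<close>, then that of its syzygy
  module vanishes in degrees \<open>i - 1\<close> and \<open>j\<close>. This dimension shift also shows that all syzygy modules are
  finitely generated, so that minimal resolutions exist.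
\<close>

\<comment> \<open>Since reg I is an integer that is at least d, either it is at least d + 1 and the
  unconditional bound for the integral closure settles the claim, or it equals d; only the second
  case uses more about I than its degree. Betti numbers are defined through a chosen resolution,
  whereas the geometry speaks of monomials. Koszul homology connects the two: in each multidegree it
  is decided by which of a few neighbouring exponents lie in the ideal, so the field never enters.
  For the integral closure, vanishing homology has to bound the resolution; for I, missing degrees
  in the resolution have to yield vanishing homology. Hence the shift to syzygies is also proved
  backwards in homological degree one. In the linear case the obstacle is that A may miss many
  lattice points of P. All that is available is connectedness by unit steps, and it enters through a
  discrete intermediate value argument: a coordinate takes on A every integer between two of its
  values. This puts points of A on prescribed lattice lines, which convexity alone cannot
  do.\<close>
alias lookup = Poly_Mapping.lookup
alias keys = Poly_Mapping.keys
alias single = Poly_Mapping.single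

section \<open>Polynomials and the Koszul complex\<close>

lemma cyclic_distinct [simp]:
  "(i::3) \<noteq> i + 1" "i \<noteq> i + 2" "i + 1 \<noteq> i + 2" "i + 1 \<noteq> i" "i + 2 \<noteq> i" "i + 2 \<noteq> i + 1"
  by simp_all

lemma cyclic_add [simp]: "(i::3) + 1 + 1 = i + 2" "i + 1 + 2 = i" "i + 2 + 1 = i" "i + 2 + 2 = i + 1"
  by (simp_all add: add.assoc)

lemma three_eq_zero [simp]: "(3::3) = 0" "(4::3) = 1"
  by simp_all

lemma UNIV_cyclic: "(UNIV :: 3 set) = {i, i + 1, i + 2}"
  by (rule card_subset_eq[symmetric]) simp_all

lemma sum_cyclic: "sum f (UNIV :: 3 set) = f i + (f (i + 1) + (f (i + 2) :: 'a::comm_monoid_add))"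
  unfolding UNIV_cyclic[of i] by (simp add: insert_eq_iff)

lemma cyclic_cases: obtains "j = i" | "j = i + 1" | "j = (i::3) + 2"
  using UNIV_cyclic[of i] by blast

section \<open>Exponent vectors, multiplication by a variable, homogeneity\<close>

type_synonym expo = "3 \<Rightarrow>\<^sub>0 nat"
type_synonym 'k pol = "(3, 'k) mpoly"

definition uexp :: "3 \<Rightarrow> expo" where "uexp i = single i 1"

definition deg :: "expo \<Rightarrow> int" where "deg m = (\<Sum>x\<in>UNIV. int (lookup m x))"

definition var :: "3 \<Rightarrow> 'k::field pol" where "var i = single (uexp i) 1"

lemma deg_add [simp]: "deg (a + b) = deg a + deg b"
  by (simp add: deg_def lookup_add sum.distrib)

lemma deg_uexp [simp]: "deg (uexp i) = 1"
  by (simp add: deg_def uexp_def lookup_single sum_cyclic[of _ i] when_def)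

lemma deg_nonneg: "deg m \<ge> 0"
  by (simp add: deg_def sum_nonneg)

lemma deg_zero [simp]: "deg 0 = 0"
  by (simp add: deg_def)

lemma deg_eq_0_iff [simp]: "deg m = 0 \<longleftrightarrow> m = 0"
proof
  assume "deg m = 0"
  then have "\<forall>i. lookup m i = 0"
    by (simp add: deg_def sum_nonneg_eq_0_iff)
  then show "m = 0" by (simp add: poly_mapping_eqI)
qed simp

lemma lookup_uexp: "lookup (uexp i) j = (if i = j then 1 else 0)"
  by (simp add: uexp_def lookup_single when_def)

lemma exponent_split:
  assumes "lookup m i \<noteq> 0"
  obtains u where "m = u + uexp i"
proof
  show "m = (m - uexp i) + uexp i"
    by (rule poly_mapping_eqI) (use assms in \<open>auto simp: lookup_add lookup_minus lookup_uexp\<close>)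
qed

lemma lookup_monom_mult:
  fixes f :: "'k::field pol"
  shows "lookup (single a c * f) (a + m) = c * lookup f m"
proof -
  have "lookup (single a c * f) (a + m) =
    (\<Sum>l. (c when a = l) * (\<Sum>q. lookup f q when a + m = l + q))"
    by (simp add: lookup_mult lookup_single)
  also have "\<dots> = (\<Sum>l. (c * (\<Sum>q. lookup f q when a + m = l + q)) when a = l)"
    by (simp add: when_mult)
  also have "\<dots> = c * lookup f m"
    by simp
  finally show ?thesis .
qed

lemma lookup_var_mult_add [simp]: "lookup (var i * f) (m + uexp i) = lookup f m"
  unfolding var_def using lookup_monom_mult[of "uexp i" 1 f m] by (simp add: add.commute)

lemma keys_monom_mult:
  fixes f :: "'k::field pol"
  shows "keys (single a c * f) \<subseteq> (\<lambda>m. a + m) ` keys f"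
  using keys_mult[of "single a c" f] by (force split: if_splits)

lemma lookup_var_mult_0 [simp]:
  assumes "lookup m i = 0"
  shows "lookup (var i * f) m = 0"
proof (rule ccontr)
  assume "lookup (var i * f) m \<noteq> 0"
  then obtain u where "m = uexp i + u"
    unfolding var_def using keys_monom_mult by (metis (no_types, lifting) image_iff in_keys_iff subsetD)
  with assms show False by (simp add: lookup_add lookup_uexp)
qed

lemma keys_var_mult: "keys (var i * f) = (\<lambda>m. m + uexp i) ` keys f"
proof (intro equalityI subsetI)
  fix m assume "m \<in> keys (var i * f)"
  then show "m \<in> (\<lambda>m. m + uexp i) ` keys f"
    unfolding var_def using keys_monom_mult by (fastforce simp: add.commute)
qed (auto simp: in_keys_iff)

text \<open>Division by x_i that drops the monomials not divisible by x_i. It is additive, inverts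
  multiplication by \<open>var i\<close> and commutes with the other variables, which is what makes
  the Koszul relations solvable explicitly.\<close>

definition quot :: "3 \<Rightarrow> 'k::field pol \<Rightarrow> 'k pol" where
  "quot i = Poly_Mapping.map_key (\<lambda>m. m + uexp i)"

lemma lookup_quot [simp]: "lookup (quot i f) m = lookup f (m + uexp i)"
  unfolding quot_def by (subst map_key.rep_eq) (auto simp: inj_on_def)

lemma quot_var_mult [simp]: "quot i (var i * f) = f"
  by (rule poly_mapping_eqI) simp

lemma quot_var_mult_other:
  assumes "i \<noteq> j"
  shows "quot i (var j * f) = var j * quot i f"
proof (rule poly_mapping_eqI)
  fix m
  show "lookup (quot i (var j * f)) m = lookup (var j * quot i f) m"
  proof (cases "lookup m j = 0")
    case True
    then show ?thesis using assms by (simp add: lookup_add lookup_uexp)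
  next
    case False
    then obtain u where u: "m = u + uexp j" by (rule exponent_split)
    have "u + uexp j + uexp i = u + uexp i + uexp j" by (simp add: ac_simps)
    then show ?thesis unfolding u by (metis lookup_var_mult_add lookup_quot)
  qed
qed

lemma quot_add [simp]: "quot i (f + g) = quot i f + quot i g"
  by (rule poly_mapping_eqI) (simp add: lookup_add)

lemma quot_zero [simp]: "quot i 0 = 0"
  by (rule poly_mapping_eqI) simp

lemma var_mult_cancel [simp]: "var i * f = var i * g \<longleftrightarrow> f = g"
  by (metis quot_var_mult)

lemma var_nonzero [simp]: "var i \<noteq> 0"
  by (metis var_def lookup_single_eq lookup_zero one_neq_zero)

lemma homogeneous_iff: "homogeneous d p \<longleftrightarrow> (\<forall>m\<in>keys p. deg m = d)"
  by (simp add: homogeneous_def deg_def)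

lemma homogeneous_iff': "homogeneous d p \<longleftrightarrow> (\<forall>m. lookup p m \<noteq> 0 \<longrightarrow> deg m = d)"
  by (auto simp: homogeneous_iff in_keys_iff)

lemma homogeneous_zero [simp]: "homogeneous d (0 :: 'k::field pol)"
  by (simp add: homogeneous_iff)

lemma homogeneous_add:
  "homogeneous d p \<Longrightarrow> homogeneous d q \<Longrightarrow> homogeneous d (p + q :: 'k::field pol)"
  unfolding homogeneous_iff' lookup_add by (metis add_0)

lemma homogeneous_uminus [simp]: "homogeneous d (- p :: 'k::field pol) \<longleftrightarrow> homogeneous d p"
  by (simp add: homogeneous_iff')

lemma homogeneous_diff:
  "homogeneous d p \<Longrightarrow> homogeneous d q \<Longrightarrow> homogeneous d (p - q :: 'k::field pol)"
  using homogeneous_add[of d p "- q"] by simp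

lemma homogeneous_sum:
  "(\<And>i. i \<in> A \<Longrightarrow> homogeneous d (p i)) \<Longrightarrow> homogeneous d (\<Sum>i\<in>A. p i :: 'k::field pol)"
  by (induction A rule: infinite_finite_induct) (auto intro: homogeneous_add)

lemma homogeneous_mult:
  assumes "homogeneous d p" "homogeneous d' q"
  shows "homogeneous (d + d') (p * q :: 'k::field pol)"
  using assms keys_mult[of p q] unfolding homogeneous_iff by fastforce

lemma homogeneous_var [simp]: "homogeneous 1 (var i)"
  by (simp add: homogeneous_iff var_def)

lemma homogeneous_var_mult: "homogeneous (d - 1) f \<Longrightarrow> homogeneous d (var i * f)"
  using homogeneous_mult[OF homogeneous_var, of "d - 1" f i] by simp

lemma homogeneous_quot: "homogeneous d f \<Longrightarrow> homogeneous (d - 1) (quot i f)"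
  unfolding homogeneous_iff' by fastforce

lemma homogeneous_negative: "homogeneous d p \<Longrightarrow> d < 0 \<Longrightarrow> (p :: 'k::field pol) = 0"
  unfolding homogeneous_iff using deg_nonneg by (metis all_not_in_conv keys_eq_empty not_le)

text \<open>With three variables the differentials of the Koszul complex are, up to sign, the dot product, the
  cross product and the scalar product with the vector of variables; indices are added in \<open>\<int>/3\<close>.\<close>

lemma koszul1_exact:
  fixes f :: "3 \<Rightarrow> 'k::field pol"
  assumes "(\<Sum>i\<in>UNIV. var i * f i) = 0"
  obtains G where "\<And>i. f i = var (i + 1) * G (i + 2) - var (i + 2) * G (i + 1)"
    and "\<And>j i. (\<And>i. homogeneous j (f i)) \<Longrightarrow> homogeneous (j - 1) (G i)"
proof -
  \<comment> \<open>\<open>f1\<close> and \<open>f2\<close> are the parts of \<open>f 1\<close> and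
    \<open>f 2\<close> free of x_0. Subtracting x_0 times the relation divided by x_0 leaves a
    relation between them in x_1 and x_2 alone, which divisibility solves.\<close>
  define f1 where "f1 = f 1 - var 0 * quot 0 (f 1)"
  define f2 where "f2 = f 2 - var 0 * quot 0 (f 2)"
  define G where "G = (\<lambda>i::3. if i = 0 then - quot 1 f2 else if i = 1 then quot 0 (f 2) else - quot 0 (f 1))"
  have s: "var 0 * f 0 + (var 1 * f 1 + var 2 * f 2) = 0"
    using assms by (simp add: sum_cyclic[of _ 0])
  then have "quot 0 (var 0 * f 0 + (var 1 * f 1 + var 2 * f 2)) = 0" by simp
  then have f0: "f 0 + (var 1 * quot 0 (f 1) + var 2 * quot 0 (f 2)) = 0"
    by (simp add: quot_var_mult_other)
  have "var 1 * f1 + var 2 * f2 = (var 0 * f 0 + (var 1 * f 1 + var 2 * f 2))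
      - var 0 * (f 0 + (var 1 * quot 0 (f 1) + var 2 * quot 0 (f 2)))"
    unfolding f1_def f2_def by (simp add: algebra_simps)
  then have r: "var 1 * f1 + var 2 * f2 = 0"
    using s f0 by simp
  then have "quot 1 (var 1 * f1 + var 2 * f2) = 0" by simp
  then have f1: "f1 + var 2 * quot 1 f2 = 0" by (simp add: quot_var_mult_other)
  then have "var 2 * f2 = var 2 * (var 1 * quot 1 f2)"
    using r by (simp add: add_eq_0_iff algebra_simps)
  then have f2: "f2 = var 1 * quot 1 f2" by (simp only: var_mult_cancel)
  have "f i = var (i + 1) * G (i + 2) - var (i + 2) * G (i + 1)" for i
  proof (cases rule: cyclic_cases[of i 0])
    case 1
    then show ?thesis using f0 by (simp add: G_def eq_neg_iff_add_eq_0 algebra_simps)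
  next
    case 2
    then show ?thesis using f1 by (simp add: G_def f1_def algebra_simps add_eq_0_iff)
  next
    case 3
    then show ?thesis using f2 unfolding f2_def by (simp add: G_def f2_def algebra_simps)
  qed
  moreover have "homogeneous (j - 1) (G i)" if "\<And>i. homogeneous j (f i)" for j i
  proof -
    have "homogeneous j f2"
      unfolding f2_def using that by (intro homogeneous_diff homogeneous_var_mult homogeneous_quot)
    then show ?thesis using that by (simp add: G_def homogeneous_quot)
  qed
  ultimately show thesis by (rule that)
qed

text \<open>The factor \<open>h\<close> is read off at index 0. Dividing the relations between
  \<open>G 0\<close> and the other entries by x_0 transfers it to \<open>G 1\<close> and
  \<open>G 2\<close>; cancelling x_1 then shows that x_0 divides \<open>G 0\<close>.\<close>

lemma koszul2_exact:
  fixes G :: "3 \<Rightarrow> 'k::field pol"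
  assumes "\<And>i. var (i + 1) * G (i + 2) = var (i + 2) * G (i + 1)"
  obtains h where "\<And>i. G i = var i * h" and "\<And>j. (\<And>i. homogeneous j (G i)) \<Longrightarrow> homogeneous (j - 1) h"
proof -
  define h where "h = quot 0 (G 0)"
  have "quot 0 (var 0 * G 1) = quot 0 (var 1 * G 0)" "quot 0 (var 2 * G 0) = quot 0 (var 0 * G 2)"
    using arg_cong[OF assms[of 2], of "quot 0"] arg_cong[OF assms[of 1], of "quot 0"] by simp_all
  then have G: "G 1 = var 1 * h" "G 2 = var 2 * h" 
    by (simp_all add: quot_var_mult_other h_def)
  have "var 0 * G 1 = var 1 * G 0"
    using assms[of 2] by simp
  then have "var 1 * G 0 = var 1 * (var 0 * h)"
    unfolding G(1) by (metis mult.left_commute)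
  then have "G 0 = var 0 * h" by (simp only: var_mult_cancel)
  with G have "G i = var i * h" for i
    by (cases rule: cyclic_cases[of i 0]) simp_all
  moreover have "homogeneous (j - 1) h" if "\<And>i. homogeneous j (G i)" for j
    unfolding h_def using that by (intro homogeneous_quot)
  ultimately show thesis by (rule that)
qed

text \<open>Each stage removes the multiples of one variable, so after three stages only the
  constant term, which is zero here, could remain.\<close>

lemma koszul0_exact:
  assumes "lookup f 0 = 0"
  obtains g where "f = (\<Sum>i\<in>UNIV. var i * g i)" 
    and "\<And>j i. homogeneous j f \<Longrightarrow> homogeneous (j - 1) (g i)"
proof -
  define f1 where "f1 = f - var 0 * quot 0 f"
  define f2 where "f2 = f1 - var 1 * quot 1 f1"
  define g where "g = (\<lambda>i::3. if i = 0 then quot 0 f else if i = 1 then quot 1 f1 else quot 2 f2)"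
  have 0: "lookup (p - var i * quot i p) m =
      (if lookup m i = 0 then lookup p m else 0)" for p :: "'a pol" and i m
  proof (cases "lookup m i = 0")
    case True then show ?thesis by (simp add: lookup_minus)
  next
    case False then show ?thesis by (elim exponent_split) (simp add: lookup_minus lookup_add lookup_uexp)
  qed
  have "f2 - var 2 * quot 2 f2 = 0"
  proof (rule poly_mapping_eqI)
    fix m
    show "lookup (f2 - var 2 * quot 2 f2) m = lookup 0 m"
    proof (cases "m = 0")
      case False
      then obtain i where "lookup m i \<noteq> 0" by (metis poly_mapping_eqI lookup_zero)
      then show ?thesis unfolding f2_def f1_def 0 
        by (cases rule: cyclic_cases[of i 0]) simp_all
    qed (unfold f2_def f1_def 0, simp add: assms)
  qed
  then have "f2 = var 2 * quot 2 f2" by simp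
  moreover have "f = var 0 * quot 0 f + f1" "f1 = var 1 * quot 1 f1 + f2"
    by (simp_all add: f1_def f2_def)
  ultimately have "f = (\<Sum>i\<in>UNIV. var i * g i)"
    unfolding sum_cyclic[of _ 0] by (simp add: g_def)
  moreover have "homogeneous (j - 1) (g i)" if "homogeneous j f" for j i
  proof -
    have "homogeneous j f1"
      unfolding f1_def using that by (intro homogeneous_diff homogeneous_var_mult homogeneous_quot)
    moreover from this have "homogeneous j f2"
      unfolding f2_def by (intro homogeneous_diff homogeneous_var_mult homogeneous_quot)
    ultimately show ?thesis using that by (simp add: g_def homogeneous_quot)
  qed
  ultimately show thesis by (rule that)
qed

section \<open>Syzygies of graded modules\<close>

type_synonym 'k fvec = "nat \<Rightarrow> 'k pol"

definition smul :: "'k::field pol \<Rightarrow> 'k fvec \<Rightarrow> 'k fvec" (infixr "\<odot>" 75)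
  where "c \<odot> v = (\<lambda>r. c * v r)"

lemma smul_apply [simp]: "(c \<odot> v) r = c * v r"
  by (simp add: smul_def)

lemma sum_fun_apply: "(\<Sum>i\<in>A. f i) r = (\<Sum>i\<in>A. f i r :: 'a::comm_monoid_add)"
  by (induction A rule: infinite_finite_induct) auto

definition hom_part :: "int \<Rightarrow> 'k::field pol \<Rightarrow> 'k pol" where
  "hom_part j p = Poly_Mapping.mapp (\<lambda>m c. if deg m = j then c else 0) p"

lemma lookup_hom_part: "lookup (hom_part j p) m = (if deg m = j then lookup p m else 0)"
  by (auto simp: hom_part_def lookup_mapp when_def in_keys_iff)

lemma homogeneous_hom_part [simp]: "homogeneous j (hom_part j p)"
  by (simp add: homogeneous_iff' lookup_hom_part)

lemma hom_part_add: "hom_part j (p + q) = hom_part j p + hom_part j q"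
  by (rule poly_mapping_eqI) (simp add: lookup_hom_part lookup_add)

lemma hom_part_sum: "hom_part j (\<Sum>i\<in>A. p i) = (\<Sum>i\<in>A. hom_part j (p i))"
proof (induction A rule: infinite_finite_induct)
  case (insert x F) then show ?case by (simp add: hom_part_add)
qed (auto intro: poly_mapping_eqI simp: lookup_hom_part)

lemma hom_part_zero [simp]: "hom_part j 0 = 0"
  by (rule poly_mapping_eqI) (simp add: lookup_hom_part)

lemma hom_part_homogeneous: "homogeneous j p \<Longrightarrow> hom_part i p = (if i = j then p else 0)"
  by (rule poly_mapping_eqI) (auto simp: lookup_hom_part homogeneous_iff')

lemma hom_part_mult:
  assumes "homogeneous d g"
  shows "hom_part j (g * f) = g * hom_part (j - d) f"
proof -
  have "hom_part j (g * (f - hom_part (j - d) f)) = 0"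
  proof (rule poly_mapping_eqI, rule ccontr)
    fix m
    assume "lookup (hom_part j (g * (f - hom_part (j - d) f))) m \<noteq> lookup 0 m"
    then have "deg m = j" "m \<in> keys (g * (f - hom_part (j - d) f))"
      by (auto simp: lookup_hom_part in_keys_iff split: if_splits)
    then obtain a b where "m = a + b" "a \<in> keys g" "b \<in> keys (f - hom_part (j - d) f)"
      using keys_mult by blast
    moreover from this have "deg a = d" "deg b \<noteq> j - d"
      using assms by (auto simp: homogeneous_iff in_keys_iff lookup_minus lookup_hom_part)
    ultimately show False using \<open>deg m = j\<close> by simp
  qed
  moreover have "hom_part j (g * hom_part (j - d) f) = g * hom_part (j - d) f"
    using homogeneous_mult[OF assms homogeneous_hom_part, of "j - d" f] by (simp add: hom_part_homogeneous)
  moreover have "g * f = g * hom_part (j - d) f + g * (f - hom_part (j - d) f)"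
    by (simp add: algebra_simps)
  ultimately show ?thesis by (metis hom_part_add add.right_neutral)
qed

text \<open>One type of vectors serves all ranks: entries beyond the rank are forced to be zero, so
  that a resolution becomes a sequence of sets in a single type.\<close>

definition free :: "int list \<Rightarrow> 'k::field fvec set" where
  "free b = {v. \<forall>r\<ge>length b. v r = 0}"

definition graded :: "int list \<Rightarrow> int \<Rightarrow> 'k::field fvec set" where
  "graded b j = {v \<in> free b. \<forall>r<length b. homogeneous (j - b ! r) (v r)}"

definition graded_part :: "int list \<Rightarrow> int \<Rightarrow> 'k::field fvec \<Rightarrow> 'k fvec" where
  "graded_part b j v = (\<lambda>r. if r < length b then hom_part (j - b ! r) (v r) else 0)"

definition graded_submodule :: "int list \<Rightarrow> 'k::field fvec set \<Rightarrow> bool" where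
  "graded_submodule b Z \<longleftrightarrow> Z \<subseteq> free b \<and> 0 \<in> Z \<and> (\<forall>u\<in>Z. \<forall>v\<in>Z. u + v \<in> Z) \<and>
     (\<forall>c. \<forall>v\<in>Z. c \<odot> v \<in> Z) \<and> (\<forall>j. \<forall>v\<in>Z. graded_part b j v \<in> Z)"

lemma graded_submoduleD:
  assumes "graded_submodule b Z"
  shows "v \<in> Z \<Longrightarrow> v \<in> free b" "0 \<in> Z" "u \<in> Z \<Longrightarrow> v \<in> Z \<Longrightarrow> u + v \<in> Z"
    "v \<in> Z \<Longrightarrow> c \<odot> v \<in> Z" "v \<in> Z \<Longrightarrow> graded_part b j v \<in> Z"
  using assms unfolding graded_submodule_def by auto

lemma graded_submodule_uminus:
  assumes "graded_submodule b Z" "v \<in> Z" shows "- v \<in> Z"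
proof -
  have "- v = (- 1) \<odot> v" by (auto simp: fun_eq_iff)
  then show ?thesis using assms graded_submoduleD(4) by metis
qed

lemma graded_submodule_diff:
  assumes "graded_submodule b Z" "u \<in> Z" "v \<in> Z" shows "u - v \<in> Z"
  using graded_submoduleD(3)[OF assms(1,2) graded_submodule_uminus[OF assms(1,3)]] by simp

lemma graded_submodule_sum:
  assumes "graded_submodule b Z" "\<And>i. i \<in> A \<Longrightarrow> f i \<in> Z" shows "(\<Sum>i\<in>A. f i) \<in> Z"
  using assms(2) by (induction A rule: infinite_finite_induct) (auto intro: graded_submoduleD[OF assms(1)])

lemma free_graded_submodule: "graded_submodule b (free b)"
  by (auto simp: graded_submodule_def free_def graded_part_def)

lemma graded_part_graded [simp]: "graded_part b j v \<in> graded b j"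
  by (auto simp: graded_def graded_part_def free_def)

lemma graded_part_eq: "v \<in> graded b j \<Longrightarrow> graded_part b i v = (if i = j then v else 0)"
  by (auto simp: graded_def graded_part_def free_def fun_eq_iff hom_part_homogeneous)

lemma graded_part_sum: "graded_part b j (\<Sum>i\<in>A. f i) = (\<Sum>i\<in>A. graded_part b j (f i))"
  by (auto simp: graded_part_def fun_eq_iff sum_fun_apply hom_part_sum)

lemma graded_part_var_smul: "graded_part b j (var i \<odot> v) = var i \<odot> graded_part b (j - 1) v"
  by (auto simp: graded_part_def fun_eq_iff hom_part_mult[OF homogeneous_var] algebra_simps)

lemma sum_graded_part:
  assumes "v \<in> free b"
  obtains J where "finite J" "v = (\<Sum>j\<in>J. graded_part b j v)"
proof
  define J where "J = (\<Union>r<length b. (\<lambda>m. deg m + b ! r) ` keys (v r))"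
  show J: "finite J" by (auto simp: J_def)
  show "v = (\<Sum>j\<in>J. graded_part b j v)"
  proof
    fix r
    show "v r = (\<Sum>j\<in>J. graded_part b j v) r"
    proof (cases "r < length b")
      case True
      have "lookup (v r) m = (\<Sum>j\<in>J. lookup (hom_part (j - b ! r) (v r)) m)" for m
      proof -
        have "(\<Sum>j\<in>J. lookup (hom_part (j - b ! r) (v r)) m) =
            (\<Sum>j\<in>J. if j = deg m + b ! r then lookup (v r) m else 0)"
          by (rule sum.cong) (auto simp: lookup_hom_part)
        also have "\<dots> = lookup (v r) m"
        proof (cases "lookup (v r) m = 0")
          case False
          then have "deg m + b ! r \<in> (\<lambda>m. deg m + b ! r) ` keys (v r)"
            by (simp add: in_keys_iff)
          then have "deg m + b ! r \<in> J" using True unfolding J_def by blast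
          with J show ?thesis by simp
        qed (simp add: if_distrib sum.neutral)
        finally show ?thesis ..
      qed
      with True show ?thesis by (auto intro!: poly_mapping_eqI simp: sum_fun_apply lookup_sum graded_part_def)
    qed (use assms in \<open>simp add: sum_fun_apply graded_part_def free_def\<close>)
  qed
qed

lemma graded_free: "v \<in> graded b j \<Longrightarrow> v \<in> free b"
  by (simp add: graded_def)

lemma graded_shift: "v \<in> graded b (j - 1) \<Longrightarrow> var i \<odot> v \<in> graded b j"
  by (auto simp: graded_def free_def intro!: homogeneous_var_mult) (simp add: algebra_simps)

lemma graded_sum: "(\<And>i. i \<in> A \<Longrightarrow> f i \<in> graded b j) \<Longrightarrow> (\<Sum>i\<in>A. f i) \<in> graded b j"
  by (auto simp: graded_def free_def homogeneous_sum sum_fun_apply)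

section \<open>Koszul maps and Koszul homology of submodules of free modules\<close>

definition xdot :: "(3 \<Rightarrow> 'k::field fvec) \<Rightarrow> 'k fvec" where
  "xdot f = (\<Sum>i\<in>UNIV. var i \<odot> f i)"

definition cross :: "(3 \<Rightarrow> 'k::field fvec) \<Rightarrow> 3 \<Rightarrow> 'k fvec" where
  "cross f i = var (i + 1) \<odot> f (i + 2) - var (i + 2) \<odot> f (i + 1)"

lemma xdot_apply: "xdot f r = (\<Sum>i\<in>UNIV. var i * f i r)"
  by (simp add: xdot_def sum_fun_apply)

lemma cross_apply: "cross f i r = var (i + 1) * f (i + 2) r - var (i + 2) * f (i + 1) r"
  by (simp add: cross_def)

lemma xdot_cross [simp]: "xdot (cross f) = 0"
  by (rule ext) (simp add: xdot_apply cross_apply sum_cyclic[of _ 0] algebra_simps)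

lemma xdot_diff: "xdot (\<lambda>i. f i - g i) = xdot f - xdot g"
  by (rule ext) (simp add: xdot_apply algebra_simps sum_subtractf)

lemma cross_diff: "cross (\<lambda>i. f i - g i) i = cross f i - cross g i"
  by (rule ext) (simp add: cross_apply algebra_simps)

lemma cross_var [simp]: "cross (\<lambda>i. var i \<odot> h) i = 0"
  by (rule ext) (simp add: cross_apply algebra_simps)

lemma cross_in:
  assumes "graded_submodule b Z" "\<And>i. f i \<in> Z" shows "cross f i \<in> Z"
  unfolding cross_def using assms by (intro graded_submodule_diff[OF assms(1)] graded_submoduleD(4))

lemma xdot_in:
  assumes "graded_submodule b Z" "\<And>i. f i \<in> Z" shows "xdot f \<in> Z"
  unfolding xdot_def using assms by (intro graded_submodule_sum[OF assms(1)] graded_submoduleD(4))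

lemma koszul0_exact_free:
  assumes v: "v \<in> free b" and 0: "\<And>r. lookup (v r) 0 = 0"
  obtains g where "v = xdot g" "\<And>i. g i \<in> free b" 
    "\<And>j i. v \<in> graded b j \<Longrightarrow> g i \<in> graded b (j - 1)"
proof -
  have "\<exists>g. v r = (\<Sum>i\<in>UNIV. var i * g i) \<and> (\<forall>j i. homogeneous j (v r) \<longrightarrow> homogeneous (j - 1) (g i))" for r
    using koszul0_exact[OF 0[of r]] by metis
  then obtain g where g: "v r = (\<Sum>i\<in>UNIV. var i * g r i)" 
    "homogeneous j (v r) \<Longrightarrow> homogeneous (j - 1) (g r i)" for r j i
    by metis
  show thesis
  proof
    let ?g = "\<lambda>i r. if r < length b then g r i else 0"
    show "v = xdot ?g"
    proof
      fix r
      show "v r = xdot ?g r"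
        using v g(1)[of r] by (cases "r < length b") (simp_all add: xdot_apply free_def)
    qed
    show "?g i \<in> free b" for i by (auto simp: free_def)
    show "?g i \<in> graded b (j - 1)" if "v \<in> graded b j" for j i
      using that g(2)[of "j - b ! r" r for r] by (auto simp: graded_def free_def algebra_simps)
  qed
qed

lemma koszul1_exact_free:
  assumes f: "\<And>i. f i \<in> free b" and 0: "xdot f = 0"
  obtains G where "\<And>i. f i = cross G i" "\<And>i. G i \<in> free b" 
    "\<And>j i. (\<And>i. f i \<in> graded b j) \<Longrightarrow> G i \<in> graded b (j - 1)"
proof -
  have "\<exists>G. (\<forall>i. f i r = var (i + 1) * G (i + 2) - var (i + 2) * G (i + 1)) \<and>
     (\<forall>j i. (\<forall>i. homogeneous j (f i r)) \<longrightarrow> homogeneous (j - 1) (G i))" for r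
  proof -
    have "(\<Sum>i\<in>UNIV. var i * f i r) = 0" using fun_cong[OF 0, of r] by (simp add: xdot_apply)
    then show ?thesis
    proof (rule koszul1_exact)
      fix G
      assume "\<And>i. f i r = var (i + 1) * G (i + 2) - var (i + 2) * G (i + 1)"
        "\<And>j i. (\<And>i. homogeneous j (f i r)) \<Longrightarrow> homogeneous (j - 1) (G i)"
      then show ?thesis by blast
    qed
  qed
  then obtain G where G: "f i r = var (i + 1) * G r (i + 2) - var (i + 2) * G r (i + 1)"
    "(\<And>i. homogeneous j (f i r)) \<Longrightarrow> homogeneous (j - 1) (G r i)" for r j i
    by metis
  show thesis
  proof
    let ?g = "\<lambda>i r. if r < length b then G r i else 0"
    show "f i = cross ?g i" for i
      using f[of i] by (auto simp: fun_eq_iff cross_apply free_def G(1))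
    show "?g i \<in> free b" for i by (auto simp: free_def)
    show "?g i \<in> graded b (j - 1)" if "\<And>i. f i \<in> graded b j" for j i
      using that G(2)[of "j - b ! r" r for r] by (auto simp: graded_def free_def algebra_simps)
  qed
qed

lemma koszul2_exact_free:
  assumes G: "\<And>i. G i \<in> free b" and 0: "\<And>i. cross G i = 0"
  obtains h where "\<And>i. G i = var i \<odot> h" "h \<in> free b" 
proof -
  have "\<exists>h. (\<forall>i. G i r = var i * h)" for r
  proof -
    have "var (i + 1) * G (i + 2) r = var (i + 2) * G (i + 1) r" for i
      using fun_cong[OF 0[of i], of r] by (simp add: cross_apply)
    then show ?thesis
    proof (rule koszul2_exact)
      fix h assume "\<And>i. G i r = var i * h"
      then show ?thesis by (intro exI[of _ h]) simp
    qed
  qed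
  then obtain h where h: "G i r = var i * h r" for r i
    by metis
  show thesis
  proof
    let ?g = "\<lambda>r. if r < length b then h r else 0"
    show "G i = var i \<odot> ?g" for i
      using G[of i] by (auto simp: fun_eq_iff free_def h(1))
    show "?g \<in> free b" by (auto simp: free_def)
  qed
qed

text \<open>Vanishing in degree \<open>j\<close> of the Koszul homology of a graded submodule \<open>Z\<close>; the homology
  module in homological degree \<open>i\<close> is \<open>Tor\<^sub>i(Z, k)\<close>.\<close>

definition H0_vanishes :: "int list \<Rightarrow> 'k::field fvec set \<Rightarrow> int \<Rightarrow> bool" where
  "H0_vanishes b Z j \<longleftrightarrow> (\<forall>z \<in> Z \<inter> graded b j. \<exists>f. (\<forall>i. f i \<in> Z) \<and> z = xdot f)"

text \<open>A basis element of the Koszul complex in homological degree i has internal degree i, so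
  the entries of a cycle have degree \<open>j - 1\<close> here and \<open>j - 2\<close> one step up.
  Only cycles are taken homogeneous; a bounding element may be replaced by its graded part.\<close>

definition H1_vanishes :: "int list \<Rightarrow> 'k::field fvec set \<Rightarrow> int \<Rightarrow> bool" where
  "H1_vanishes b Z j \<longleftrightarrow> (\<forall>f. (\<forall>i. f i \<in> Z \<inter> graded b (j - 1)) \<and> xdot f = 0 \<longrightarrow>
     (\<exists>G. (\<forall>i. G i \<in> Z) \<and> (\<forall>i. f i = cross G i)))"

definition H2_vanishes :: "int list \<Rightarrow> 'k::field fvec set \<Rightarrow> int \<Rightarrow> bool" where
  "H2_vanishes b Z j \<longleftrightarrow> (\<forall>G. (\<forall>i. G i \<in> Z \<inter> graded b (j - 2)) \<and> (\<forall>i. cross G i = 0) \<longrightarrow>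
     (\<exists>h\<in>Z. \<forall>i. G i = var i \<odot> h))"

lemma H0_vanishesD:
  assumes "H0_vanishes b Z j" "z \<in> Z" "z \<in> graded b j"
  obtains f where "\<And>i. f i \<in> Z" "z = xdot f"
  using assms unfolding H0_vanishes_def by blast

lemma H1_vanishesD:
  assumes "H1_vanishes b Z j" "\<And>i. f i \<in> Z \<inter> graded b (j - 1)" "xdot f = 0"
  obtains G where "\<And>i. G i \<in> Z" "\<And>i. f i = cross G i"
  using assms(1)[unfolded H1_vanishes_def, rule_format, of f] assms(2,3) by metis

lemma H2_vanishesD:
  assumes "H2_vanishes b Z j" "\<And>i. G i \<in> Z \<inter> graded b (j - 2)" "\<And>i. cross G i = 0"
  obtains h where "h \<in> Z" "\<And>i. G i = var i \<odot> h"
  using assms(1)[unfolded H2_vanishes_def, rule_format, of G] assms(2,3) by metis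

section \<open>Syzygy modules and the dimension shift\<close>

definition mat_apply :: "(nat \<Rightarrow> nat \<Rightarrow> 'k::field pol) \<Rightarrow> nat \<Rightarrow> 'k fvec \<Rightarrow> 'k fvec" where
  "mat_apply E n v = (\<lambda>r. \<Sum>c<n. E r c * v c)"

lemma mat_apply_add: "mat_apply E n (u + v) = mat_apply E n u + mat_apply E n v"
  by (auto simp: mat_apply_def fun_eq_iff algebra_simps sum.distrib)

lemma mat_apply_zero [simp]: "mat_apply E n 0 = 0"
  by (auto simp: mat_apply_def fun_eq_iff)

lemma mat_apply_diff: "mat_apply E n (u - v) = mat_apply E n u - mat_apply E n v"
  by (auto simp: mat_apply_def fun_eq_iff algebra_simps sum_subtractf)

lemma mat_apply_smul: "mat_apply E n (c \<odot> v) = c \<odot> mat_apply E n v"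
  by (auto simp: mat_apply_def fun_eq_iff sum_distrib_left algebra_simps)

lemma mat_apply_sum: "mat_apply E n (\<Sum>i\<in>A. f i) = (\<Sum>i\<in>A. mat_apply E n (f i))"
proof (induction A rule: infinite_finite_induct)
  case (insert x F)
  then show ?case unfolding sum.insert[OF insert(1,2)] mat_apply_add by simp
qed (simp_all only: sum.infinite sum.empty mat_apply_zero not_False_eq_True)

lemma mat_apply_xdot: "mat_apply E n (xdot f) = xdot (\<lambda>i. mat_apply E n (f i))"
  by (simp add: xdot_def mat_apply_sum mat_apply_smul)

lemma mat_apply_cross: "mat_apply E n (cross f i) = cross (\<lambda>i. mat_apply E n (f i)) i"
  by (simp add: cross_def mat_apply_diff mat_apply_smul)

lemma mat_apply_graded_part:
  assumes "\<And>r c. r \<ge> length b \<Longrightarrow> E r c = 0"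
    and "\<And>r c. r < length b \<Longrightarrow> c < length b1 \<Longrightarrow> homogeneous (b1 ! c - b ! r) (E r c)"
  shows "mat_apply E (length b1) (graded_part b1 j v) = graded_part b j (mat_apply E (length b1) v)"
proof
  fix r
  have "hom_part (j - b ! r) (E r c * v c) = E r c * hom_part (j - b1 ! c) (v c)"
    if "r < length b" "c < length b1" for c
    using hom_part_mult[OF assms(2)[OF that], of "j - b ! r" "v c"] by simp
  then show "mat_apply E (length b1) (graded_part b1 j v) r = graded_part b j (mat_apply E (length b1) v) r"
    using assms(1) by (auto simp: mat_apply_def graded_part_def hom_part_sum intro!: sum.cong)
qed

text \<open>\<open>Z\<^sub>1\<close> is the first syzygy module of \<open>Z\<close> with respect to the minimal system of generators given by
  the columns of \<open>E\<close>.\<close>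

definition syzygy_step ::
    "int list \<Rightarrow> 'k::field fvec set \<Rightarrow> int list \<Rightarrow> (nat \<Rightarrow> nat \<Rightarrow> 'k pol) \<Rightarrow> 'k fvec set \<Rightarrow> bool" where
  "syzygy_step b Z b1 E Z1 \<longleftrightarrow>
     (\<forall>r c. r \<ge> length b \<longrightarrow> E r c = 0) \<and>
     (\<forall>r<length b. \<forall>c<length b1. homogeneous (b1 ! c - b ! r) (E r c)) \<and>
     mat_apply E (length b1) ` free b1 = Z \<and>
     Z1 = {v \<in> free b1. mat_apply E (length b1) v = 0} \<and>
     (\<forall>v\<in>Z1. \<forall>r. lookup (v r) 0 = 0)"

context
  fixes b Z b1 E Z1
  assumes step: "syzygy_step b (Z :: 'k::field fvec set) b1 E Z1"
begin

abbreviation (input) "E' \<equiv> mat_apply E (length b1)"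

lemma step_graded_part: "v \<in> free b1 \<Longrightarrow> E' (graded_part b1 j v) = graded_part b j (E' v)"
  using step by (intro mat_apply_graded_part) (auto simp: syzygy_step_def)

lemma step_image: "v \<in> free b1 \<Longrightarrow> E' v \<in> Z"
  using step by (auto simp: syzygy_step_def)

lemma step_preimage:
  assumes "z \<in> Z" obtains v where "v \<in> free b1" "E' v = z"
  using step assms by (auto simp: syzygy_step_def)

lemma step_kernel: "v \<in> Z1 \<longleftrightarrow> v \<in> free b1 \<and> E' v = 0"
  using step by (auto simp: syzygy_step_def)

lemma step_minimal: "v \<in> Z1 \<Longrightarrow> lookup (v r) 0 = 0"
  using step by (auto simp: syzygy_step_def)

lemma step_graded:
  assumes "v \<in> graded b1 j" shows "E' v \<in> graded b j"
proof -
  have "v \<in> free b1" using assms by (simp add: graded_def)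
  then have "E' v = graded_part b j (E' v)" using step_graded_part[of v j] graded_part_eq[OF assms, of j] by simp
  then show ?thesis using graded_part_graded by metis
qed

lemma step_kernel_submodule: "graded_submodule b1 Z1"
proof -
  have "graded_submodule b1 (free b1 :: 'k fvec set)" by (rule free_graded_submodule)
  note f = graded_submoduleD[OF this]
  show ?thesis unfolding graded_submodule_def
  proof (intro conjI ballI allI)
    show "Z1 \<subseteq> free b1" using step_kernel by auto
    show "0 \<in> Z1" unfolding step_kernel using f(2) by simp
    show "u + v \<in> Z1" if "u \<in> Z1" "v \<in> Z1" for u v using that f(3) unfolding step_kernel by (simp add: mat_apply_add)
    show "c \<odot> v \<in> Z1" if "v \<in> Z1" for c v using that f(4) unfolding step_kernel by (auto simp add: mat_apply_smul fun_eq_iff)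
    show "graded_part b1 j v \<in> Z1" if "v \<in> Z1" for j v 
      using that f(5) unfolding step_kernel by (auto simp: step_graded_part) (auto simp: graded_part_def fun_eq_iff)
  qed
qed

lemma step_preimage_graded:
  assumes "z \<in> Z" "z \<in> graded b j" obtains v where "v \<in> graded b1 j" "E' v = z"
proof -
  obtain v where v: "v \<in> free b1" "E' v = z" using step_preimage[OF assms(1)] .
  show thesis
    by (rule that[OF graded_part_graded[of b1 j v]]) (use v assms graded_part_eq[OF assms(2), of j] in \<open>simp add: step_graded_part\<close>)
qed

text \<open>By minimality a syzygy is \<open>xdot u\<close> with \<open>u\<close> in the free
  module. The image of \<open>u\<close> is a Koszul cycle of \<open>Z\<close>; lifting a bounding
  element of it corrects \<open>u\<close> to a family of syzygies without changing
  \<open>xdot u\<close>.\<close>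

lemma step_H0:
  assumes "H1_vanishes b Z j" shows "H0_vanishes b1 Z1 j"
  unfolding H0_vanishes_def
proof
  fix z assume z: "z \<in> Z1 \<inter> graded b1 j"
  obtain u where u: "z = xdot u" "\<And>i. u i \<in> graded b1 (j - 1)"
    using koszul0_exact_free[of z b1] z step_minimal graded_def by (metis (no_types, lifting) IntD1 IntD2 graded_free step_kernel)
  have "xdot (\<lambda>i. E' (u i)) = 0"
    using z by (simp add: mat_apply_xdot[symmetric] u(1)[symmetric] step_kernel)
  moreover have "E' (u i) \<in> Z \<inter> graded b (j - 1)" for i
    using step_graded[OF u(2)[of i]] step_image[OF graded_free[OF u(2)[of i]]] by simp
  ultimately obtain F where F: "\<And>i. F i \<in> Z" "\<And>i. E' (u i) = cross F i"
    using H1_vanishesD[OF assms, of "\<lambda>i. E' (u i)"] by metis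
  from F(1) have "\<forall>i. \<exists>w. w \<in> free b1 \<and> E' w = F i" by (metis step_preimage)
  then obtain w where w: "\<And>i. w i \<in> free b1" "\<And>i. E' (w i) = F i" by metis
  let ?u = "\<lambda>i. u i - cross w i"
  have "?u i \<in> Z1" for i
    using u(2)[of i] w F(2) cross_in[OF free_graded_submodule w(1)]
    by (auto simp: step_kernel mat_apply_diff mat_apply_cross graded_def intro!: graded_submodule_diff[OF free_graded_submodule])
  moreover have "z = xdot ?u" by (simp add: xdot_diff u(1))
  ultimately show "\<exists>f. (\<forall>i. f i \<in> Z1) \<and> z = xdot f" by (intro exI[of _ ?u]) simp
qed

text \<open>The same correction one degree up, starting from exactness of the Koszul complex of the
  free module instead of minimality.\<close>

lemma step_H1:
  assumes "H2_vanishes b Z j" shows "H1_vanishes b1 Z1 j"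
  unfolding H1_vanishes_def
proof (intro allI impI, elim conjE)
  fix f assume f: "\<forall>i. f i \<in> Z1 \<inter> graded b1 (j - 1)" and 0: "xdot f = 0"
  obtain u where u: "\<And>i. f i = cross u i" "\<And>i. u i \<in> graded b1 (j - 1 - 1)"
    using koszul1_exact_free[OF _ 0, of b1] f by (metis (no_types, lifting) Int_iff step_kernel)
  have "cross (\<lambda>i. E' (u i)) i = 0" for i
    using f by (simp add: mat_apply_cross[symmetric] u(1)[symmetric] step_kernel)
  moreover have "E' (u i) \<in> Z \<inter> graded b (j - 2)" for i
    using step_graded[OF u(2)[of i]] step_image[OF graded_free[OF u(2)[of i]]] by simp
  ultimately obtain h where h: "h \<in> Z" "\<And>i. E' (u i) = var i \<odot> h"
    using H2_vanishesD[OF assms, of "\<lambda>i. E' (u i)"] by metis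
  obtain w where w: "w \<in> free b1" "E' w = h" using step_preimage[OF h(1)] .
  let ?u = "\<lambda>i. u i - var i \<odot> w"
  have "?u i \<in> Z1" for i
    using u(2)[of i] w h graded_submoduleD(4)[OF free_graded_submodule w(1), of "var i"]
    by (auto simp: step_kernel mat_apply_diff mat_apply_smul graded_def intro!: graded_submodule_diff[OF free_graded_submodule])
  moreover have "f i = cross ?u i" for i by (simp add: cross_diff u(1))
  ultimately show "\<exists>G. (\<forall>i. G i \<in> Z1) \<and> (\<forall>i. f i = cross G i)" by (intro exI[of _ ?u]) simp
qed

text \<open>If x_0 times the image of \<open>h\<close> is zero, so is the image, because
  \<open>Z\<close> lies in a free module. Every syzygy module thus has no second homology; two more
  shifts give Hilbert's bound on the length of resolutions.\<close>

lemma step_H2: "H2_vanishes b1 Z1 j"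
  unfolding H2_vanishes_def
proof (intro allI impI, elim conjE)
  fix G assume G: "\<forall>i. G i \<in> Z1 \<inter> graded b1 (j - 2)" and 0: "\<forall>i. cross G i = 0"
  have "G i \<in> free b1" for i using G by (simp add: step_kernel)
  then obtain h where h: "\<And>i. G i = var i \<odot> h" "h \<in> free b1" 
    using koszul2_exact_free[of G b1] 0 by metis
  have "var 0 \<odot> E' h = 0" using G h(1)[of 0] by (metis IntD1 mat_apply_smul step_kernel)
  then have "E' h = 0" by (simp add: fun_eq_iff)
  with h show "\<exists>h\<in>Z1. \<forall>i. G i = var i \<odot> h" by (auto simp: step_kernel)
qed

text \<open>A cycle of \<open>Z\<close> lifts to a family \<open>u\<close> for which
  \<open>xdot u\<close> is a syzygy. Writing it as \<open>xdot w\<close> with syzygies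
  \<open>w\<close> makes \<open>u - w\<close> a cycle in the free module, hence a boundary, and its
  image is the given cycle.\<close>

lemma step_H1_converse:
  assumes "H0_vanishes b1 Z1 j" shows "H1_vanishes b Z j"
  unfolding H1_vanishes_def
proof (intro allI impI, elim conjE)
  fix f assume f: "\<forall>i. f i \<in> Z \<inter> graded b (j - 1)" and 0: "xdot f = 0"
  then have "\<exists>u. u \<in> graded b1 (j - 1) \<and> E' u = f i" for i
    using step_preimage_graded[of "f i" "j - 1"] by (metis IntE)
  then obtain u where u: "\<And>i. u i \<in> graded b1 (j - 1)" "\<And>i. E' (u i) = f i" by metis
  have uf: "u i \<in> free b1" for i using u(1) by (simp add: graded_def)
  have "xdot u \<in> graded b1 j"
    unfolding xdot_def using u(1) by (intro graded_sum graded_shift)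
  moreover have "xdot u \<in> Z1"
    using xdot_in[OF free_graded_submodule uf] u(2) 0 by (simp add: step_kernel mat_apply_xdot)
  ultimately obtain w where w: "\<And>i. w i \<in> Z1" "xdot u = xdot w"
    using H0_vanishesD[OF assms] by metis
  have "u i - w i \<in> free b1" for i
    using w(1)[of i] uf by (intro graded_submodule_diff[OF free_graded_submodule]) (auto simp: step_kernel)
  moreover have "xdot (\<lambda>i. u i - w i) = 0" using w(2) by (simp add: xdot_diff)
  ultimately obtain G where G: "\<And>i. u i - w i = cross G i" "\<And>i. G i \<in> free b1"
    using koszul1_exact_free[of "\<lambda>i. u i - w i" b1] by metis
  have "f i = cross (\<lambda>i. E' (G i)) i" for i
    using w(1)[of i] by (simp add: mat_apply_cross[symmetric] G(1)[symmetric] mat_apply_diff u(2) step_kernel)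
  then show "\<exists>G. (\<forall>i. G i \<in> Z) \<and> (\<forall>i. f i = cross G i)"
    using step_image[OF G(2)] by (intro exI[of _ "\<lambda>i. E' (G i)"]) simp
qed

text \<open>If the image of a basis element were \<open>xdot f\<close>, subtracting a lift would
  produce a syzygy with constant term 1 at that basis element, against minimality.\<close>

lemma step_generator_degree:
  assumes "H0_vanishes b Z j" shows "j \<notin> set b1"
proof
  assume "j \<in> set b1"
  then obtain r where r: "r < length b1" "b1 ! r = j" by (auto simp: in_set_conv_nth)
  define v :: "'k fvec" where "v = (\<lambda>s. if s = r then 1 else 0)"
  have v: "v \<in> graded b1 j"
    using r by (auto simp: v_def graded_def free_def homogeneous_iff)
  then have "E' v \<in> Z \<inter> graded b j" using step_graded step_image[OF graded_free] by simp
  then obtain f where f: "\<And>i. f i \<in> Z" "E' v = xdot f"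
    using H0_vanishesD[OF assms] by (metis Int_iff)
  from f(1) have "\<forall>i. \<exists>w. w \<in> free b1 \<and> E' w = f i" by (metis step_preimage)
  then obtain w where w: "\<And>i. w i \<in> free b1" "\<And>i. E' (w i) = f i" by metis
  have "v - xdot w \<in> Z1"
    using v f(2) w(2) xdot_in[OF free_graded_submodule w(1)] unfolding step_kernel
    by (auto simp: mat_apply_diff mat_apply_xdot graded_def intro!: graded_submodule_diff[OF free_graded_submodule])
  from step_minimal[OF this, of r] show False
    by (simp add: v_def xdot_apply lookup_minus lookup_sum)
qed

text \<open>Without a basis element of degree \<open>j\<close>, no entry of a preimage of degree
  \<open>j\<close> can have a constant term, so the preimage already lies in the multiples of the
  variables.\<close>

lemma step_no_generator:
  assumes "j \<notin> set b1" shows "H0_vanishes b Z j"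
  unfolding H0_vanishes_def
proof
  fix z assume "z \<in> Z \<inter> graded b j"
  then obtain v where v: "v \<in> graded b1 j" "E' v = z" using step_preimage_graded by blast
  have "lookup (v r) 0 = 0" for r
  proof (cases "r < length b1")
    case True
    then have "j - b1 ! r \<noteq> 0" using assms by auto
    moreover have "homogeneous (j - b1 ! r) (v r)" using True v(1) by (simp add: graded_def)
    ultimately show ?thesis unfolding homogeneous_iff' by (metis deg_zero)
  qed (use v(1) in \<open>simp add: graded_def free_def\<close>)
  then obtain g where g: "v = xdot g" "\<And>i. g i \<in> free b1"
    using koszul0_exact_free[OF graded_free[OF v(1)]] by (metis)
  then show "\<exists>f. (\<forall>i. f i \<in> Z) \<and> z = xdot f"
    using v(2) step_image by (intro exI[of _ "\<lambda>i. E' (g i)"]) (simp add: mat_apply_xdot)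
qed

end

section \<open>Minimal resolutions\<close>

interpretation fvec: Modules.module smul
  by standard (auto simp: fun_eq_iff algebra_simps)

section \<open>Finite generation and minimal generators\<close>

lemma finite_deg: "finite {m. deg m = j}"
proof (rule finite_imageD)
  have "lookup m x \<le> nat j" if "deg m = j" for m x
  proof -
    have "int (lookup m x) \<le> deg m"
      unfolding deg_def by (rule member_le_sum) auto
    with that show ?thesis by simp
  qed
  then have "lookup ` {m. deg m = j} \<subseteq> {f. \<forall>x. (x \<in> UNIV \<longrightarrow> f x \<in> {..nat j}) \<and> (x \<notin> UNIV \<longrightarrow> f x = 0)}"
    by auto
  then show "finite (lookup ` {m. deg m = j})"
    by (rule finite_subset) (rule finite_set_of_finite_funs; simp)
  show "inj_on lookup {m. deg m = j}"
    by (simp add: inj_on_def)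
qed

lemma sum_monomials: "p = (\<Sum>m\<in>keys p. single m (lookup p m))"
proof (rule poly_mapping_eqI)
  fix m
  have "(\<Sum>n\<in>keys p. lookup (single n (lookup p n)) m) =
      (\<Sum>n\<in>keys p. if n = m then lookup p m else 0)"
    by (rule sum.cong) (auto simp: lookup_single when_def)
  then show "lookup p m =
      lookup (\<Sum>m\<in>keys p. single m (lookup p m)) m"
    by (simp add: lookup_sum in_keys_iff)
qed

text \<open>Constants, embedded as \<open>single 0 c\<close>, make the graded piece of a free module
  a vector space spanned by the finitely many monomial vectors in \<open>T\<close>. A maximal
  independent subset of the piece of \<open>Z\<close> is therefore finite, and it spans over the
  polynomials too.\<close>

lemma graded_pieces_finitely_generated:
  fixes Z :: "'k::field fvec set"
  assumes Z: "graded_submodule b Z"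
  obtains B where "finite B" "B \<subseteq> Z \<inter> graded b j" "Z \<inter> graded b j \<subseteq> fvec.span B"
proof -
  interpret vs: vector_space "\<lambda>(c::'k) (v::'k fvec). single 0 c \<odot> v"
    by standard (auto simp: fun_eq_iff algebra_simps mult_single single_add)
  define u :: "nat \<Rightarrow> expo \<Rightarrow> 'k fvec" where
    "u r m = (\<lambda>s. if s = r then single m 1 else 0)" for r m
  define T where "T = (\<Union>r<length b. u r ` {m. deg m = j - b ! r})"
  have T: "finite T" unfolding T_def using finite_deg by blast
  have "v \<in> vs.span T" if v: "v \<in> graded b j" for v
  proof -
    have "v = (\<Sum>r<length b. \<Sum>m\<in>keys (v r).
        single 0 (lookup (v r) m) \<odot> u r m)"
    proof
      fix s
      have "(\<Sum>r<length b. \<Sum>m\<in>keys (v r).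
          single 0 (lookup (v r) m) \<odot> u r m) s =
        (\<Sum>r<length b. if r = s then v s else 0)"
        unfolding sum_fun_apply
      proof (rule sum.cong)
        fix r assume "r \<in> {..<length b}"
        show "(\<Sum>m\<in>keys (v r). (single 0 (lookup (v r) m) \<odot> u r m) s) =
           (if r = s then v s else 0)"
          using sum_monomials[of "v s"] by (auto simp: u_def mult_single sum.neutral)
      qed simp
      also have "\<dots> = v s" using v by (auto simp: graded_def free_def)
      finally show "v s = (\<Sum>r<length b. \<Sum>m\<in>keys (v r).
          single 0 (lookup (v r) m) \<odot> u r m) s" ..
    qed
    also have "\<dots> \<in> vs.span T"
      using v by (intro vs.span_sum vs.span_scale vs.span_base) (auto simp: T_def graded_def homogeneous_iff)
    finally show ?thesis .
  qed
  obtain B where B: "B \<subseteq> Z \<inter> graded b j" "vs.independent B" "Z \<inter> graded b j \<subseteq> vs.span B"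
    using vs.maximal_independent_subset[of "Z \<inter> graded b j"] by metis
  have "finite B"
    using vs.independent_span_bound[OF T B(2)] B(1) \<open>\<And>v. v \<in> graded b j \<Longrightarrow> v \<in> vs.span T\<close> by blast
  moreover have "vs.span B \<subseteq> fvec.span B"
  proof
    fix v assume "v \<in> vs.span B"
    then show "v \<in> fvec.span B"
    proof (induction rule: vs.span_induct_alt)
      case base show ?case by (rule fvec.span_zero)
    next
      case (step c x y)
      then show ?case using fvec.span_add[OF fvec.span_scale[OF fvec.span_base]] by metis
    qed
  qed
  ultimately show thesis using that B by blast
qed

text \<open>Above \<open>N\<close> vanishing homology reduces an element to elements of one degree
  less, so finitely many graded pieces generate everything.\<close>

lemma finitely_generated:
  fixes Z :: "'k::field fvec set"
  assumes Z: "graded_submodule b Z" and H0: "\<And>j. j > N \<Longrightarrow> H0_vanishes b Z j"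
  obtains B where "finite B" "B \<subseteq> Z" "\<forall>w\<in>B. \<exists>j. w \<in> graded b j" "Z \<subseteq> fvec.span B"
proof -
  have "\<exists>B. finite B \<and> B \<subseteq> Z \<inter> graded b j \<and> Z \<inter> graded b j \<subseteq> fvec.span B" for j
    using graded_pieces_finitely_generated[OF Z] by metis
  then obtain B where B: "finite (B j)" "B j \<subseteq> Z \<inter> graded b j" "Z \<inter> graded b j \<subseteq> fvec.span (B j)" for j
    by metis
  \<comment> \<open>There is nothing nonzero below the least degree of a basis element. For empty
    \<open>b\<close> the value is arbitrary, since the free module is then zero.\<close>
  define lo where "lo = (if b = [] then 0 else Min (set b))"
  have lo: "lo \<le> b ! r" if "r < length b" for r
    using that by (auto simp: lo_def)
  define BB where "BB = (\<Union>j\<in>{lo..N}. B j)"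
  have gen: "z \<in> fvec.span BB" if "z \<in> Z" "z \<in> graded b j" for j z
    using that
  proof (induction "nat (j - lo + 1)" arbitrary: j z rule: less_induct)
    case less
    consider "j < lo" | "lo \<le> j" "j \<le> N" | "lo \<le> j" "j > N" by linarith
    then show ?case
    proof cases
      case 1
      have "z r = 0" for r
      proof (cases "r < length b")
        case True
        then have "homogeneous (j - b ! r) (z r)" using less by (simp add: graded_def)
        then show ?thesis using 1 lo[OF True] by (intro homogeneous_negative[of "j - b ! r"]) auto
      qed (use less in \<open>simp add: graded_def free_def\<close>)
      then have "z = 0" by (simp add: fun_eq_iff)
      then show ?thesis by (simp only: fvec.span_zero)
    next
      case 2
      then have "B j \<subseteq> BB" by (auto simp: BB_def)
      then show ?thesis using B(3)[of j] less fvec.span_mono by blast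
    next
      case 3
      obtain f where f: "\<And>i. f i \<in> Z" "z = xdot f"
        using H0_vanishesD[OF H0[OF 3(2)]] less(2,3) by metis
      \<comment> \<open>The \<open>f i\<close> need not be homogeneous; comparing graded parts makes
        the induction hypothesis applicable to them.\<close>
      have "z = graded_part b j z" using graded_part_eq[OF less(3), of j] by simp
      also have "\<dots> = (\<Sum>i\<in>UNIV. var i \<odot> graded_part b (j - 1) (f i))"
        unfolding f(2) xdot_def by (simp add: graded_part_sum graded_part_var_smul)
      also have "\<dots> \<in> fvec.span BB"
        using 3 f(1) by (intro fvec.span_sum fvec.span_scale less(1)[of "j - 1"]) (auto intro: graded_submoduleD(5)[OF Z])
      finally show ?thesis .
    qed
  qed
  show thesis
  proof
    show "finite BB" "BB \<subseteq> Z" "\<forall>w\<in>BB. \<exists>j. w \<in> graded b j" using B unfolding BB_def by blast+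
    show "Z \<subseteq> fvec.span BB"
    proof
      fix z assume z: "z \<in> Z"
      obtain J where "z = (\<Sum>j\<in>J. graded_part b j z)"
        using sum_graded_part graded_submoduleD(1)[OF Z z] by metis
      also have "\<dots> \<in> fvec.span BB"
        by (intro fvec.span_sum gen[OF graded_submoduleD(5)[OF Z z] graded_part_graded])
      finally show "z \<in> fvec.span BB" .
    qed
  qed
qed

lemma hom_part_0: "hom_part 0 p = single 0 (lookup p 0)"
  by (rule poly_mapping_eqI) (auto simp: lookup_hom_part lookup_single when_def)

text \<open>A homogeneous generating set of least cardinality works: a syzygy with a nonzero
  constant term would express one generator by the others.\<close>

lemma exists_syzygy_step:
  fixes Z :: "'k::field fvec set"
  assumes Z: "graded_submodule b Z" and H0: "\<And>j. j > N \<Longrightarrow> H0_vanishes b Z j"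
  shows "\<exists>b1 E Z1. syzygy_step b Z b1 E Z1"
proof -
  define gens where "gens B \<longleftrightarrow> finite B \<and> B \<subseteq> Z \<and> (\<forall>w\<in>B. \<exists>j. w \<in> graded b j) \<and> Z \<subseteq> fvec.span B" for B
  have "\<exists>B. gens B" using finitely_generated[OF Z H0] unfolding gens_def by metis
  then obtain B where B: "gens B" and min: "\<And>B'. gens B' \<Longrightarrow> card B \<le> card B'"
    using ex_has_least_nat[of gens _ card] by metis
  have "finite B" using B by (simp add: gens_def)
  then obtain g where g: "set g = B" "distinct g" using finite_distinct_list by blast
  have "\<forall>w\<in>B. \<exists>j. w \<in> graded b j" using B by (simp add: gens_def)
  then obtain dg where dg: "\<And>w. w \<in> B \<Longrightarrow> w \<in> graded b (dg w)" by metis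
  define b1 where "b1 = map dg g"
  define E where "E r c = (if r < length b \<and> c < length g then (g ! c) r else 0)" for r c
  have len [simp]: "length b1 = length g" by (simp add: b1_def)
  have gB: "g ! c \<in> B" if "c < length g" for c using g that by auto
  have mvE: "mat_apply E (length g) v = (\<Sum>c<length g. v c \<odot> g ! c)" for v
  proof
    fix r
    have "v c * (g ! c) r = E r c * v c" if "c < length g" for c
    proof (cases "r < length b")
      case False
      then have "(g ! c) r = 0" using dg[OF gB[OF that]] by (simp add: graded_def free_def)
      then show ?thesis by (simp add: E_def)
    qed (use that in \<open>simp add: E_def\<close>)
    then show "mat_apply E (length g) v r = (\<Sum>c<length g. v c \<odot> g ! c) r"
      unfolding mat_apply_def sum_fun_apply smul_apply by (intro sum.cong refl) (metis lessThan_iff)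
  qed
  have img: "mat_apply E (length b1) ` free b1 = Z"
  proof (intro equalityI subsetI)
    fix z assume "z \<in> mat_apply E (length b1) ` free b1"
    then obtain v where "z = (\<Sum>c<length g. v c \<odot> g ! c)" by (auto simp: mvE)
    also have "\<dots> \<in> Z"
      using gB B by (intro graded_submodule_sum[OF Z] graded_submoduleD(4)[OF Z]) (auto simp: gens_def)
    finally show "z \<in> Z" .
  next
    fix z assume "z \<in> Z"
    then have "z \<in> fvec.span B" using B by (auto simp: gens_def)
    then obtain u where "z = (\<Sum>w\<in>B. u w \<odot> w)"
      using fvec.span_finite[of B] B by (auto simp: gens_def)
    also have "\<dots> = (\<Sum>c<length g. u (g ! c) \<odot> g ! c)"
      using g by (intro sum.reindex_bij_betw[symmetric] bij_betw_nth) (auto)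
    also have "\<dots> = mat_apply E (length b1) (\<lambda>c. if c < length g then u (g ! c) else 0)"
      by (auto simp: mvE intro!: sum.cong)
    finally show "z \<in> mat_apply E (length b1) ` free b1" by (auto simp: free_def)
  qed
  have hom: "homogeneous (b1 ! c - b ! r) (E r c)" if "r < length b" "c < length b1" for r c
    using that dg[OF gB[of c]] by (auto simp: E_def b1_def graded_def)
  have minimal: "lookup (v r) 0 = 0" if v: "v \<in> free b1" "mat_apply E (length b1) v = 0" for v r
  proof (rule ccontr)
    assume nz: "lookup (v r) 0 \<noteq> 0"
    then have r: "r < length g" using v by (auto simp: free_def intro: ccontr)
    \<comment> \<open>In the graded part of the degree of generator \<open>r\<close>, the entry at
      \<open>r\<close> is a nonzero constant, so it can be inverted.\<close>
    define u where "u = graded_part b1 (b1 ! r) v"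
    define a where "a = lookup (v r) 0"
    have ur: "u r = single 0 a"
      using r by (simp add: u_def graded_part_def hom_part_0 a_def)
    have "mat_apply E (length b1) u = graded_part b (b1 ! r) (mat_apply E (length b1) v)"
      unfolding u_def by (rule mat_apply_graded_part) (use hom in \<open>auto simp: E_def\<close>)
    also have "\<dots> = 0" unfolding v(2) by (auto simp: graded_part_def fun_eq_iff)
    finally have "(\<Sum>c<length g. u c \<odot> g ! c) = 0" by (simp add: mvE)
    then have "u r \<odot> g ! r + (\<Sum>c\<in>{..<length g} - {r}. u c \<odot> g ! c) = 0"
      using r by (subst (asm) sum.remove[of _ r]) auto
    then have "u r \<odot> g ! r = - (\<Sum>c\<in>{..<length g} - {r}. u c \<odot> g ! c)"
      by (simp only: eq_neg_iff_add_eq_0)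
    also have "\<dots> \<in> fvec.span (B - {g ! r})"
      using r g by (intro fvec.span_neg fvec.span_sum fvec.span_scale fvec.span_base)
        (auto simp: nth_eq_iff_index_eq)
    finally have "single 0 (1 / a) \<odot> u r \<odot> g ! r \<in> fvec.span (B - {g ! r})"
      by (rule fvec.span_scale)
    also have "single 0 (1 / a) \<odot> u r \<odot> g ! r = g ! r"
      using nz by (auto simp: fun_eq_iff ur a_def mult.assoc[symmetric] mult_single)
    finally have "B \<subseteq> fvec.span (B - {g ! r})"
      using fvec.span_base[of _ "B - {g ! r}"] by blast
    then have "fvec.span B \<subseteq> fvec.span (B - {g ! r})"
      by (rule fvec.span_minimal) simp
    then have "gens (B - {g ! r})" using B by (auto simp: gens_def)
    from min[OF this] show False
      using gB[OF r] B by (metis card_Diff1_less gens_def not_le)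
  qed
  have "syzygy_step b Z b1 E {v \<in> free b1. mat_apply E (length b1) v = 0}"
    unfolding syzygy_step_def using img hom minimal by (auto simp: E_def)
  then show ?thesis by blast
qed

text \<open>The index is shifted: \<open>bb 0\<close> belongs to the free module containing
  \<open>Z\<close>, so the i-th module of the resolution has the degrees \<open>bb (Suc i)\<close>,
  and \<open>ZZ i\<close> is the i-th syzygy module.\<close>

definition minimal_resolution ::
    "int list \<Rightarrow> 'k::field fvec set \<Rightarrow> (nat \<Rightarrow> int list) \<Rightarrow> (nat \<Rightarrow> 'k fvec set) \<Rightarrow> bool" where
  "minimal_resolution b Z bb ZZ \<longleftrightarrow> bb 0 = b \<and> ZZ 0 = Z \<and>
     (\<forall>i. \<exists>E. syzygy_step (bb i) (ZZ i) (bb (Suc i)) E (ZZ (Suc i)))"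

text \<open>Passing to syzygies lowers the homological degree of the vanishing by one and
  \<open>step_H2\<close> refills the top, so the same \<open>N\<close> serves every step.\<close>

lemma exists_minimal_resolution:
  fixes Z :: "'k::field fvec set"
  assumes "graded_submodule b Z"
    and "\<And>j. j > N \<Longrightarrow> H0_vanishes b Z j" "\<And>j. j > N \<Longrightarrow> H1_vanishes b Z j" "\<And>j. j > N \<Longrightarrow> H2_vanishes b Z j"
  shows "\<exists>bb ZZ. minimal_resolution b Z bb ZZ"
proof -
  define P where "P n p \<longleftrightarrow> graded_submodule (fst p) (snd p) \<and>
      (\<forall>j>N. H0_vanishes (fst p) (snd p) j \<and> H1_vanishes (fst p) (snd p) j \<and> H2_vanishes (fst p) (snd p) j) \<and>
      (n = 0 \<longrightarrow> p = (b, Z))" for n :: nat and p :: "int list \<times> 'k fvec set"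
  define Q where "Q n p q \<longleftrightarrow> (\<exists>E. syzygy_step (fst p) (snd p) (fst q) E (snd q))"
    for n :: nat and p q :: "int list \<times> 'k fvec set"
  have "\<exists>F. \<forall>i. P i (F i) \<and> Q i (F i) (F (Suc i))"
  proof (rule dependent_nat_choice)
    show "\<exists>p. P 0 p" using assms by (auto simp: P_def)
    fix p :: "int list \<times> 'k fvec set" and n :: nat
    assume p: "P n p"
    obtain b' Z' where [simp]: "p = (b', Z')" by (cases p)
    obtain b1 E Z1 where E: "syzygy_step b' Z' b1 E Z1"
      using exists_syzygy_step[of b' Z' N] p by (auto simp: P_def)
    have "P (Suc n) (b1, Z1)"
      using p step_kernel_submodule[OF E] step_H0[OF E] step_H1[OF E] step_H2[OF E] by (auto simp: P_def)
    then show "\<exists>q. P (Suc n) q \<and> Q n p q"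
      using E by (intro exI[of _ "(b1, Z1)"]) (auto simp: Q_def)
  qed
  then obtain F where "F 0 = (b, Z)"
    "\<And>i. \<exists>E. syzygy_step (fst (F i)) (snd (F i)) (fst (F (Suc i))) E (snd (F (Suc i)))"
    unfolding P_def Q_def by blast
  then have "minimal_resolution b Z (fst \<circ> F) (snd \<circ> F)"
    by (simp add: minimal_resolution_def)
  then show ?thesis by blast
qed

text \<open>A basis element of degree \<open>j\<close> in the i-th module forces nonzero i-th Koszul
  homology of \<open>Z\<close> in degree \<open>j\<close>, by i shifts. Beyond i = 2 the shifts end
  in a second homology of a syzygy module, which is zero.\<close>

lemma minimal_resolution_bound:
  assumes res: "minimal_resolution b Z bb ZZ"
    and 0: "\<And>j. j > N \<Longrightarrow> H0_vanishes b Z j"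
    and 1: "\<And>j. j > N + 1 \<Longrightarrow> H1_vanishes b Z j"
    and 2: "\<And>j. j > N + 2 \<Longrightarrow> H2_vanishes b Z j"
    and j: "j \<in> set (bb (Suc i))"
  shows "i \<le> 2 \<and> j \<le> N + int i"
proof -
  have "\<exists>E. syzygy_step (bb i) (ZZ i) (bb (Suc i)) E (ZZ (Suc i))" for i
    using res by (simp add: minimal_resolution_def)
  then obtain E where E: "syzygy_step (bb i) (ZZ i) (bb (Suc i)) (E i) (ZZ (Suc i))" for i
    by metis
  have [simp]: "bb 0 = b" "ZZ 0 = Z" using res by (auto simp: minimal_resolution_def)
  have "H2_vanishes (bb (Suc i)) (ZZ (Suc i)) j" for i j using step_H2[OF E] .
  then have H1: "H1_vanishes (bb (Suc (Suc i))) (ZZ (Suc (Suc i))) j" for i j by (rule step_H1[OF E])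
  then have H0: "H0_vanishes (bb (Suc (Suc (Suc i)))) (ZZ (Suc (Suc (Suc i)))) j" for i j by (rule step_H0[OF E])
  have h: "\<not> H0_vanishes (bb i) (ZZ i) j" using step_generator_degree[OF E, of i j] j by blast
  consider "i = 0" | "i = 1" | "i = 2" | k where "i = Suc (Suc (Suc k))"
    by (metis One_nat_def Suc_1 not0_implies_Suc)
  then show ?thesis
  proof cases
    case 1 then show ?thesis using h 0[of j] by force
  next
    case 2 then show ?thesis using h step_H0[OF E[of 0], of j] 1[of j] by force
  next
    case 3
    then show ?thesis using h step_H0[OF E[of 1], of j] step_H1[OF E[of 0], of j] 2[of j] by (force simp: numeral_2_eq_2)
  next
    case 4 then show ?thesis using h H0 by blast
  qed
qed

section \<open>Translation between matrix resolutions and chains of syzygy modules\<close>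

definition embed :: "'k::field pol \<Rightarrow> 'k fvec" where
  "embed p = (\<lambda>r. if r = 0 then p else 0)"

lemma embed_apply [simp]: "embed p 0 = p" "embed p (Suc r) = 0"
  by (simp_all add: embed_def)

lemma inj_embed: "inj embed"
  by (metis embed_apply(1) injI)

lemma embed_eq_iff [simp]: "embed p = embed q \<longleftrightarrow> p = q"
  by (metis embed_apply(1))

definition vec_fun :: "'k::field pol Matrix.vec \<Rightarrow> 'k fvec" where
  "vec_fun v = (\<lambda>r. if r < dim_vec v then vec_index v r else 0)"

definition mat_fun :: "'k::field pol Matrix.mat \<Rightarrow> nat \<Rightarrow> nat \<Rightarrow> 'k pol" where
  "mat_fun A r c = (if r < dim_row A \<and> c < dim_col A then A $$ (r, c) else 0)"

lemma inj_on_vec_fun: "inj_on vec_fun (carrier_vec n)"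
proof (rule inj_onI)
  fix u v :: "'k::field pol Matrix.vec" assume uv: "u \<in> carrier_vec n" "v \<in> carrier_vec n" "vec_fun u = vec_fun v"
  show "u = v"
  proof (rule eq_vecI)
    fix i assume "i < dim_vec v"
    then show "vec_index u i = vec_index v i"
      using fun_cong[OF uv(3), of i] uv by (simp add: vec_fun_def)
  qed (use uv in simp)
qed

lemma vec_fun_image: "vec_fun ` carrier_vec (length b) = free b"
proof (intro equalityI subsetI)
  fix v :: "'k::field fvec" assume "v \<in> free b"
  then have "v = vec_fun (Matrix.vec (length b) v)" by (auto simp: vec_fun_def free_def)
  then show "v \<in> vec_fun ` carrier_vec (length b)" by (metis imageI Matrix.vec_carrier)
qed (auto simp: vec_fun_def free_def)

lemma vec_fun_image_Collect: "vec_fun ` {v \<in> carrier_vec (length b). P (vec_fun v)} = {v \<in> free b. P v}"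
  unfolding vec_fun_image[symmetric] by auto

lemma vec_fun_eq_iff: "u \<in> carrier_vec n \<Longrightarrow> v \<in> carrier_vec n \<Longrightarrow> vec_fun u = vec_fun v \<longleftrightarrow> u = v"
  using inj_on_vec_fun by (metis inj_onD)

lemma vec_fun_zero [simp]: "vec_fun (0\<^sub>v n) = 0"
  by (auto simp: vec_fun_def)

lemma vec_fun_mult:
  assumes "A \<in> carrier_mat m n" "v \<in> carrier_vec n"
  shows "vec_fun (A *\<^sub>v v) = mat_apply (mat_fun A) n (vec_fun v)"
proof
  fix r
  show "vec_fun (A *\<^sub>v v) r = mat_apply (mat_fun A) n (vec_fun v) r"
    using assms by (auto simp: vec_fun_def mat_fun_def mat_apply_def scalar_prod_def atLeast0LessThan intro!: sum.cong)
qed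

lemma embed_augmentation:
  assumes "v \<in> carrier_vec (length g)"
  shows "embed (augmentation (*) g v) = mat_apply (\<lambda>r c. if r = 0 \<and> c < length g then g ! c else 0) (length g) (vec_fun v)"
proof
  fix r
  show "embed (augmentation (*) g v) r =
      mat_apply (\<lambda>r c. if r = 0 \<and> c < length g then g ! c else 0) (length g) (vec_fun v) r"
    using assms by (cases r) (auto simp: augmentation_def mat_apply_def vec_fun_def mult.commute intro!: sum.cong)
qed

lemma lookup_mult_0:
  fixes p q :: "'k::field pol"
  assumes "lookup p 0 = 0" shows "lookup (p * q) 0 = 0"
proof (rule ccontr)
  assume "lookup (p * q) 0 \<noteq> 0"
  then obtain a b where "0 = a + b" "a \<in> keys p"
    using keys_mult[of p q] by (auto simp: in_keys_iff)
  moreover from this have "deg a + deg b = 0" by (metis deg_add deg_zero)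
  then have "deg a = 0" using deg_nonneg[of a] deg_nonneg[of b] by linarith
  ultimately show False using assms by (simp add: in_keys_iff)
qed

lemma minimal_graded_free_resolution_imp:
  fixes I :: "'k::field pol set"
  assumes res: "minimal_graded_free_resolution (*) I (\<lambda>j. {f \<in> I. homogeneous j f}) b g D"
  shows "\<exists>ZZ. minimal_resolution [0] (embed ` I) (case_nat [0] b) ZZ"
proof -
  define EE where "EE i = (case i of 0 \<Rightarrow> (\<lambda>r c. if r = 0 \<and> c < length (b 0) then g ! c else 0)
    | Suc k \<Rightarrow> mat_fun (D k))" for i
  define ZZ where "ZZ i = (case i of 0 \<Rightarrow> embed ` I
    | Suc k \<Rightarrow> {v \<in> free (b k). mat_apply (EE k) (length (b k)) v = 0})" for i
  have lg: "length g = length (b 0)"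
    and g: "\<And>r. r < length (b 0) \<Longrightarrow> homogeneous (b 0 ! r) (g ! r)"
    and D: "\<And>i. D i \<in> carrier_mat (length (b i)) (length (b (Suc i)))"
    and hD: "\<And>i r c. r < length (b i) \<Longrightarrow> c < length (b (Suc i)) \<Longrightarrow> homogeneous (b (Suc i) ! c - b i ! r) (D i $$ (r, c))"
    and aug: "augmentation (*) g ` carrier_vec (length (b 0)) = I"
    and ker0: "{v \<in> carrier_vec (length (b 0)). augmentation (*) g v = 0} =
       (*\<^sub>v) (D 0) ` carrier_vec (length (b 1))"
    and ker: "\<And>i. {v \<in> carrier_vec (length (b (Suc i))). D i *\<^sub>v v = 0\<^sub>v (length (b i))} =
        (*\<^sub>v) (D (Suc i)) ` carrier_vec (length (b (Suc (Suc i))))"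
    and min: "\<And>i r c. r < length (b i) \<Longrightarrow> c < length (b (Suc i)) \<Longrightarrow> lookup (D i $$ (r, c)) 0 = 0"
    using res unfolding minimal_graded_free_resolution_def by auto
  have vD: "vec_fun ` (*\<^sub>v) (D k) ` carrier_vec (length (b (Suc k))) =
      mat_apply (EE (Suc k)) (length (b (Suc k))) ` free (b (Suc k))" for k
    unfolding vec_fun_image[symmetric] image_image EE_def using vec_fun_mult[OF D[of k]] by (auto intro!: image_cong)
  have vg: "embed (augmentation (*) g v) = mat_apply (EE 0) (length (b 0)) (vec_fun v)" if "v \<in> carrier_vec (length (b 0))" for v
    using embed_augmentation[of v g] that by (simp add: lg EE_def)
  have img: "mat_apply (EE i) (length (b i)) ` free (b i) = ZZ i" for i
  proof -
    consider "i = 0" | "i = 1" | k where "i = Suc (Suc k)" by (metis One_nat_def not0_implies_Suc)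
    then show ?thesis
    proof cases
      case 1
      then show ?thesis
        unfolding aug[symmetric] vec_fun_image[symmetric] ZZ_def image_image by (auto simp: vg intro!: image_cong)
    next
      case 2
      have "{v \<in> carrier_vec (length (b 0)). augmentation (*) g v = 0} =
          {v \<in> carrier_vec (length (b 0)). mat_apply (EE 0) (length (b 0)) (vec_fun v) = 0}"
        using vg by (metis (no_types, lifting) embed_eq_iff embed_def ext zero_fun_apply)
      then show ?thesis
        using vD[of 0] ker0 vec_fun_image_Collect[of "b 0" "\<lambda>v. mat_apply (EE 0) (length (b 0)) v = 0"] 2 by (simp add: ZZ_def)
    next
      case 3
      have "{v \<in> carrier_vec (length (b (Suc k))). D k *\<^sub>v v = 0\<^sub>v (length (b k))} =
          {v \<in> carrier_vec (length (b (Suc k))). mat_apply (EE (Suc k)) (length (b (Suc k))) (vec_fun v) = 0}"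
      proof (rule Collect_cong, rule conj_cong[OF refl])
        fix v :: "'k pol Matrix.vec" assume v: "v \<in> carrier_vec (length (b (Suc k)))"
        have "vec_fun (D k *\<^sub>v v) = vec_fun (0\<^sub>v (length (b k))) \<longleftrightarrow> D k *\<^sub>v v = 0\<^sub>v (length (b k))"
          by (rule vec_fun_eq_iff[of _ "length (b k)"]) (use v D[of k] in auto)
        then show "(D k *\<^sub>v v = 0\<^sub>v (length (b k))) = (mat_apply (EE (Suc k)) (length (b (Suc k))) (vec_fun v) = 0)"
          unfolding vec_fun_mult[OF D v] by (simp add: EE_def)
      qed
      then show ?thesis
        using vD[of "Suc k"] ker[of k] vec_fun_image_Collect[of "b (Suc k)" "\<lambda>v. mat_apply (EE (Suc k)) (length (b (Suc k))) v = 0"] 3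
        by (simp add: ZZ_def)
    qed
  qed
  \<comment> \<open>Exactness makes a syzygy the image of a matrix none of whose entries has a
    constant term.\<close>
  have const: "lookup (v r) 0 = 0" if v: "v \<in> ZZ (Suc i)" for i v r
  proof -
    obtain w where w: "v = mat_apply (EE (Suc i)) (length (b (Suc i))) w" using v img[of "Suc i"] by auto
    have "lookup (EE (Suc i) r c * w c) 0 = 0" if "c < length (b (Suc i))" for c
      by (rule lookup_mult_0) (use min[of r i c] D[of i] that in \<open>auto simp: EE_def mat_fun_def\<close>)
    then show ?thesis unfolding w mat_apply_def by (simp add: lookup_sum)
  qed
  have hom: "homogeneous (b i ! c - case_nat [0] b i ! r) (EE i r c)"
    if "r < length (case_nat [0] b i)" "c < length (b i)" for i r c
    using that g hD D by (cases i) (auto simp: EE_def mat_fun_def carrier_matD)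
  have zero: "EE i r c = 0" if "r \<ge> length (case_nat [0] b i)" for i r c
    using that carrier_matD(1)[OF D] by (cases i) (auto simp: EE_def mat_fun_def)
  have "syzygy_step (case_nat [0] b i) (ZZ i) (b i) (EE i) (ZZ (Suc i))" for i
    unfolding syzygy_step_def using hom zero img const by (auto simp: ZZ_def)
  then have "minimal_resolution [0] (embed ` I) (case_nat [0] b) ZZ"
    unfolding minimal_resolution_def by (auto simp: ZZ_def)
  then show ?thesis by blast
qed

lemma minimal_resolution_imp:
  fixes I :: "'k::field pol set"
  assumes res: "minimal_resolution [0] (embed ` I) bb ZZ"
  shows "\<exists>g D. minimal_graded_free_resolution (*) I (\<lambda>j. {f \<in> I. homogeneous j f}) (\<lambda>i. bb (Suc i)) g D"
proof -
  define b where "b i = bb (Suc i)" for i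
  have "\<exists>E. syzygy_step (bb i) (ZZ i) (b i) E (ZZ (Suc i))" for i
    using res by (simp add: minimal_resolution_def b_def)
  then obtain E where E: "syzygy_step (bb i) (ZZ i) (b i) (E i) (ZZ (Suc i))" for i
    by metis
  have [simp]: "bb 0 = [0]" "ZZ 0 = embed ` I" using res by (auto simp: minimal_resolution_def)
  have bS: "bb (Suc i) = b i" for i by (simp add: b_def)
  define g where "g = map (E 0 0) [0..<length (b 0)]"
  define D where "D i = Matrix.mat (length (b i)) (length (b (Suc i))) (\<lambda>(r, c). E (Suc i) r c)" for i
  have D: "D i \<in> carrier_mat (length (b i)) (length (b (Suc i)))" for i by (simp add: D_def)
  have zero: "E i r c = 0" if "r \<ge> length (bb i)" for i r c
    using E[of i] that by (auto simp: syzygy_step_def)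
  have hom: "homogeneous (b i ! c - bb i ! r) (E i r c)" if "r < length (bb i)" "c < length (b i)" for i r c
    using E[of i] that by (auto simp: syzygy_step_def)
  have img: "mat_apply (E i) (length (b i)) ` free (b i) = ZZ i" for i
    using E[of i] by (auto simp: syzygy_step_def)
  have ZS: "ZZ (Suc i) = {v \<in> free (b i). mat_apply (E i) (length (b i)) v = 0}" for i
    using E[of i] by (auto simp: syzygy_step_def)
  \<comment> \<open>The columns are images of basis vectors. From the second map on they are
    syzygies, so their entries have no constant term.\<close>
  have unit: "mat_apply (E i) (length (b i)) (\<lambda>s. if s = c then 1 else 0) = (\<lambda>r. E i r c)" 
    "(\<lambda>s. if s = c then 1 else 0) \<in> free (b i)" if "c < length (b i)" for i c
    using that by (auto simp: mat_apply_def free_def if_distrib cong: if_cong)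
  have col: "(\<lambda>r. E i r c) \<in> ZZ i" if "c < length (b i)" for i c
    using img[of i] unit[OF that] by (metis imageI)
  have mvD: "mat_apply (mat_fun (D i)) (length (b (Suc i))) = mat_apply (E (Suc i)) (length (b (Suc i)))" for i
    using zero[of "Suc i"] by (auto simp: mat_apply_def mat_fun_def D_def fun_eq_iff bS intro!: sum.cong)
  have mvg: "mat_apply (\<lambda>r c. if r = 0 \<and> c < length g then g ! c else 0) (length g) = mat_apply (E 0) (length (b 0))"
    using zero[of 0] by (auto simp: mat_apply_def g_def fun_eq_iff intro!: sum.cong)
  have lg: "length g = length (b 0)" by (simp add: g_def)
  have vg: "embed (augmentation (*) g v) = mat_apply (E 0) (length (b 0)) (vec_fun v)" if "v \<in> carrier_vec (length (b 0))" for v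
    using embed_augmentation[of v g] that mvg by (simp add: lg)
  have vD: "vec_fun ` (*\<^sub>v) (D k) ` carrier_vec (length (b (Suc k))) = ZZ (Suc k)" for k
    unfolding img[of "Suc k", symmetric] vec_fun_image[symmetric] image_image mvD[symmetric]
    using vec_fun_mult[OF D[of k]] by (auto intro!: image_cong)
  have gI: "g ! r \<in> I \<and> homogeneous (b 0 ! r) (g ! r)" if r: "r < length (b 0)" for r
  proof -
    obtain p where p: "p \<in> I" "(\<lambda>s. E 0 s r) = embed p" using col[OF r] by auto
    then have "E 0 0 r = p" by (metis embed_apply(1))
    then show ?thesis using p hom[of 0 0 r] r by (simp add: g_def)
  qed
  have "embed ` augmentation (*) g ` carrier_vec (length (b 0)) = embed ` I"
    using img[of 0] unfolding vec_fun_image[symmetric] image_image by (simp add: vg cong: image_cong)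
  then have aug: "augmentation (*) g ` carrier_vec (length (b 0)) = I"
    by (simp add: inj_image_eq_iff[OF inj_embed])
  have "{v \<in> carrier_vec (length (b 0)). augmentation (*) g v = 0} =
      {v \<in> carrier_vec (length (b 0)). mat_apply (E 0) (length (b 0)) (vec_fun v) = 0}"
    using vg by (metis (no_types, lifting) embed_eq_iff embed_def ext zero_fun_apply)
  then have "vec_fun ` {v \<in> carrier_vec (length (b 0)). augmentation (*) g v = 0} =
      vec_fun ` (*\<^sub>v) (D 0) ` carrier_vec (length (b 1))"
    using vD[of 0] ZS[of 0] vec_fun_image_Collect[of "b 0" "\<lambda>v. mat_apply (E 0) (length (b 0)) v = 0"] by simp
  then have ker0: "{v \<in> carrier_vec (length (b 0)). augmentation (*) g v = 0} =
      (*\<^sub>v) (D 0) ` carrier_vec (length (b 1))"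
    by (subst (asm) inj_on_image_eq_iff[OF inj_on_vec_fun[of "length (b 0)"]]) (use D[of 0] in auto)
  have ker: "{v \<in> carrier_vec (length (b (Suc i))). D i *\<^sub>v v = 0\<^sub>v (length (b i))} =
        (*\<^sub>v) (D (Suc i)) ` carrier_vec (length (b (Suc (Suc i))))" for i
  proof -
    have "{v \<in> carrier_vec (length (b (Suc i))). D i *\<^sub>v v = 0\<^sub>v (length (b i))} =
          {v \<in> carrier_vec (length (b (Suc i))). mat_apply (E (Suc i)) (length (b (Suc i))) (vec_fun v) = 0}"
    proof (rule Collect_cong, rule conj_cong[OF refl])
      fix v :: "'k pol Matrix.vec" assume v: "v \<in> carrier_vec (length (b (Suc i)))"
      have "vec_fun (D i *\<^sub>v v) = vec_fun (0\<^sub>v (length (b i))) \<longleftrightarrow> D i *\<^sub>v v = 0\<^sub>v (length (b i))"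
        by (rule vec_fun_eq_iff[of _ "length (b i)"]) (use v D[of i] in auto)
      then show "(D i *\<^sub>v v = 0\<^sub>v (length (b i))) = (mat_apply (E (Suc i)) (length (b (Suc i))) (vec_fun v) = 0)"
        unfolding vec_fun_mult[OF D v] mvD by simp
    qed
    then have "vec_fun ` {v \<in> carrier_vec (length (b (Suc i))). D i *\<^sub>v v = 0\<^sub>v (length (b i))} =
        vec_fun ` (*\<^sub>v) (D (Suc i)) ` carrier_vec (length (b (Suc (Suc i))))"
      using vD[of "Suc i"] ZS[of "Suc i"]
        vec_fun_image_Collect[of "b (Suc i)" "\<lambda>v. mat_apply (E (Suc i)) (length (b (Suc i))) v = 0"] by simp
    then show ?thesis
      by (subst (asm) inj_on_image_eq_iff[OF inj_on_vec_fun[of "length (b (Suc i))"]]) (use D[of "Suc i"] in auto)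
  qed
  have const: "lookup (D i $$ (r, c)) 0 = 0" if "r < length (b i)" "c < length (b (Suc i))" for i r c
    using step_minimal[OF E[of i] col[OF that(2)], of r] that by (simp add: D_def)
  have "minimal_graded_free_resolution (*) I (\<lambda>j. {f \<in> I. homogeneous j f}) b g D"
    unfolding minimal_graded_free_resolution_def
    using lg gI D aug ker0 ker const hom[of _ "Suc _"] by (auto simp: D_def bS)
  then show ?thesis unfolding b_def by blast
qed

text \<open>Once a resolution exists, the choice in \<open>graded_betti\<close> returns the degrees
  of an actual one. Bounds proved for arbitrary minimal resolutions therefore apply to it.\<close>

lemma ideal_regularity_eq:
  fixes I :: "'k::field pol set"
  assumes "\<exists>bb ZZ. minimal_resolution [0] (embed ` I) bb ZZ"
  obtains bb ZZ where "minimal_resolution [0] (embed ` I) bb ZZ"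
    "ideal_regularity I = Max {j - int i | i j. j \<in> set (bb (Suc i))}"
proof -
  define b where "b = (SOME b. \<exists>g D. minimal_graded_free_resolution (*) I (\<lambda>j. {f \<in> I. homogeneous j f}) b g D)"
  have "\<exists>b g D. minimal_graded_free_resolution (*) I (\<lambda>j. {f \<in> I. homogeneous j f}) b g D"
    using assms minimal_resolution_imp by blast
  then have "\<exists>g D. minimal_graded_free_resolution (*) I (\<lambda>j. {f \<in> I. homogeneous j f}) b g D"
    unfolding b_def by (rule someI_ex)
  then obtain ZZ where "minimal_resolution [0] (embed ` I) (case_nat [0] b) ZZ"
    using minimal_graded_free_resolution_imp by blast
  moreover have "ideal_regularity I = Max {j - int i | i j. j \<in> set (case_nat [0] b (Suc i))}"
    unfolding ideal_regularity_def regularity_def graded_betti_def b_def[symmetric]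
    by (simp add: count_list_0_iff)
  ultimately show thesis by (rule that)
qed

section \<open>Monomial ideals\<close>

definition upclosed :: "expo set \<Rightarrow> bool" where
  "upclosed E \<longleftrightarrow> (\<forall>m\<in>E. \<forall>i. m + uexp i \<in> E)"

lemma upclosed_add:
  assumes "upclosed E" "m \<in> E" shows "m + u \<in> E"
proof (induction "nat (deg u)" arbitrary: u)
  case 0
  then have "deg u = 0" using deg_nonneg[of u] by simp
  with assms show ?case by simp
next
  case (Suc n)
  then have "u \<noteq> 0" by auto
  then obtain i where "lookup u i \<noteq> 0" by (metis poly_mapping_eqI lookup_zero)
  then obtain w where w: "u = w + uexp i" by (rule exponent_split)
  then have "m + w \<in> E" using Suc by auto
  then show ?case using assms(1) unfolding w upclosed_def by (metis add.assoc)
qed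

definition monomial_span :: "expo set \<Rightarrow> 'k::field pol set" where
  "monomial_span E = {p. keys p \<subseteq> E}"

lemma monomial_spanD: "p \<in> monomial_span E \<Longrightarrow> lookup p m \<noteq> 0 \<Longrightarrow> m \<in> E"
  by (auto simp: monomial_span_def in_keys_iff)

lemma monomial_spanI: "(\<And>m. lookup p m \<noteq> 0 \<Longrightarrow> m \<in> E) \<Longrightarrow> p \<in> monomial_span E"
  by (auto simp: monomial_span_def in_keys_iff)

lemma monomial_span_zero [simp]: "0 \<in> monomial_span E"
  by (simp add: monomial_span_def)

lemma monomial_span_add: "p \<in> monomial_span E \<Longrightarrow> q \<in> monomial_span E \<Longrightarrow> p + q \<in> monomial_span E"
  using Poly_Mapping.keys_add[of p q] by (auto simp: monomial_span_def)

lemma monomial_span_sum: "(\<And>x. x \<in> A \<Longrightarrow> p x \<in> monomial_span E) \<Longrightarrow> sum p A \<in> monomial_span E"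
  by (induction A rule: infinite_finite_induct) (auto intro: monomial_span_add)

lemma monomial_span_mult:
  assumes "upclosed E" "p \<in> monomial_span E" shows "c * p \<in> monomial_span E"
  using keys_mult[of c p] assms upclosed_add[OF assms(1)]
  by (force simp: monomial_span_def add.commute)

lemma monomial_span_single: "m \<in> E \<Longrightarrow> single m c \<in> monomial_span E"
  by (auto simp: monomial_span_def)

section \<open>Koszul homology of monomial ideals\<close>

lemma embed_image_iff: "v \<in> embed ` M \<longleftrightarrow> v 0 \<in> M \<and> (\<forall>r\<ge>1. v r = 0)"
proof
  assume "v 0 \<in> M \<and> (\<forall>r\<ge>1. v r = 0)"
  then have "v = embed (v 0)" by (auto simp: embed_def fun_eq_iff)
  then show "v \<in> embed ` M" using \<open>v 0 \<in> M \<and> _\<close> by blast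
qed (auto simp: embed_def)

lemma embed_apply_pos [simp]: "Suc 0 \<le> r \<Longrightarrow> embed p r = 0"
  by (simp add: embed_def)

lemma monomial_span_graded_submodule:
  assumes "upclosed E" shows "graded_submodule [0] (embed ` monomial_span E)"
  unfolding graded_submodule_def
proof (intro conjI ballI allI)
  show "graded_part [0] j v \<in> embed ` monomial_span E" if v: "v \<in> embed ` monomial_span E" for j v
  proof -
    have "hom_part j (v 0) \<in> monomial_span E"
      using v by (intro monomial_spanI) (auto simp: lookup_hom_part split: if_splits dest: monomial_spanD)
    then show ?thesis by (simp add: embed_image_iff graded_part_def)
  qed
qed (use assms in \<open>auto simp: embed_image_iff free_def monomial_span_add monomial_span_mult\<close>)

lemma embed_graded: "v \<in> embed ` M \<Longrightarrow> v \<in> graded [0] j \<longleftrightarrow> homogeneous j (v 0)"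
  by (auto simp: embed_image_iff graded_def free_def)

text \<open>Vanishing in degree \<open>j\<close> means that the ideal has no minimal generator of
  that degree. A single monomial tests one direction; for the other each monomial is divided by a
  variable separately.\<close>

lemma H0_monomial_iff:
  assumes up: "upclosed E"
  shows "H0_vanishes [0] (embed ` monomial_span E :: 'k::field fvec set) j \<longleftrightarrow>
    (\<forall>w\<in>E. deg w = j \<longrightarrow> (\<exists>i u. w = u + uexp i \<and> u \<in> E))" (is "?H \<longleftrightarrow> ?K")
proof
  assume H: ?H
  show ?K
  proof (intro ballI impI)
    fix w assume w: "w \<in> E" "deg w = j"
    let ?z = "embed (single w (1::'k))"
    have "?z \<in> embed ` monomial_span E" using w by (simp add: embed_image_iff monomial_span_single embed_def)
    moreover from this have "?z \<in> graded [0] j" using w by (simp add: embed_graded homogeneous_iff)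
    ultimately obtain f where f: "\<And>i. f i \<in> embed ` monomial_span E" "?z = xdot f"
      using H0_vanishesD[OF H] by metis
    have "lookup (xdot f 0) w = 1"
      unfolding f(2)[symmetric] by simp
    then have "(\<Sum>i\<in>UNIV. lookup (var i * f i 0) w) = 1"
      unfolding xdot_apply lookup_sum .
    then have "(\<Sum>i\<in>UNIV. lookup (var i * f i 0) w) \<noteq> 0" by simp
    then obtain i where "lookup (var i * f i 0) w \<noteq> 0"
      by (rule sum.not_neutral_contains_not_neutral)
    then have "w \<in> (\<lambda>m. m + uexp i) ` keys (f i 0)"
      by (simp add: keys_var_mult[symmetric] in_keys_iff)
    then show "\<exists>i u. w = u + uexp i \<and> u \<in> E"
      using f(1)[of i] by (auto simp: embed_image_iff monomial_span_def)
  qed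
next
  assume K: ?K
  show ?H unfolding H0_vanishes_def
  proof
    fix z :: "'k fvec" assume z: "z \<in> embed ` monomial_span E \<inter> graded [0] j"
    let ?p = "z 0"
    have "homogeneous j ?p" using z by (metis IntE embed_graded)
    then have p: "m \<in> E" "deg m = j" if "m \<in> keys ?p" for m
      using z that by (auto simp: embed_image_iff monomial_span_def homogeneous_iff)
    have "\<exists>i u. m = u + uexp i \<and> u \<in> E" if "m \<in> keys ?p" for m
      using K p[OF that] by blast
    then obtain \<iota> u where iu: "\<And>m. m \<in> keys ?p \<Longrightarrow> m = u m + uexp (\<iota> m) \<and> u m \<in> E" by metis
    \<comment> \<open>Each monomial is assigned to one variable only, so that every coefficient is
      counted once.\<close>
    define f where "f i = (\<Sum>m\<in>{m\<in>keys ?p. \<iota> m = i}. single (u m) (lookup ?p m))" for i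
    have "(\<Sum>i\<in>UNIV. var i * f i) =
        (\<Sum>i\<in>UNIV. \<Sum>m\<in>{m\<in>keys ?p. \<iota> m = i}. single m (lookup ?p m))"
      unfolding f_def sum_distrib_left
    proof (intro sum.cong refl)
      fix i m assume "m \<in> {m\<in>keys ?p. \<iota> m = i}"
      then have "m = uexp i + u m" using iu[of m] by (simp add: add.commute)
      then show "var i * single (u m) (lookup ?p m) = single m (lookup ?p m)"
        unfolding var_def by (metis mult_single mult_1)
    qed
    also have "\<dots> = (\<Sum>m\<in>keys ?p. single m (lookup ?p m))"
      by (rule sum.group) auto
    also have "\<dots> = ?p" by (rule sum_monomials[symmetric])
    finally have "z = xdot (\<lambda>i. embed (f i))"
      using z by (auto simp: fun_eq_iff xdot_apply embed_def embed_image_iff)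
    moreover have "f i \<in> monomial_span E" for i
      unfolding f_def using iu by (intro monomial_span_sum monomial_span_single) auto
    ultimately show "\<exists>f. (\<forall>i. f i \<in> embed ` monomial_span E) \<and> z = xdot f"
      by (intro exI[of _ "\<lambda>i. embed (f i)"]) simp
  qed
qed

text \<open>In multidegree \<open>c + uexp (k + 1) + uexp (k + 2)\<close> the first Koszul homology vanishes iff the upper
  Koszul complex joins the vertices \<open>k + 1\<close> and \<open>k + 2\<close>, by an edge or through \<open>k\<close>.\<close>

definition connected_at :: "expo set \<Rightarrow> int \<Rightarrow> bool" where
  "connected_at E j \<longleftrightarrow> (\<forall>k c. deg c + 2 = j \<and> c + uexp (k + 1) \<in> E \<and> c + uexp (k + 2) \<in> E \<longrightarrow>
     c \<in> E \<or> (\<exists>u. c = u + uexp k \<and> u + uexp (k + 1) \<in> E \<and> u + uexp (k + 2) \<in> E))"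

lemma connected_atD:
  assumes "connected_at E j" "c + uexp k \<in> E" "c + uexp l \<in> E" "k \<noteq> l" "deg c + 2 = j" 
  shows "c \<in> E \<or> (\<exists>u i. i \<noteq> k \<and> i \<noteq> l \<and> c = u + uexp i \<and> u + uexp k \<in> E \<and> u + uexp l \<in> E)"
proof (cases rule: cyclic_cases[of k l])
  case 2
  have "c \<in> E \<or> (\<exists>u. c = u + uexp (l + 2) \<and> u + uexp l \<in> E \<and> u + uexp (l + 1) \<in> E)"
    using assms(1)[unfolded connected_at_def, rule_format, of c "l + 2"] assms(2-5) 2 by simp
  then show ?thesis using 2 by (metis cyclic_distinct)
next
  case 3
  have "c \<in> E \<or> (\<exists>u. c = u + uexp (l + 1) \<and> u + uexp (l + 2) \<in> E \<and> u + uexp l \<in> E)"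
    using assms(1)[unfolded connected_at_def, rule_format, of c "l + 1"] assms(2-5) 3 by simp
  then show ?thesis using 3 by (metis cyclic_distinct)
qed (use assms in simp)

lemma H1_monomial_imp_connected:
  assumes up: "upclosed E"
    and H: "H1_vanishes [0] (embed ` monomial_span E :: 'k::field fvec set) j"
  shows "connected_at E j"
  unfolding connected_at_def
proof (intro allI impI, elim conjE)
  fix k c
  assume c: "deg c + 2 = j" "c + uexp (k + 1) \<in> E" "c + uexp (k + 2) \<in> E"
  \<comment> \<open>This is the trivial Koszul relation between the two monomials x^c x_{k+1} and
    x^c x_{k+2}.\<close>
  define f :: "3 \<Rightarrow> 'k fvec" where "f i = embed (if i = k + 1 then single (c + uexp (k + 2)) 1
    else if i = k + 2 then - single (c + uexp (k + 1)) 1 else 0)" for i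
  have "f i \<in> embed ` monomial_span E \<inter> graded [0] (j - 1)" for i
  proof -
    have 1: "f i \<in> embed ` monomial_span E" 
      using c unfolding f_def by (intro imageI) (auto simp: monomial_span_def split: if_splits)
    moreover have "f i \<in> graded [0] (j - 1)"
      unfolding embed_graded[OF 1] using c by (auto simp: f_def homogeneous_iff)
    ultimately show ?thesis by blast
  qed
  moreover have "xdot f = 0"
  proof
    fix r
    have "uexp (k + 1) + (c + uexp (k + 2)) = uexp (k + 2) + (c + uexp (k + 1))" by (simp add: ac_simps)
    then show "xdot f r = 0 r"
      by (auto simp: f_def xdot_apply sum_cyclic[of _ k] embed_def var_def mult_single)
  qed
  ultimately obtain G where G: "\<And>i. G i \<in> embed ` monomial_span E" "\<And>i. f i = cross G i"
    using H1_vanishesD[OF H] by metis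
  have GE: "m \<in> E" if "lookup (G i 0) m \<noteq> 0" for i m
    using G(1)[of i] that by (auto simp: embed_image_iff dest: monomial_spanD)
  show "c \<in> E \<or> (\<exists>u. c = u + uexp k \<and> u + uexp (k + 1) \<in> E \<and> u + uexp (k + 2) \<in> E)"
  proof (rule disjCI)
    assume nu: "\<nexists>u. c = u + uexp k \<and> u + uexp (k + 1) \<in> E \<and> u + uexp (k + 2) \<in> E"
    have f1: "single (c + uexp (k + 2)) 1 = var (k + 2) * G k 0 - var k * G (k + 2) 0"
      using fun_cong[OF G(2)[of "k + 1"], of 0] by (simp add: f_def cross_apply)
    have f2: "- single (c + uexp (k + 1)) 1 = var k * G (k + 1) 0 - var (k + 1) * G k 0"
      using fun_cong[OF G(2)[of "k + 2"], of 0] by (simp add: f_def cross_apply)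
    have 1: "1 = lookup (G k 0) c - lookup (var k * G (k + 2) 0) (c + uexp (k + 2))"
      using arg_cong[OF f1, of "\<lambda>p. lookup p (c + uexp (k + 2))"] by (simp add: lookup_minus)
    have 2: "- 1 = lookup (var k * G (k + 1) 0) (c + uexp (k + 1)) - lookup (G k 0) c"
      using arg_cong[OF f2, of "\<lambda>p. lookup p (c + uexp (k + 1))"] by (simp add: lookup_minus)
    \<comment> \<open>If \<open>c\<close> is missing from \<open>E\<close>, then x^c does not occur
      in \<open>G k\<close>. The two nonzero coefficients of \<open>f\<close> must then come from
      the multiples of x_k, which produces \<open>u\<close> and both neighbours of it.\<close>
    show "c \<in> E"
    proof (rule ccontr)
      assume "c \<notin> E"
      then have 0: "lookup (G k 0) c = 0" using GE by blast
      then have "lookup (var k * G (k + 2) 0) (c + uexp (k + 2)) \<noteq> 0" using 1 by auto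
      then have "lookup (c + uexp (k + 2)) k \<noteq> 0" using lookup_var_mult_0 by blast
      then have "lookup c k \<noteq> 0" by (simp add: lookup_add lookup_uexp)
      then obtain u where u: "c = u + uexp k" by (rule exponent_split)
      have s: "c + uexp i = (u + uexp i) + uexp k" for i by (simp add: u ac_simps)
      have "lookup (G (k + 2) 0) (u + uexp (k + 2)) \<noteq> 0" using 1 0 unfolding s by auto
      moreover have "lookup (G (k + 1) 0) (u + uexp (k + 1)) \<noteq> 0" using 2 0 unfolding s by auto
      ultimately show False using nu u GE by blast
    qed
  qed
qed

text \<open>Over the whole ring the cycle bounds some \<open>G\<close>, perhaps with monomials
  outside \<open>E\<close>. Subtracting \<open>h\<close> times the vector of variables keeps the
  boundary; the coefficient of \<open>h\<close> at \<open>u\<close> acts on the coefficients of all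
  \<open>G i\<close> at \<open>u + uexp i\<close> at once, so these must agree wherever they have to
  be cancelled.\<close>

lemma connected_imp_H1_monomial:
  assumes up: "upclosed E" and K: "connected_at E j"
  shows "H1_vanishes [0] (embed ` monomial_span E :: 'k::field fvec set) j"
  unfolding H1_vanishes_def
proof (intro allI impI, elim conjE)
  fix f :: "3 \<Rightarrow> 'k fvec"
  assume f: "\<forall>i. f i \<in> embed ` monomial_span E \<inter> graded [0] (j - 1)" and 0: "xdot f = 0"
  let ?f = "\<lambda>i. f i 0"
  have fE: "m \<in> E" if "lookup (?f i) m \<noteq> 0" for i m
    using f that by (auto simp: embed_image_iff dest: monomial_spanD)
  have "homogeneous (j - 1) (?f i)" for i using f by (metis IntE embed_graded)
  then have fdeg: "deg m = j - 1" if "lookup (?f i) m \<noteq> 0" for i m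
    using that unfolding homogeneous_iff' by blast
  have "(\<Sum>i\<in>UNIV. var i * ?f i) = 0" using fun_cong[OF 0, of 0] by (simp add: xdot_apply)
  then have "\<exists>G. \<forall>i. ?f i = var (i + 1) * G (i + 2) - var (i + 2) * G (i + 1)"
  proof (rule koszul1_exact)
    fix G assume "\<And>i. ?f i = var (i + 1) * G (i + 2) - var (i + 2) * G (i + 1)"
    then show ?thesis by (intro exI[of _ G] allI)
  qed
  then obtain G where G: "\<And>i. ?f i = var (i + 1) * G (i + 2) - var (i + 2) * G (i + 1)"
    by blast
  have G1: "?f (i + 1) = var (i + 2) * G i - var i * G (i + 2)" for i
    using G[of "i + 1"] by simp
  have G2: "?f (i + 2) = var i * G (i + 1) - var (i + 1) * G i" for i
    using G[of "i + 2"] by simp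
  let ?\<gamma> = "\<lambda>i u. lookup (G i) (u + uexp i)"
  have f_coeff: "lookup (?f i) (u + uexp (i + 1) + uexp (i + 2)) = ?\<gamma> (i + 2) u - ?\<gamma> (i + 1) u" for i u
  proof -
    have "u + uexp (i + 1) + uexp (i + 2) = u + uexp (i + 2) + uexp (i + 1)" by (simp add: ac_simps)
    then have "lookup (var (i + 1) * G (i + 2)) (u + uexp (i + 1) + uexp (i + 2)) = ?\<gamma> (i + 2) u"
      by (simp only: lookup_var_mult_add)
    then show ?thesis unfolding G[of i] lookup_minus by (simp only: lookup_var_mult_add)
  qed
  \<comment> \<open>Two differing coefficients make \<open>f\<close> nonzero on one edge, and the
    third coefficient differs from one of them, giving a second edge. Connecting these at their
    common vertex puts one of the two missing exponents into \<open>E\<close>.\<close>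
  have agree1: "?\<gamma> (k + 1) u = ?\<gamma> (k + 2) u" if nE: "u + uexp (k + 1) \<notin> E" "u + uexp (k + 2) \<notin> E" for k u
  proof (rule ccontr)
    assume ne: "?\<gamma> (k + 1) u \<noteq> ?\<gamma> (k + 2) u"
    then have k: "lookup (?f k) (u + uexp (k + 1) + uexp (k + 2)) \<noteq> 0" unfolding f_coeff by simp
    from ne have "?\<gamma> k u \<noteq> ?\<gamma> (k + 1) u \<or> ?\<gamma> k u \<noteq> ?\<gamma> (k + 2) u" by auto
    then show False
    proof
      assume "?\<gamma> k u \<noteq> ?\<gamma> (k + 1) u"
      then have "lookup (?f (k + 2)) (u + uexp k + uexp (k + 1)) \<noteq> 0"
        using f_coeff[of "k + 2" u] by simp
      from fE[OF this] fdeg[OF this] have "u + uexp (k + 1) + uexp k \<in> E" "deg (u + uexp (k + 1)) + 2 = j"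
        by (simp_all add: ac_simps)
      from connected_atD[OF K this(1) fE[OF k] cyclic_distinct(2) this(2)] obtain u' i
        where "i \<noteq> k" "i \<noteq> k + 2" "u + uexp (k + 1) = u' + uexp i" "u' + uexp (k + 2) \<in> E"
        using nE(1) by blast
      then show False using nE(2) by (cases rule: cyclic_cases[of i k]) auto
    next
      assume "?\<gamma> k u \<noteq> ?\<gamma> (k + 2) u"
      then have "lookup (?f (k + 1)) (u + uexp (k + 2) + uexp k) \<noteq> 0"
        using f_coeff[of "k + 1" u] by simp
      from fE[OF this] fdeg[OF this] fE[OF k]
      have *: "u + uexp (k + 2) + uexp k \<in> E" "u + uexp (k + 2) + uexp (k + 1) \<in> E" "deg (u + uexp (k + 2)) + 2 = j"
        by (simp_all add: ac_simps)
      from connected_atD[OF K *(1,2) cyclic_distinct(1) *(3)] obtain u' i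
        where "i \<noteq> k" "i \<noteq> k + 1" "u + uexp (k + 2) = u' + uexp i" "u' + uexp (k + 1) \<in> E"
        using nE(2) by blast
      then show False using nE(1) by (cases rule: cyclic_cases[of i k]) auto
    qed
  qed
  have agree: "?\<gamma> i u = ?\<gamma> l u" if "u + uexp i \<notin> E" "u + uexp l \<notin> E" for i l u
  proof (cases rule: cyclic_cases[of l i])
    case 2 then show ?thesis using agree1[of u "i + 2"] that by simp
  next
    case 3 then show ?thesis using agree1[of u "i + 1"] that by simp
  qed simp
  \<comment> \<open>The coefficient at any missing exponent; by \<open>agree\<close> the choice is
    immaterial, and 0 is used where nothing has to be cancelled.\<close>
  define \<eta> where "\<eta> u = (if \<exists>i. u + uexp i \<notin> E then ?\<gamma> (SOME i. u + uexp i \<notin> E) u else 0)" for u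
  have eta: "\<eta> u = ?\<gamma> i u" if "u + uexp i \<notin> E" for i u
    using agree[OF that someI[of "\<lambda>i. u + uexp i \<notin> E", OF that]] that by (auto simp: \<eta>_def)
  define U where "U = (\<Union>i. keys (quot i (G i)))"
  have fin: "finite U" by (simp add: U_def)
  define h where "h = (\<Sum>u\<in>U. single u (\<eta> u))"
  have h: "lookup h u = \<eta> u" for u
  proof -
    have "lookup h u = (\<Sum>w\<in>U. if w = u then \<eta> u else 0)"
      unfolding h_def lookup_sum by (rule sum.cong) (auto simp: lookup_single when_def)
    also have "\<dots> = (if u \<in> U then \<eta> u else 0)" using fin by simp
    also have "\<dots> = \<eta> u" by (auto simp: U_def in_keys_iff \<eta>_def)
    finally show ?thesis .
  qed
  define G' where "G' i = G i - var i * h" for i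
  have "G' i \<in> monomial_span E" for i
  proof (rule monomial_spanI, rule ccontr)
    fix c assume nz: "lookup (G' i) c \<noteq> 0" and c: "c \<notin> E"
    show False
    proof (cases "lookup c i = 0")
      case False
      then obtain u where "c = u + uexp i" by (rule exponent_split)
      then show False using nz c eta[of u i] by (simp add: G'_def lookup_minus h)
    next
      \<comment> \<open>Here the correction does not reach, since x_i does not divide the monomial.
        But then \<open>f\<close> shows that both other multiples lie in \<open>E\<close>, and
        connecting them would require \<open>c\<close> in \<open>E\<close> or divisibility by
        x_i.\<close>
      case True
      then have nz: "lookup (G i) c \<noteq> 0" using nz by (simp add: G'_def lookup_minus)
      have "lookup (?f (i + 1)) (c + uexp (i + 2)) = lookup (G i) c"
        using True unfolding G1 by (simp add: lookup_minus lookup_add lookup_uexp)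
      moreover have "lookup (?f (i + 2)) (c + uexp (i + 1)) = - lookup (G i) c"
        using True unfolding G2 by (simp add: lookup_minus lookup_add lookup_uexp)
      ultimately have cE: "c + uexp (i + 2) \<in> E" "c + uexp (i + 1) \<in> E" "deg c + 2 = j"
        using nz fE[of "i + 1" "c + uexp (i + 2)"] fE[of "i + 2" "c + uexp (i + 1)"] fdeg[of "i + 1" "c + uexp (i + 2)"] by auto
      from K cE have "\<exists>u. c = u + uexp i" using c unfolding connected_at_def by blast
      then show False using True by (auto simp: lookup_add lookup_uexp)
    qed
  qed
  then have "embed (G' i) \<in> embed ` monomial_span E" for i by blast
  moreover have "f i = cross (\<lambda>i. embed (G' i)) i" for i
  proof
    fix r
    show "f i r = cross (\<lambda>i. embed (G' i)) i r"
    proof (cases r)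
      case 0
      then show ?thesis using G[of i] by (simp add: cross_apply G'_def algebra_simps)
    next
      case (Suc n)
      then show ?thesis using f by (simp add: cross_apply embed_image_iff)
    qed
  qed
  ultimately show "\<exists>G. (\<forall>i. G i \<in> embed ` monomial_span E) \<and> (\<forall>i. f i = cross G i)"
    by (intro exI[of _ "\<lambda>i. embed (G' i)"]) simp
qed

text \<open>The cycle is \<open>h\<close> times the vector of variables. A monomial of
  \<open>h\<close> has all its multiples by a variable in \<open>E\<close>, so outside
  \<open>E\<close> it would be a socle monomial of the quotient ring.\<close>

lemma H2_monomial:
  assumes up: "upclosed E" and K: "\<And>c. (\<And>i. c + uexp i \<in> E) \<Longrightarrow> deg c + 3 = j \<Longrightarrow> c \<in> E"
  shows "H2_vanishes [0] (embed ` monomial_span E :: 'k::field fvec set) j"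
  unfolding H2_vanishes_def
proof (intro allI impI, elim conjE)
  fix G :: "3 \<Rightarrow> 'k fvec"
  assume G: "\<forall>i. G i \<in> embed ` monomial_span E \<inter> graded [0] (j - 2)" and 0: "\<forall>i. cross G i = 0"
  have "G i \<in> free [0]" for i using G by (auto simp: graded_def)
  then obtain h where h: "\<And>i. G i = var i \<odot> h" "h \<in> free [0]"
    using koszul2_exact_free[of G "[0]"] 0 by metis
  have hom: "homogeneous (j - 2) (G i 0)" for i using G by (metis IntE embed_graded)
  have "h 0 \<in> monomial_span E"
  proof (rule monomial_spanI, rule K)
    fix c assume c: "lookup (h 0) c \<noteq> 0"
    have nz: "lookup (G i 0) (c + uexp i) \<noteq> 0" for i using c h(1)[of i] by simp
    then show "c + uexp i \<in> E" for i using G by (auto simp: embed_image_iff dest: monomial_spanD)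
    have "deg (c + uexp 0) = j - 2" using hom[of 0] nz[of 0] unfolding homogeneous_iff' by blast
    then show "deg c + 3 = j" by simp
  qed
  then have "h \<in> embed ` monomial_span E" using h(2) by (auto simp: embed_image_iff free_def)
  then show "\<exists>h\<in>embed ` monomial_span E. \<forall>i. G i = var i \<odot> h" using h(1) by blast
qed

section \<open>Lattice polygons\<close>

no_notation vec_index (infixl "$" 100)

abbreviation coord :: "expo \<Rightarrow> 3 \<Rightarrow> real" where "coord m i \<equiv> real (lookup m i)"

definition real_vec :: "expo \<Rightarrow> real ^ 3" where "real_vec m = (\<chi> i. coord m i)"

lemma real_vec_nth [simp]: "real_vec m $ i = coord m i"
  by (simp add: real_vec_def)

lemma deg_real: "real_of_int (deg m) = (\<Sum>i\<in>UNIV. coord m i)"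
  by (simp add: deg_def)

lemma coord_add_uexp: "coord (u + uexp i) j = coord u j + (if j = i then 1 else 0)"
  by (simp add: lookup_add lookup_uexp)

lemma exponent_split_ge: 
  assumes "coord m i \<ge> 1" obtains u where "m = u + uexp i"
  using assms exponent_split[of m i] by (metis not_one_le_zero of_nat_0)

lemma UNIV_distinct: "i \<noteq> j \<Longrightarrow> j \<noteq> k \<Longrightarrow> i \<noteq> k \<Longrightarrow> (UNIV :: 3 set) = {i, j, k}"
  by (rule card_subset_eq[symmetric]) auto

lemma sum_distinct: "i \<noteq> j \<Longrightarrow> j \<noteq> k \<Longrightarrow> i \<noteq> k \<Longrightarrow> sum f (UNIV :: 3 set) = f i + f j + (f k :: real)"
  by (subst UNIV_distinct[of i j k]) auto

lemma cases_distinct: 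
  assumes "i \<noteq> j" "j \<noteq> k" "i \<noteq> (k :: 3)" obtains "l = i" | "l = j" | "l = k"
  using UNIV_distinct[OF assms] by blast

section \<open>Bounds for the Newton polyhedron without further assumptions\<close>

locale newton =
  fixes A :: "expo set" and d :: int
  assumes finite_A: "finite A" and A_nonempty: "A \<noteq> {}" and deg_A: "\<And>a. a \<in> A \<Longrightarrow> deg a = d"
begin

definition P :: "(real ^ 3) set" where "P = convex hull (real_vec ` A)"

definition NP :: "expo set" where "NP = {w. \<exists>p\<in>P. \<forall>i. p $ i \<le> coord w i}"

lemma NP_I: "p \<in> P \<Longrightarrow> (\<And>i. p $ i \<le> coord w i) \<Longrightarrow> w \<in> NP"
  by (auto simp: NP_def)

lemma real_vec_in_P: "a \<in> A \<Longrightarrow> real_vec a \<in> P"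
  unfolding P_def by (simp add: hull_inc)

lemma convex_P: "convex P" by (simp add: P_def)

lemma P_segment: "p \<in> P \<Longrightarrow> q \<in> P \<Longrightarrow> 0 \<le> t \<Longrightarrow> t \<le> 1 \<Longrightarrow> (1 - t) *\<^sub>R p + t *\<^sub>R q \<in> P"
  using convexD_alt[OF convex_P] by blast

lemma P_subset: "real_vec ` A \<subseteq> S \<Longrightarrow> convex S \<Longrightarrow> P \<subseteq> S"
  unfolding P_def by (rule hull_minimal)

lemma P_ge: "(\<And>a. a \<in> A \<Longrightarrow> c \<le> coord a i) \<Longrightarrow> p \<in> P \<Longrightarrow> c \<le> p $ i"
proof -
  assume a: "\<And>a. a \<in> A \<Longrightarrow> c \<le> coord a i" and p: "p \<in> P"
  have "{x :: real ^ 3. x $ i \<ge> c} = {x. inner (axis i 1) x \<ge> c}" by (simp add: inner_axis')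
  then have "convex {x :: real ^ 3. x $ i \<ge> c}" by (simp add: convex_halfspace_ge)
  moreover have "real_vec ` A \<subseteq> {x. x $ i \<ge> c}" using a by auto
  ultimately show ?thesis using P_subset p by blast
qed

lemma P_le: "(\<And>a. a \<in> A \<Longrightarrow> coord a i \<le> c) \<Longrightarrow> p \<in> P \<Longrightarrow> p $ i \<le> c"
proof -
  assume a: "\<And>a. a \<in> A \<Longrightarrow> coord a i \<le> c" and p: "p \<in> P"
  have "{x :: real ^ 3. x $ i \<le> c} = {x. inner (axis i 1) x \<le> c}" by (simp add: inner_axis')
  then have "convex {x :: real ^ 3. x $ i \<le> c}" by (simp add: convex_halfspace_le)
  moreover have "real_vec ` A \<subseteq> {x. x $ i \<le> c}" using a by auto
  ultimately show ?thesis using P_subset p by blast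
qed

lemma P_nonneg: "p \<in> P \<Longrightarrow> 0 \<le> p $ i"
  using P_ge[of 0] by auto

lemma P_sum: "p \<in> P \<Longrightarrow> (\<Sum>i\<in>UNIV. p $ i) = d"
proof -
  have "P \<subseteq> {x. inner 1 x = real_of_int d}"
  proof (rule P_subset)
    show "real_vec ` A \<subseteq> {x. inner 1 x = real_of_int d}"
      using deg_A by (auto simp: inner_vec_def deg_real[symmetric])
  qed (rule convex_hyperplane)
  then show "p \<in> P \<Longrightarrow> (\<Sum>i\<in>UNIV. p $ i) = d" by (auto simp: inner_vec_def)
qed

lemma P_sum3: "p \<in> P \<Longrightarrow> i \<noteq> j \<Longrightarrow> j \<noteq> k \<Longrightarrow> i \<noteq> k \<Longrightarrow> p $ i + p $ j + p $ k = d"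
  using P_sum[of p] sum_distinct[of i j k "\<lambda>i. p $ i"] by simp

lemma deg3: "i \<noteq> j \<Longrightarrow> j \<noteq> k \<Longrightarrow> i \<noteq> k \<Longrightarrow> real_of_int (deg m) = coord m i + coord m j + coord m k"
  using deg_real[of m] sum_distinct[of i j k "coord m"] by simp

text \<open>The weights are not normalised, so applications can use polynomial weights and check a
  polynomial identity.\<close>

lemma P_combination3:
  assumes "p \<in> P" "q \<in> P" "r \<in> P" "\<alpha> \<ge> 0" "\<beta> \<ge> 0" "\<gamma> \<ge> 0" "\<alpha> + \<beta> + \<gamma> > 0"
    and "\<And>i. (\<alpha> + \<beta> + \<gamma>) * x i = \<alpha> * p $ i + \<beta> * q $ i + \<gamma> * r $ i"
  shows "(\<chi> i. x i) \<in> P"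
proof -
  let ?S = "\<alpha> + \<beta> + \<gamma>"
  have "(\<chi> i. x i) = (\<alpha> / ?S) *\<^sub>R p + (\<beta> / ?S) *\<^sub>R q + (\<gamma> / ?S) *\<^sub>R r"
    unfolding vec_eq_iff
  proof
    fix i
    have "x i = (\<alpha> * p $ i + \<beta> * q $ i + \<gamma> * r $ i) / ?S"
      using assms(7) by (subst assms(8)[symmetric]) simp
    then show "(\<chi> i. x i) $ i = ((\<alpha> / ?S) *\<^sub>R p + (\<beta> / ?S) *\<^sub>R q + (\<gamma> / ?S) *\<^sub>R r) $ i"
      by (simp add: add_divide_distrib)
  qed
  also have "\<dots> \<in> convex hull {p, q, r}"
    using assms(4-7) unfolding convex_hull_3 
    by (intro CollectI exI[of _ "\<alpha> / ?S"] exI[of _ "\<beta> / ?S"] exI[of _ "\<gamma> / ?S"])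
       (simp add: add_divide_distrib[symmetric])
  also have "convex hull {p, q, r} \<subseteq> P"
    using assms(1-3) by (intro hull_minimal convex_P) auto
  finally show ?thesis .
qed

lemma upclosed_NP: "upclosed NP"
  unfolding upclosed_def
proof (intro ballI allI)
  fix m i assume "m \<in> NP"
  then obtain p where p: "p \<in> P" "\<And>j. p $ j \<le> coord m j" by (auto simp: NP_def)
  have "p $ j \<le> coord (m + uexp i) j" for j using p(2)[of j] by (cases "j = i") (auto simp: coord_add_uexp)
  then show "m + uexp i \<in> NP" by (rule NP_I[OF p(1)])
qed

lemma NP_deg_d:
  assumes "w \<in> NP" "deg w = d" shows "real_vec w \<in> P"
proof -
  obtain p where p: "p \<in> P" "\<And>i. p $ i \<le> coord w i" using assms by (auto simp: NP_def)
  have "coord w i - p $ i = 0" for i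
  proof -
    have "(\<Sum>i\<in>UNIV. coord w i - p $ i) = 0"
      using P_sum[OF p(1)] deg_real[of w] assms by (simp add: sum_subtractf)
    then show ?thesis using p(2) by (subst (asm) sum_nonneg_eq_0_iff) auto
  qed
  then have "real_vec w = p" unfolding vec_eq_iff by (metis eq_iff_diff_eq_0 real_vec_nth)
  then show ?thesis using p by simp
qed

lemma NP_divide:
  assumes "p \<in> P" "\<And>j. p $ j \<le> coord w j" "p $ i \<le> coord w i - 1"
  shows "\<exists>u. w = u + uexp i \<and> u \<in> NP"
proof -
  have "coord w i \<ge> 1" using P_nonneg[OF assms(1), of i] assms(3) by linarith
  then obtain u where u: "w = u + uexp i" by (rule exponent_split_ge)
  have "p $ j \<le> coord u j" for j
    using assms(2)[of j] assms(3) unfolding u coord_add_uexp by (cases "j = i") auto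
  then show ?thesis using u NP_I[OF assms(1)] by blast
qed

text \<open>Suppose the minimum of the largest coordinate of p - c is positive. Since these
  coordinates have sum at most 0, some coordinate j is below the maximum. A small move towards the
  witness for \<open>c + uexp j\<close> lowers the others and keeps the j-th below the maximum, a
  contradiction.\<close>

lemma socle:
  assumes c: "\<And>i. c + uexp i \<in> NP" and deg: "deg c \<ge> d"
  shows "c \<in> NP"
proof -
  define f where "f p = max (p $ 0 - coord c 0) (max (p $ 1 - coord c 1) (p $ 2 - coord c 2))" for p :: "real ^ 3"
  have f_less: "f p < x \<longleftrightarrow> (\<forall>i. p $ i - coord c i < x)" for p x
  proof -
    have "(\<forall>i. p $ i - coord c i < x) \<longleftrightarrow> (\<forall>i\<in>{0, 1, 2}. p $ i - coord c i < x)"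
      using UNIV_distinct[of 0 1 2] by (metis UNIV_I cyclic_distinct(2) zero_neq_one one_neq_zero add_0 cyclic_distinct(3))
    then show ?thesis by (simp add: f_def)
  qed
  have le_f: "p $ i - coord c i \<le> f p" for p i
    using f_less[of p "f p"] f_less by (meson linorder_not_le order.strict_iff_not)
  have "compact P" unfolding P_def by (simp add: finite_A finite_imp_compact_convex_hull)
  moreover have "P \<noteq> {}" using real_vec_in_P A_nonempty by blast
  moreover have "continuous_on P f" unfolding f_def by (intro continuous_intros)
  ultimately obtain p where p: "p \<in> P" and min: "\<And>q. q \<in> P \<Longrightarrow> f p \<le> f q"
    using continuous_attains_inf[of P f] by blast
  show ?thesis
  proof (cases "f p \<le> 0")
    case True
    have "p $ i \<le> coord c i" for i using le_f[of p i] True by linarith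
    then show ?thesis by (rule NP_I[OF p])
  next
    case False
    define \<mu> where "\<mu> = f p"
    have pos: "\<mu> > 0" using False by (simp add: \<mu>_def)
    have "\<exists>j. p $ j - coord c j < \<mu>"
    proof (rule ccontr)
      assume "\<not> ?thesis"
      then have "p $ i - coord c i > 0" for i using pos by (meson less_le_trans not_less)
      then have "(\<Sum>i\<in>UNIV. p $ i - coord c i) > 0" by (intro sum_pos) simp_all
      then show False using P_sum[OF p] deg_real[of c] deg by (simp add: sum_subtractf)
    qed
    then obtain j where j: "p $ j - coord c j < \<mu>" by blast
    obtain q where q: "q \<in> P" "\<And>i. q $ i \<le> coord (c + uexp j) i" using c[of j] by (auto simp: NP_def)
    \<comment> \<open>\<open>D\<close> is the room left in coordinate j and \<open>B\<close> exceeds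
      its growth per unit of \<open>t\<close>; this \<open>t\<close> makes \<open>t * B\<close>
      smaller than \<open>D\<close>.\<close>
    define D B t where "D = \<mu> - (p $ j - coord c j)" and "B = \<bar>1 - (p $ j - coord c j)\<bar> + 1" and "t = D / (D + B)"
    have D: "D > 0" and B: "B > 0" using j by (auto simp: D_def B_def)
    then have t: "0 < t" "t < 1" "t * B < D" by (auto simp: t_def field_simps)
    let ?r = "(1 - t) *\<^sub>R p + t *\<^sub>R q"
    have "?r $ i - coord c i < \<mu>" for i
    proof (cases "i = j")
      case False
      have "?r $ i - coord c i = (1 - t) * (p $ i - coord c i) + t * (q $ i - coord c i)" by (simp add: algebra_simps)
      also have "\<dots> \<le> (1 - t) * \<mu> + t * 0"
        using t le_f[of p i] q(2)[of i] False by (intro add_mono mult_left_mono) (auto simp: \<mu>_def coord_add_uexp)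
      also have "\<dots> < \<mu>" using t pos by (simp add: algebra_simps)
      finally show ?thesis .
    next
      case True
      have "?r $ i - coord c i = (p $ j - coord c j) + t * ((q $ j - coord c j) - (p $ j - coord c j))" 
        by (simp add: True algebra_simps)
      also have "\<dots> \<le> (p $ j - coord c j) + t * B"
        using t q(2)[of j] by (intro add_left_mono mult_left_mono) (auto simp: B_def coord_add_uexp)
      also have "\<dots> < \<mu>" using t(3) by (simp add: D_def)
      finally show ?thesis .
    qed
    then have "f ?r < \<mu>" using f_less by blast
    moreover have "?r \<in> P" using P_segment[OF p q(1)] t by simp
    ultimately show ?thesis using min[of ?r] by (simp add: \<mu>_def)
  qed
qed

text \<open>Between the witnesses for \<open>c + uexp i\<close> and \<open>c + uexp j\<close> there
  is a point r with r_j = c_j. As deg c is at least d + 1, the coordinates i and k together have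
  slack at least 1: either r lies below \<open>c\<close>, or r_i exceeds c_i and coordinate k has
  slack above 1.\<close>

lemma edge_high:
  assumes ijk: "i \<noteq> j" "j \<noteq> k" "i \<noteq> k"
    and c: "c + uexp i \<in> NP" "c + uexp j \<in> NP" and deg: "deg c \<ge> d + 1"
  shows "c \<in> NP \<or> (\<exists>u. c = u + uexp k \<and> u + uexp i \<in> NP)"
proof -
  obtain p where p: "p \<in> P" "\<And>l. p $ l \<le> coord (c + uexp i) l" using c by (auto simp: NP_def)
  obtain q where q: "q \<in> P" "\<And>l. q $ l \<le> coord (c + uexp j) l" using c by (auto simp: NP_def)
  have pi: "p $ i \<le> coord c i + 1" "p $ j \<le> coord c j" "p $ k \<le> coord c k"
    using p(2)[of i] p(2)[of j] p(2)[of k] ijk by (auto simp: coord_add_uexp)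
  have qi: "q $ i \<le> coord c i" "q $ j \<le> coord c j + 1" "q $ k \<le> coord c k"
    using q(2)[of i] q(2)[of j] q(2)[of k] ijk by (auto simp: coord_add_uexp)
  show ?thesis
  proof (cases "q $ j \<le> coord c j")
    case True
    have "c \<in> NP" by (rule NP_I[OF q(1)], rule cases_distinct[OF ijk]) (use True qi in auto)
    then show ?thesis ..
  next
    case False
    define t where "t = (coord c j - p $ j) / (q $ j - p $ j)"
    have gt: "q $ j - p $ j > 0" using False pi by simp
    then have t: "0 \<le> t" "t \<le> 1" using False pi by (auto simp: t_def field_simps)
    have tt: "t * (q $ j - p $ j) = coord c j - p $ j" using gt by (simp add: t_def)
    define r where "r = (1 - t) *\<^sub>R p + t *\<^sub>R q"
    have r: "r \<in> P" unfolding r_def using P_segment[OF p(1) q(1) t] .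
    have rj: "r $ j = coord c j" using tt by (simp add: r_def algebra_simps)
    have "r $ i \<le> (1 - t) * (coord c i + 1) + t * (coord c i + 1)"
      unfolding r_def using t pi qi by (auto intro!: add_mono mult_left_mono)
    then have ri: "r $ i \<le> coord c i + 1" by (simp add: algebra_simps)
    have "r $ k \<le> (1 - t) * coord c k + t * coord c k"
      unfolding r_def using t pi qi by (auto intro!: add_mono mult_left_mono)
    then have rk: "r $ k \<le> coord c k" by (simp add: algebra_simps)
    have "real_of_int (deg c) \<ge> d + 1" using deg by linarith
    then have s: "r $ i + r $ k \<le> coord c i + coord c k - 1"
      using P_sum3[OF r ijk] deg3[OF ijk, of c] rj by linarith
    show ?thesis
    proof (cases "r $ i \<le> coord c i")
      case True
      have "c \<in> NP" by (rule NP_I[OF r], rule cases_distinct[OF ijk]) (use True rj rk in auto)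
      then show ?thesis ..
    next
      case False
      have "\<exists>u. c + uexp i = u + uexp k \<and> u \<in> NP"
      proof (rule NP_divide[OF r])
        show "r $ l \<le> coord (c + uexp i) l" for l
          by (rule cases_distinct[OF ijk, of l]) (use ri rj rk in \<open>auto simp: coord_add_uexp\<close>)
        show "r $ k \<le> coord (c + uexp i) k - 1" using s False ijk by (simp add: coord_add_uexp)
      qed
      then obtain v where v: "c + uexp i = v + uexp k" "v \<in> NP" by blast
      have "coord c k \<ge> 1" using s False P_nonneg[OF r, of k] by linarith
      then obtain u where u: "c = u + uexp k" by (rule exponent_split_ge)
      have "v + uexp k = (u + uexp i) + uexp k" using v(1) u by (simp add: ac_simps)
      then have "v = u + uexp i" by simp
      then show ?thesis using u v by blast
    qed
  qed
qed

lemma connected_high: "j \<ge> d + 3 \<Longrightarrow> connected_at NP j"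
  unfolding connected_at_def
proof (intro allI impI, elim conjE)
  fix k c assume c: "j \<ge> d + 3" "deg c + 2 = j" "c + uexp (k + 1) \<in> NP" "c + uexp (k + 2) \<in> NP"
  have "c \<in> NP \<or> (\<exists>u. c = u + uexp k \<and> u + uexp (k + 1) \<in> NP)" "c \<in> NP \<or> (\<exists>u. c = u + uexp k \<and> u + uexp (k + 2) \<in> NP)"
    using c edge_high[of "k + 1" "k + 2" k c] edge_high[of "k + 2" "k + 1" k c] by auto
  then show "c \<in> NP \<or> (\<exists>u. c = u + uexp k \<and> u + uexp (k + 1) \<in> NP \<and> u + uexp (k + 2) \<in> NP)" by auto
qed

text \<open>Move from a witness towards a point of \<open>A\<close>, where some slack is a positive
  integer, until the largest slack is exactly 1. The slacks have sum at least 2, so none is negative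
  there, and the variable with slack 1 can be divided out.\<close>

lemma reducible_high:
  assumes w: "w \<in> NP" "deg w \<ge> d + 2"
  shows "\<exists>i u. w = u + uexp i \<and> u \<in> NP"
proof -
  obtain p where p: "p \<in> P" "\<And>i. p $ i \<le> coord w i" using w by (auto simp: NP_def)
  obtain a where a: "a \<in> A" using A_nonempty by blast
  have sum: "(\<Sum>i\<in>UNIV. coord w i - q $ i) \<ge> 2" if "q \<in> P" for q
    using P_sum[OF that] deg_real[of w] w(2) by (simp add: sum_subtractf)
  define M where "M t = max (coord w 0 - ((1 - t) *\<^sub>R p + t *\<^sub>R real_vec a) $ 0) (max (coord w 1 - ((1 - t) *\<^sub>R p + t *\<^sub>R real_vec a) $ 1)
    (coord w 2 - ((1 - t) *\<^sub>R p + t *\<^sub>R real_vec a) $ 2))" for t :: real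
  show ?thesis
  proof (cases "\<exists>i. coord w i - p $ i \<ge> 1")
    case True
    then obtain i where "p $ i \<le> coord w i - 1" by (auto simp: algebra_simps)
    then show ?thesis using NP_divide[OF p] by blast
  next
    case False
    have "M 0 \<le> 1" using False by (auto simp: M_def not_le less_imp_le)
    moreover have "1 \<le> M 1"
    proof -
      have "\<exists>i. lookup w i > lookup a i"
      proof (rule ccontr)
        assume "\<not> ?thesis"
        then have "(\<Sum>i\<in>UNIV. coord w i - real_vec a $ i) \<le> 0" by (intro sum_nonpos) (auto simp: not_less)
        then show False using sum[OF real_vec_in_P[OF a]] by linarith
      qed
      then obtain i where "Suc (lookup a i) \<le> lookup w i" by (auto simp: Suc_le_eq)
      then have "real (Suc (lookup a i)) \<le> coord w i" by (simp only: of_nat_le_iff)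
      then have "coord w i - coord a i \<ge> 1" by simp
      then show ?thesis by (cases rule: cyclic_cases[of i 0]) (auto simp: M_def)
    qed
    moreover have "continuous_on {0..1} M" unfolding M_def by (intro continuous_intros)
    ultimately obtain t where t: "0 \<le> t" "t \<le> 1" "M t = 1" using IVT'[of M 0 1 1] by auto
    let ?r = "(1 - t) *\<^sub>R p + t *\<^sub>R real_vec a"
    have r: "?r \<in> P" using P_segment[OF p(1) real_vec_in_P[OF a]] t by blast
    have le: "coord w i - ?r $ i \<le> 1" for i
      using t(3) by (cases rule: cyclic_cases[of i 0]) (auto simp: M_def max_def split: if_splits)
    have "\<exists>i. coord w i - ?r $ i = 1"
      using t(3) unfolding M_def max_def by (metis)
    then obtain i where i: "coord w i - ?r $ i = 1" by blast
    have "?r $ l \<le> coord w l" for l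
    proof -
      obtain k m where km: "l \<noteq> k" "k \<noteq> m" "l \<noteq> m" by (metis cyclic_distinct(1,2,3))
      show ?thesis using sum[OF r] sum_distinct[OF km, of "\<lambda>i. coord w i - ?r $ i"] le[of k] le[of m] by linarith
    qed
    then show ?thesis using NP_divide[OF r, of w i] i by auto
  qed
qed

definition steps :: "(expo \<times> expo) set" where
  "steps = {(a, b). a \<in> A \<and> b \<in> A \<and> (\<exists>i l. a + uexp i = b + uexp l)}"

end

section \<open>The case of linear first syzygies\<close>

locale connected_newton = newton +
  assumes connected: "\<And>a b. a \<in> A \<Longrightarrow> b \<in> A \<Longrightarrow> (a, b) \<in> steps\<^sup>*"
begin

text \<open>A unit step changes each coordinate by at most one, so a path from \<open>a\<close> to
  \<open>b\<close> cannot jump over the value \<open>x\<close>.\<close>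

lemma slice:
  assumes "a \<in> A" "b \<in> A" "lookup a i \<le> x" "x \<le> lookup b i"
  shows "\<exists>c\<in>A. lookup c i = x"
proof (rule ccontr)
  assume no: "\<not> ?thesis"
  have "(a, b) \<in> steps\<^sup>*" by (rule connected[OF assms(1,2)])
  then have "lookup b i < x"
  proof (induction rule: rtrancl_induct)
    case base then show ?case using no assms by force
  next
    case (step y z)
    then obtain k l where kl: "y + uexp k = z + uexp l" and z: "z \<in> A" by (auto simp: steps_def)
    have "lookup y i + (if k = i then 1 else 0) = lookup z i + (if l = i then 1 else 0)"
      using arg_cong[OF kl, of "\<lambda>m. lookup m i"] by (simp add: lookup_add lookup_uexp)
    then have "lookup z i \<le> lookup y i + 1" by (auto split: if_splits)
    moreover have "lookup z i \<noteq> x" using no z by blast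
    ultimately show ?case using step.IH by linarith
  qed
  then show False using assms by simp
qed

text \<open>The coordinates of \<open>w - a\<close>, for \<open>a\<close> in the plane of \<open>A\<close>, are the barycentric coordinates of \<open>a\<close>
  with respect to the unit triangle with vertices \<open>w - uexp i\<close>. If the polygon meets this triangle but
  contains none of its vertices, then each of the three lines \<open>a\<^sub>i = w\<^sub>i\<close> through its sides contains a
  point of \<open>A\<close> outside of the side; three such points surround a vertex.\<close>

lemma reducible:
  assumes w: "w \<in> NP" "deg w = d + 1"
  shows "\<exists>i u. w = u + uexp i \<and> u \<in> NP"
proof (rule ccontr)
  assume "\<not> ?thesis"
  \<comment> \<open>No vertex \<open>w - uexp i\<close> of the unit triangle belongs to
    \<open>P\<close>.\<close>
  then have NE: False if "r \<in> P" "r $ i = coord w i - 1" "r $ (i + 1) = coord w (i + 1)" "r $ (i + 2) = coord w (i + 2)" for r i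
  proof -
    have "r $ l \<le> coord w l" for l
      by (cases rule: cyclic_cases[of l i]) (use that in auto)
    then show False using NP_divide[OF that(1), of w i] \<open>\<not> (\<exists>i u. w = u + uexp i \<and> u \<in> NP)\<close> that(2) by auto
  qed
  obtain p where p: "p \<in> P" "\<And>i. p $ i \<le> coord w i" using w by (auto simp: NP_def)
  have degw: "coord w i + coord w (i + 1) + coord w (i + 2) = d + 1" for i
    using deg3[of i "i + 1" "i + 2" w] w by simp
  have Psum: "r $ i + r $ (i + 1) + r $ (i + 2) = d" if "r \<in> P" for r i
    using P_sum3[OF that, of i "i + 1" "i + 2"] by simp
  \<comment> \<open>If \<open>A\<close> lay strictly below w_i, then \<open>p\<close>, a point of
    the triangle, would have to be its vertex \<open>w - uexp i\<close>; if strictly above,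
    \<open>p\<close> could not satisfy p_i <= w_i.\<close>
  have "\<exists>a\<in>A. lookup a i = lookup w i" for i
  proof -
    have "\<exists>b\<in>A. lookup w i \<le> lookup b i"
    proof (rule ccontr)
      assume "\<not> ?thesis"
      then have "coord a i \<le> coord w i - 1" if "a \<in> A" for a
        using that by (metis Suc_leI le_diff_eq not_le of_nat_Suc of_nat_le_iff add.commute)
      then have "p $ i \<le> coord w i - 1" by (rule P_le) (use p in auto)
      then show False using NE[OF p(1), of i] Psum[OF p(1), of i] degw[of i] p(2)[of "i + 1"] p(2)[of "i + 2"] by linarith
    qed
    moreover have "\<exists>a\<in>A. lookup a i \<le> lookup w i"
    proof (rule ccontr)
      assume "\<not> ?thesis"
      then have "coord w i + 1 \<le> coord a i" if "a \<in> A" for a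
        using that by (metis Suc_leI not_le of_nat_Suc of_nat_le_iff add.commute)
      then have "coord w i + 1 \<le> p $ i" by (rule P_ge) (use p in auto)
      then show False using p(2)[of i] by linarith
    qed
    ultimately show ?thesis using slice by blast
  qed
  then obtain a where a: "\<And>i. a i \<in> A" "\<And>i. lookup (a i) i = lookup w i" by metis
  define \<delta> where "\<delta> i j = coord w j - coord (a i) j" for i j
  have aP: "real_vec (a i) \<in> P" for i using a real_vec_in_P by blast
  have \<delta>0: "\<delta> i i = 0" for i using a(2) by (simp add: \<delta>_def)
  have \<delta>2: "\<delta> i (i + 2) = 1 - \<delta> i (i + 1)" for i
    using Psum[OF aP, of i i] degw[of i] a(2)[of i] by (simp add: \<delta>_def)
  \<comment> \<open>On the line i the two other barycentric coordinates are integers with sum 1. The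
    values 0 and 1 are vertices, so the point lies beyond one end of the side.\<close>
  have s_cases: "\<delta> i (i + 1) \<ge> 2 \<or> \<delta> i (i + 2) \<ge> 2" for i
  proof -
    obtain z :: int where z: "\<delta> i (i + 1) = of_int z"
      unfolding \<delta>_def by (metis of_int_diff of_int_of_nat_eq)
    have "z \<noteq> 0"
    proof
      assume "z = 0"
      then show False using NE[OF aP, of i "i + 2"] \<delta>2[of i] \<delta>0[of i] z by (simp add: \<delta>_def)
    qed
    moreover have "z \<noteq> 1"
    proof
      assume "z = 1"
      then show False using NE[OF aP, of i "i + 1"] \<delta>2[of i] \<delta>0[of i] z by (simp add: \<delta>_def)
    qed
    ultimately have "z \<ge> 2 \<or> z \<le> - 1" by linarith
    then show ?thesis unfolding \<delta>2 z by linarith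
  qed
  have comb: False if "q \<in> P" "r \<in> P" "s \<in> P" "\<alpha> \<ge> 0" "\<beta> \<ge> 0" "\<gamma> \<ge> 0" "\<alpha> + \<beta> + \<gamma> > 0"
    "\<alpha> * (coord w (i + 1) - q $ (i + 1)) + \<beta> * (coord w (i + 1) - r $ (i + 1)) + \<gamma> * (coord w (i + 1) - s $ (i + 1)) = 0"
    "\<alpha> * (coord w (i + 2) - q $ (i + 2)) + \<beta> * (coord w (i + 2) - r $ (i + 2)) + \<gamma> * (coord w (i + 2) - s $ (i + 2)) = 0"
    for q r s \<alpha> \<beta> \<gamma> i
  proof -
    let ?x = "\<lambda>j. if j = i then coord w i - 1 else coord w j"
    have "(\<alpha> + \<beta> + \<gamma>) * ?x j = \<alpha> * q $ j + \<beta> * r $ j + \<gamma> * s $ j" for j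
    proof (cases rule: cyclic_cases[of j i])
      case 1
      have "\<alpha> * (q $ i + q $ (i + 1) + q $ (i + 2)) + \<beta> * (r $ i + r $ (i + 1) + r $ (i + 2))
          + \<gamma> * (s $ i + s $ (i + 1) + s $ (i + 2)) = (\<alpha> + \<beta> + \<gamma>) * (coord w i + coord w (i + 1) + coord w (i + 2) - 1)"
        using Psum[OF that(1), of i] Psum[OF that(2), of i] Psum[OF that(3), of i] degw[of i] by (simp add: algebra_simps)
      then show ?thesis using that(8,9) 1 by (simp add: algebra_simps)
    qed (use that(8,9) in \<open>auto simp: algebra_simps\<close>)
    then have "(\<chi> j. ?x j) \<in> P" by (rule P_combination3[OF that(1-7)])
    then show False using NE[of "\<chi> j. ?x j" i] by simp
  qed
  let ?s = "\<lambda>i. \<delta> i (i + 1) \<ge> 2"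
  \<comment> \<open>Two of the points cannot both lie beyond the vertex v: together with
    \<open>p\<close> they would surround it. The weights below cancel the barycentric coordinates v
    + 1 and v + 2. Hence all three points deviate in the same rotational sense.\<close>
  have imp: "?s (v + 1)" if s2: "?s (v + 2)" for v
  proof (rule ccontr)
    assume "\<not> ?s (v + 1)"
    then have y: "\<delta> (v + 1) v \<ge> 2" using s_cases[of "v + 1"] by simp
    have x: "\<delta> (v + 2) v \<ge> 2" using s2 by simp
    let ?\<epsilon> = "\<lambda>i. coord w i - p $ i"
    let ?x = "\<delta> (v + 2) v - 1" and ?y = "\<delta> (v + 1) v - 1"
    have eqs: "\<delta> (v + 1) (v + 1) = 0" "\<delta> (v + 1) (v + 2) = - ?y" "\<delta> (v + 2) (v + 2) = 0" "\<delta> (v + 2) (v + 1) = - ?x"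
      using \<delta>0 \<delta>2[of "v + 1"] \<delta>2[of "v + 2"] by simp_all
    have e0: "?\<epsilon> i \<ge> 0" for i using p(2) by simp
    have xy: "?x > 0" "?y > 0" using x y by simp_all
    show False
    proof (rule comb[OF aP[of "v + 1"] aP[of "v + 2"] p(1), of "?\<epsilon> (v + 2) * ?x" "?\<epsilon> (v + 1) * ?y" "?x * ?y" v])
      show "?\<epsilon> (v + 2) * ?x + ?\<epsilon> (v + 1) * ?y + ?x * ?y > 0"
        using e0 xy by (intro add_nonneg_pos add_nonneg_nonneg mult_pos_pos mult_nonneg_nonneg) (auto simp: less_imp_le)
      show "?\<epsilon> (v + 2) * ?x \<ge> 0" "?\<epsilon> (v + 1) * ?y \<ge> 0" "?x * ?y \<ge> 0"
        using e0 xy by (auto intro!: mult_nonneg_nonneg simp: less_imp_le)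
    qed (unfold real_vec_nth \<delta>_def[symmetric] eqs, simp_all add: algebra_simps)
  qed
  have eqs: "\<delta> 0 2 = 1 - \<delta> 0 1" "\<delta> 1 0 = 1 - \<delta> 1 2" "\<delta> 2 1 = 1 - \<delta> 2 0"
    "\<delta> 0 0 = 0" "\<delta> 1 1 = 0" "\<delta> 2 2 = 0"
    using \<delta>0 \<delta>2[of 0] \<delta>2[of 1] \<delta>2[of 2] by simp_all
  let ?x = "\<delta> 2 0" and ?y = "\<delta> 0 1" and ?z = "\<delta> 1 2"
  show False
  proof (cases "?s 0")
    case True
    then have s: "?x \<ge> 2" "?y \<ge> 2" "?z \<ge> 2" using imp[of 1] imp[of 0] imp[of 2] by simp_all
    show False
    \<comment> \<open>With barycentric coordinates (0, y, 1 - y), (1 - z, 0, z) and (x, 1 - x, 0),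
      these weights cancel coordinates 0 and 1 and leave the vertex 2.\<close>
    proof (rule comb[OF aP[of 0] aP[of 1] aP[of 2], of "(?x - 1) * (?z - 1)" "?x * ?y" "?y * (?z - 1)" 2])
      show "(?x - 1) * (?z - 1) + ?x * ?y + ?y * (?z - 1) > 0"
        using s by (intro add_pos_pos mult_pos_pos) auto
      show "(?x - 1) * (?z - 1) \<ge> 0" "?x * ?y \<ge> 0" "?y * (?z - 1) \<ge> 0"
        using s by (auto intro!: mult_nonneg_nonneg)
    qed (simp_all add: \<delta>_def[symmetric] eqs algebra_simps)
  next
    case False
    then have ns: "\<not> ?s 0" "\<not> ?s 1" "\<not> ?s 2" using imp[of 1] imp[of 0] imp[of 2] by auto
    let ?x = "\<delta> 2 1" and ?y = "\<delta> 0 2" and ?z = "\<delta> 1 0"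
    have s: "?x \<ge> 2" "?y \<ge> 2" "?z \<ge> 2"
      using ns s_cases[of 0] s_cases[of 1] s_cases[of 2] by simp_all
    show False
    \<comment> \<open>The mirror image: the points are (0, 1 - y, y), (z, 0, 1 - z) and (1 - x, x,
      0), and the weights leave the vertex 1.\<close>
    proof (rule comb[OF aP[of 0] aP[of 1] aP[of 2], of "(?z - 1) * (?x - 1)" "(?x - 1) * ?y" "?z * ?y" 1])
      show "(?z - 1) * (?x - 1) + (?x - 1) * ?y + ?z * ?y > 0"
        using s by (intro add_pos_pos mult_pos_pos) auto
      show "(?z - 1) * (?x - 1) \<ge> 0" "(?x - 1) * ?y \<ge> 0" "?z * ?y \<ge> 0"
        using s by (auto intro!: mult_nonneg_nonneg)
    qed (simp_all add: \<delta>_def[symmetric] eqs algebra_simps)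
  qed
qed

lemma midpoint_P: "p \<in> P \<Longrightarrow> q \<in> P \<Longrightarrow> (1 / 2) *\<^sub>R p + (1 / 2) *\<^sub>R q \<in> P"
  using P_segment[of p q "1 / 2"] by simp

text \<open>On the line where coordinate i equals c_i, the midpoint of \<open>V\<close> and
  \<open>W\<close> lies halfway between \<open>c\<close> and \<open>c + uexp j - uexp k\<close>. By
  \<open>slice\<close> this line contains a point of \<open>A\<close>; being integral, it lies at or
  beyond one of these two neighbours, which is therefore on the segment to the midpoint.\<close>

lemma connected_aux:
  assumes ijk: "i \<noteq> j" "j \<noteq> k" "i \<noteq> k"
    and c: "deg c = d" and V: "c + uexp j = V + uexp i" "V \<in> NP" and W: "c + uexp i = W + uexp k" "W \<in> NP"
  shows "c \<in> NP \<or> (\<exists>u. c = u + uexp k \<and> u + uexp i \<in> NP \<and> u + uexp j \<in> NP)"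
proof -
  have "deg V = d" "deg W = d" using arg_cong[OF V(1), of deg] arg_cong[OF W(1), of deg] c by simp_all
  then have P: "real_vec V \<in> P" "real_vec W \<in> P" using NP_deg_d V W by auto
  have Vc: "coord V i = coord c i - 1" "coord V j = coord c j + 1" "coord V k = coord c k"
    using arg_cong[OF V(1), of "\<lambda>m. coord m i"] arg_cong[OF V(1), of "\<lambda>m. coord m j"] arg_cong[OF V(1), of "\<lambda>m. coord m k"] ijk
    by (simp_all add: coord_add_uexp)
  have Wc: "coord W i = coord c i + 1" "coord W j = coord c j" "coord W k = coord c k - 1"
    using arg_cong[OF W(1), of "\<lambda>m. coord m i"] arg_cong[OF W(1), of "\<lambda>m. coord m j"] arg_cong[OF W(1), of "\<lambda>m. coord m k"] ijk
    by (simp_all add: coord_add_uexp)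
  have "\<exists>a\<in>A. lookup a i \<le> lookup c i"
  proof (rule ccontr)
    assume "\<not> ?thesis"
    then have "coord c i \<le> coord a i" if "a \<in> A" for a using that by force
    then have "coord c i \<le> real_vec V $ i" by (rule P_ge) (use P in auto)
    then show False using Vc by simp
  qed
  moreover have "\<exists>b\<in>A. lookup c i \<le> lookup b i"
  proof (rule ccontr)
    assume "\<not> ?thesis"
    then have "coord a i \<le> coord c i" if "a \<in> A" for a using that by force
    then have "real_vec W $ i \<le> coord c i" by (rule P_le) (use P in auto)
    then show False using Wc by simp
  qed
  ultimately obtain a where a: "a \<in> A" "coord a i = coord c i" using slice by (metis of_nat_eq_iff)
  note aP = real_vec_in_P[OF a(1)]
  define m where "m = (1 / 2) *\<^sub>R real_vec V + (1 / 2) *\<^sub>R real_vec W"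
  have mP: "m \<in> P" unfolding m_def using P by (rule midpoint_P)
  have m: "m $ i = coord c i" "m $ j = coord c j + 1 / 2" "m $ k = coord c k - 1 / 2"
    using Vc Wc by (simp_all add: m_def field_simps)
  have ak: "coord a j + coord a k = coord c j + coord c k"
    using P_sum3[OF aP ijk] deg3[OF ijk, of c] c a by simp
  consider "coord a j \<le> coord c j" | "coord a j \<ge> coord c j + 1"
    by (metis Suc_leI add.commute not_le_imp_less of_nat_Suc of_nat_le_iff)
  then show ?thesis
  proof cases
    case 1
    define t where "t = (coord c j - coord a j) / (coord c j + 1 / 2 - coord a j)"
    have t: "0 \<le> t" "t \<le> 1" using 1 by (auto simp: t_def field_simps)
    have tt: "t * (coord c j + 1 / 2 - coord a j) = coord c j - coord a j" using 1 by (simp add: t_def)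
    let ?r = "(1 - t) *\<^sub>R real_vec a + t *\<^sub>R m"
    have "?r $ j = coord c j" using tt by (simp add: m algebra_simps)
    moreover have "?r $ i = coord c i" by (simp add: m a algebra_simps)
    moreover have r: "?r \<in> P" using P_segment[OF aP mP t] .
    ultimately have "?r $ k = coord c k" using P_sum3[OF r ijk] deg3[OF ijk, of c] c by linarith
    with \<open>?r $ i = coord c i\<close> \<open>?r $ j = coord c j\<close> have "?r $ l \<le> coord c l" for l
      by (cases rule: cases_distinct[OF ijk, of l]) auto
    then have "c \<in> NP" by (rule NP_I[OF r])
    then show ?thesis ..
  next
    case 2
    have "coord c k \<ge> 1" using 2 ak by simp
    then obtain u where u: "c = u + uexp k" by (rule exponent_split_ge)
    have "W + uexp k = (u + uexp i) + uexp k" using W(1) u by (simp add: ac_simps)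
    then have "W = u + uexp i" by simp
    \<comment> \<open>The parameter at which the segment reaches the neighbour
      \<open>u + uexp j\<close>; the other required point \<open>u + uexp i\<close> is
      \<open>W\<close> itself.\<close>
    define t where "t = (coord a j - (coord c j + 1)) / (coord a j - (coord c j + 1 / 2))"
    have t: "0 \<le> t" "t \<le> 1" using 2 by (auto simp: t_def field_simps)
    have tt: "t * (coord a j - (coord c j + 1 / 2)) = coord a j - (coord c j + 1)" using 2 by (simp add: t_def)
    let ?r = "(1 - t) *\<^sub>R real_vec a + t *\<^sub>R m"
    have rj: "?r $ j = coord c j + 1" using tt by (simp add: m algebra_simps)
    have ri: "?r $ i = coord c i" by (simp add: m a algebra_simps)
    have r: "?r \<in> P" using P_segment[OF aP mP t] .
    have rk: "?r $ k = coord c k - 1" using P_sum3[OF r ijk] deg3[OF ijk, of c] c ri rj by linarith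
    have "?r $ l \<le> coord (u + uexp j) l" for l
      by (cases rule: cases_distinct[OF ijk, of l]) (use ri rj rk ijk in \<open>auto simp: u coord_add_uexp\<close>)
    then have "u + uexp j \<in> NP" by (rule NP_I[OF r])
    then show ?thesis using u W \<open>W = u + uexp i\<close> by blast
  qed
qed

text \<open>Both given exponents have degree d + 1, so \<open>reducible\<close> divides each by a
  variable. The cases compare the two variables.\<close>

lemma connected_low: "connected_at NP (d + 2)"
  unfolding connected_at_def
proof (intro allI impI, elim conjE)
  fix k c assume c: "deg c + 2 = d + 2" "c + uexp (k + 1) \<in> NP" "c + uexp (k + 2) \<in> NP"
  let ?i = "k + 1" and ?j = "k + 2"
  let ?C = "c \<in> NP \<or> (\<exists>u. c = u + uexp k \<and> u + uexp ?i \<in> NP \<and> u + uexp ?j \<in> NP)"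
  obtain x u where u: "c + uexp ?i = u + uexp x" "u \<in> NP" using reducible[OF c(2)] c(1) by auto
  obtain y v where v: "c + uexp ?j = v + uexp y" "v \<in> NP" using reducible[OF c(3)] c(1) by auto
  show ?C
  proof (cases "x = ?i \<or> y = ?j")
    case True then show ?thesis using u v by auto
  next
    case False
    then consider "x = k" "y = k" | "x = k" "y = ?i" | "x = ?j" "y = k" | "x = ?j" "y = ?i"
      using cyclic_cases by metis
    then show ?thesis
    proof cases
      case 1
      have "lookup c k \<noteq> 0"
        using arg_cong[OF u(1), of "\<lambda>m. lookup m k"] 1 by (simp add: lookup_add lookup_uexp)
      then obtain z where z: "c = z + uexp k" by (rule exponent_split)
      have "(z + uexp ?i) + uexp k = u + uexp k" "(z + uexp ?j) + uexp k = v + uexp k"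
        using u(1) v(1) 1 by (simp_all add: z ac_simps)
      then show ?thesis using u v z by auto
    next
      case 2
      then show ?thesis using connected_aux[of ?i ?j k c v u] u v c by simp
    next
      case 3
      then show ?thesis using connected_aux[of ?j ?i k c u v] u v c by auto
    next
      case 4
      \<comment> \<open>Now \<open>u\<close> and \<open>v\<close> are opposite neighbours of
        \<open>c\<close>, whose midpoint is \<open>c\<close>.\<close>
      have d: "deg u = d" "deg v = d" using arg_cong[OF u(1), of deg] arg_cong[OF v(1), of deg] c by simp_all
      have "(1 / 2) *\<^sub>R real_vec u + (1 / 2) *\<^sub>R real_vec v \<in> P" using d u v by (intro midpoint_P NP_deg_d)
      moreover have "((1 / 2) *\<^sub>R real_vec u + (1 / 2) *\<^sub>R real_vec v) $ l \<le> coord c l" for l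
      proof -
        have "coord u l + coord v l = 2 * coord c l"
          using arg_cong[OF u(1), of "\<lambda>m. coord m l"] arg_cong[OF v(1), of "\<lambda>m. coord m l"] 4
          unfolding coord_add_uexp by (auto split: if_splits)
        then show ?thesis by simp
      qed
      ultimately show ?thesis using NP_I by blast
    qed
  qed
qed

end

section \<open>Integral closure of monomial ideals\<close>

interpretation rm: Modules.module "(*) :: 'r::comm_ring_1 \<Rightarrow> 'r \<Rightarrow> 'r"
  by standard (auto simp: algebra_simps)

declare rm.scale_scale [simp del]

lemma ideal_power_mult:
  fixes I :: "'r::comm_ring_1 set"
  assumes "p \<in> ideal_power I i" "a \<in> I"
  shows "p * a \<in> ideal_power I (Suc i)"
proof -
  let ?S = "{p. p * a \<in> ideal_power I (Suc i)}"
  have "rm.subspace ?S"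
    unfolding ideal_power_def
    by (rule rm.subspaceI) (auto simp: distrib_right mult.assoc intro: rm.span_add rm.span_scale rm.span_zero)
  moreover have "(\<Prod>k<i. f k) \<in> ?S" if "\<forall>k<i. f k \<in> I" for f
  proof -
    have "(\<Prod>k<i. f k) * a = (\<Prod>k<Suc i. (f(i := a)) k)"
      by (simp add: lessThan_Suc mult.commute)
    then show ?thesis using that assms(2) unfolding ideal_power_def
      by (intro CollectI rm.span_base) (auto simp: less_Suc_eq intro!: exI[of _ "f(i := a)"])
  qed
  ultimately have "ideal_power I i \<subseteq> ?S"
    unfolding ideal_power_def by (intro rm.span_minimal) auto
  then show ?thesis using assms(1) by blast
qed

lemma ideal_power_1: "a \<in> I \<Longrightarrow> a \<in> ideal_power I (Suc 0)"
  using ideal_power_mult[of 1 I 0 a] rm.span_base[of 1 "{1}"] unfolding ideal_power_def by simp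

lemma ideal_power_zero [simp]: "0 \<in> ideal_power I i"
  unfolding ideal_power_def by (rule rm.span_zero)

lemma ideal_power_add: "p \<in> ideal_power I i \<Longrightarrow> q \<in> ideal_power I i \<Longrightarrow> p + q \<in> ideal_power I i"
  unfolding ideal_power_def by (rule rm.span_add)

lemma ideal_power_scale: "p \<in> ideal_power I i \<Longrightarrow> c * p \<in> ideal_power I i"
  unfolding ideal_power_def by (rule rm.span_scale)

text \<open>The possible lower parts of an equation of integral dependence of degree
  \<open>n\<close> for \<open>f\<close>. Unlike the equations themselves they are closed under sums
  and multiples, which suits the expansion of a determinant.\<close>

definition lower_terms :: "'r::comm_ring_1 set \<Rightarrow> 'r \<Rightarrow> nat \<Rightarrow> 'r set" where
  "lower_terms I f n = {\<Sum>i=1..n. a i * f ^ (n - i) | a. \<forall>i\<in>{1..n}. a i \<in> ideal_power I i}"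

lemma lower_terms_zero: "0 \<in> lower_terms I f n"
  unfolding lower_terms_def by (intro CollectI exI[of _ "\<lambda>_. 0"]) auto

lemma lower_terms_add:
  assumes "u \<in> lower_terms I f n" "v \<in> lower_terms I f n" shows "u + v \<in> lower_terms I f n"
proof -
  obtain a b where "u = (\<Sum>i=1..n. a i * f ^ (n - i))" "\<forall>i\<in>{1..n}. a i \<in> ideal_power I i"
    "v = (\<Sum>i=1..n. b i * f ^ (n - i))" "\<forall>i\<in>{1..n}. b i \<in> ideal_power I i"
    using assms unfolding lower_terms_def by blast
  then show ?thesis unfolding lower_terms_def
    by (intro CollectI exI[of _ "\<lambda>i. a i + b i"]) (auto simp: sum.distrib distrib_right intro: ideal_power_add)
qed

lemma lower_terms_scale:
  assumes "u \<in> lower_terms I f n" shows "c * u \<in> lower_terms I f n"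
proof -
  obtain a where "u = (\<Sum>i=1..n. a i * f ^ (n - i))" "\<forall>i\<in>{1..n}. a i \<in> ideal_power I i"
    using assms unfolding lower_terms_def by blast
  then show ?thesis unfolding lower_terms_def
    by (intro CollectI exI[of _ "\<lambda>i. c * a i"]) (auto simp: sum_distrib_left mult.assoc intro: ideal_power_scale)
qed

lemma lower_terms_sum:
  "(\<And>x. x \<in> S \<Longrightarrow> g x \<in> lower_terms I f n) \<Longrightarrow> sum g S \<in> lower_terms I f n"
  by (induction S rule: infinite_finite_induct) (auto intro: lower_terms_add lower_terms_zero)

lemma lower_terms_mult_f:
  assumes "u \<in> lower_terms I f n" shows "u * f \<in> lower_terms I f (Suc n)"
proof -
  obtain a where a: "u = (\<Sum>i=1..n. a i * f ^ (n - i))" "\<forall>i\<in>{1..n}. a i \<in> ideal_power I i"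
    using assms unfolding lower_terms_def by blast
  let ?b = "a(Suc n := 0)"
  have "(\<Sum>i=1..Suc n. ?b i * f ^ (Suc n - i)) = (\<Sum>i=1..n. a i * f ^ (Suc n - i))"
    by (simp)
  also have "\<dots> = u * f"
    unfolding a(1) sum_distrib_right by (rule sum.cong) (auto simp: Suc_diff_le mult_ac)
  finally show ?thesis
    using a(2) unfolding lower_terms_def by (intro CollectI exI[of _ ?b]) auto
qed

lemma lower_terms_mult_ideal:
  assumes "u \<in> lower_terms I f n" "x \<in> I" shows "u * x \<in> lower_terms I f (Suc n)"
proof -
  obtain a where a: "u = (\<Sum>i=1..n. a i * f ^ (n - i))" "\<forall>i\<in>{1..n}. a i \<in> ideal_power I i"
    using assms unfolding lower_terms_def by blast
  let ?b = "\<lambda>i. if i = 1 then 0 else a (i - 1) * x"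
  have "(\<Sum>i=1..Suc n. ?b i * f ^ (Suc n - i)) = (\<Sum>i=Suc 1..Suc n. ?b i * f ^ (Suc n - i))"
    by (subst sum.atLeast_Suc_atMost) auto
  also have "\<dots> = (\<Sum>i=1..n. ?b (Suc i) * f ^ (n - i))"
    by (subst sum.shift_bounds_cl_Suc_ivl) simp
  also have "\<dots> = u * x"
    unfolding a(1) sum_distrib_right by (rule sum.cong) (auto simp: mult_ac)
  finally have "u * x = (\<Sum>i=1..Suc n. ?b i * f ^ (Suc n - i))" ..
  moreover have "?b i \<in> ideal_power I i" if "i \<in> {1..Suc n}" for i
  proof (cases "i = 1")
    case False
    then have "i - 1 \<in> {1..n}" using that by auto
    then have "a (i - 1) * x \<in> ideal_power I (Suc (i - 1))"
      using a(2) assms(2) by (intro ideal_power_mult) blast+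
    with False that show ?thesis by simp
  qed simp
  ultimately show ?thesis unfolding lower_terms_def by (intro CollectI exI[of _ ?b] conjI ballI; blast)
qed

lemma ideal_power_f_lower_terms:
  assumes "x \<in> I" shows "x * f ^ n \<in> lower_terms I f (Suc n)"
proof -
  have "(\<Sum>i=1..Suc n. (if i = 1 then x else 0) * f ^ (Suc n - i)) = (\<Sum>i=1..Suc n. if i = 1 then x * f ^ n else 0)"
    by (rule sum.cong) auto
  then have "x * f ^ n = (\<Sum>i=1..Suc n. (if i = 1 then x else 0) * f ^ (Suc n - i))" by simp
  then show ?thesis using ideal_power_1[OF assms] unfolding lower_terms_def
    by (intro CollectI exI[of _ "\<lambda>i. if i = 1 then x else 0"]) auto
qed

text \<open>Expansion of one summand of the determinant: choosing the ideal element in at least one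
  factor gives a lower term. The \<open>c i\<close> tell diagonal from off-diagonal factors.\<close>

lemma prod_lower_terms:
  assumes "\<And>i. i < n \<Longrightarrow> a i \<in> I"
  shows "\<exists>w\<in>lower_terms I f n. (\<Prod>i<n. c i * f + a i) = (\<Prod>i<n. c i) * f ^ n + w"
  using assms
proof (induction n)
  case 0 then show ?case using lower_terms_zero[of I f 0] by (intro bexI[of _ 0]) auto
next
  case (Suc n)
  then obtain w where w: "w \<in> lower_terms I f n" "(\<Prod>i<n. c i * f + a i) = (\<Prod>i<n. c i) * f ^ n + w"
    by (metis less_Suc_eq)
  let ?C = "\<Prod>i<n. c i"
  have "(\<Prod>i<Suc n. c i * f + a i) = (\<Prod>i<Suc n. c i) * f ^ Suc n + (?C * (a n * f ^ n) + (c n * (w * f) + w * a n))"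
    unfolding prod.lessThan_Suc w(2) by (simp add: algebra_simps)
  moreover have "?C * (a n * f ^ n) + (c n * (w * f) + w * a n) \<in> lower_terms I f (Suc n)"
    using w(1) Suc.prems by (intro lower_terms_add lower_terms_scale ideal_power_f_lower_terms
        lower_terms_mult_f lower_terms_mult_ideal) auto
  ultimately show ?case by blast
qed

text \<open>Multiplication by \<open>f\<close> acts on the span of \<open>B\<close> through the matrix \<open>C\<close>, so \<open>det (f - C) = 0\<close>;
  expanding the determinant gives an equation of integral dependence.\<close>

lemma integral_if_stable:
  fixes f :: "'r::idom" and I :: "'r set"
  assumes I: "\<And>x. x \<in> I \<Longrightarrow> - x \<in> I" and B: "finite B" "B \<noteq> {}" "0 \<notin> B"
    and C: "\<And>u v. C u v \<in> I"
    and stable: "\<And>u. u \<in> B \<Longrightarrow> f * u = (\<Sum>v\<in>B. C u v * v)"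
  shows "f \<in> integral_closure I"
proof -
  obtain bs where bs: "set bs = B" "distinct bs" using finite_distinct_list[OF B(1)] by blast
  define n where "n = length bs"
  have n: "n > 0" using bs B(2) by (auto simp: n_def)
  define M where "M = Matrix.mat n n (\<lambda>(i, j). (if i = j then f else 0) - C (bs ! i) (bs ! j))"
  have M: "M \<in> carrier_mat n n" by (simp add: M_def)
  let ?v = "Matrix.vec n (\<lambda>i. bs ! i)"
  have "M *\<^sub>v ?v = 0\<^sub>v n"
  proof (rule eq_vecI)
    fix i assume i: "i < dim_vec (0\<^sub>v n :: 'r Matrix.vec)"
    have "vec_index (M *\<^sub>v ?v) i = (\<Sum>j=0..<n. ((if i = j then f else 0) - C (bs ! i) (bs ! j)) * bs ! j)"
      using i by (simp add: M_def scalar_prod_def)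
    also have "\<dots> = (\<Sum>j=0..<n. (if i = j then f * bs ! i else 0)) - (\<Sum>j=0..<n. C (bs ! i) (bs ! j) * bs ! j)"
      unfolding sum_subtractf[symmetric] by (rule sum.cong) (auto simp: algebra_simps)
    also have "(\<Sum>j=0..<n. C (bs ! i) (bs ! j) * bs ! j) = (\<Sum>v\<in>B. C (bs ! i) v * v)"
      using bs by (intro sum.reindex_bij_betw bij_betw_nth) (auto simp: n_def atLeast0LessThan)
    also have "\<dots> = f * bs ! i"
      using stable[of "bs ! i"] i bs by (auto simp: n_def)
    finally show "vec_index (M *\<^sub>v ?v) i = vec_index (0\<^sub>v n) i" using i by simp
  qed (simp add: M_def)
  moreover have "?v \<noteq> 0\<^sub>v n"
  proof
    assume "?v = 0\<^sub>v n"
    then have "vec_index ?v 0 = vec_index (0\<^sub>v n) 0" by simp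
    then show False using n bs B(3) by (metis index_vec index_zero_vec(1) n_def nth_mem)
  qed
  ultimately have "Determinant.det M = 0"
    using det_0_iff_vec_prod_zero[OF M] vec_carrier by blast
  then have 0: "(\<Sum>p\<in>{p. p permutes {0..<n}}. signof p * (\<Prod>i=0..<n. M $$ (i, p i))) = 0"
    using det_def'[OF M] by simp
  have "\<exists>w\<in>lower_terms I f n. (\<Prod>i=0..<n. M $$ (i, p i)) = (if p = id then f ^ n else 0) + w"
    if p: "p permutes {0..<n}" for p
  proof -
    define c where "c i = (if i = p i then 1 else 0 :: 'r)" for i
    define a where "a i = - C (bs ! i) (bs ! p i)" for i
    have aI: "a i \<in> I" for i unfolding a_def by (rule I, rule C)
    obtain w where w: "w \<in> lower_terms I f n" "(\<Prod>i<n. c i * f + a i) = (\<Prod>i<n. c i) * f ^ n + w"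
      by (rule bexE[OF prod_lower_terms[where n=n and a=a and I=I and c=c and f=f, OF aI]])
    have "(\<Prod>i=0..<n. M $$ (i, p i)) = (\<Prod>i<n. c i * f + a i)"
    proof (rule prod.cong)
      fix i assume "i \<in> {..<n}"
      then have i: "i < n" "p i < n" using permutes_in_image[OF p, of i] by auto
      have "M $$ (i, j) = (if i = j then 1 else 0) * f + - C (bs ! i) (bs ! j)" if "j < n" for j
        using i(1) that by (simp add: M_def)
      from this[OF i(2)] show "M $$ (i, p i) = c i * f + a i" unfolding c_def a_def .
    qed auto
    \<comment> \<open>A permutation other than the identity meets an off-diagonal entry, so only the
      identity contributes the leading power of \<open>f\<close>.\<close>
    moreover have "(\<Prod>i<n. c i) = (if p = id then 1 else 0)"
    proof (cases "p = id")
      case False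
      then obtain i where i: "p i \<noteq> i" by (auto simp: fun_eq_iff)
      then have "i < n" using permutes_not_in[OF p] by fastforce
      moreover have "c i = 0" using i by (simp add: c_def)
      ultimately show ?thesis using False by (auto simp: prod_zero_iff)
    qed (simp add: c_def)
    ultimately show ?thesis using w by (intro bexI[of _ w]) auto
  qed
  then obtain w where w: "\<And>p. p permutes {0..<n} \<Longrightarrow> w p \<in> lower_terms I f n"
    "\<And>p. p permutes {0..<n} \<Longrightarrow> (\<Prod>i=0..<n. M $$ (i, p i)) = (if p = id then f ^ n else 0) + w p"
    by metis
  have expand: "(\<Sum>p\<in>{p. p permutes {0..<n}}. signof p * (\<Prod>i=0..<n. M $$ (i, p i))) =
      (\<Sum>p\<in>{p. p permutes {0..<n}}. signof p * ((if p = id then f ^ n else 0) + w p))"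
    by (rule sum.cong) (simp_all add: w(2))
  have "0 = (\<Sum>p\<in>{p. p permutes {0..<n}}. signof p * ((if p = id then f ^ n else 0) + w p))"
    using 0 unfolding expand by (rule sym)
  also have "\<dots> = (\<Sum>p\<in>{p. p permutes {0..<n}}. if p = id then f ^ n else 0) +
      (\<Sum>p\<in>{p. p permutes {0..<n}}. signof p * w p)"
    unfolding sum.distrib[symmetric] by (rule sum.cong) (auto simp: distrib_left)
  also have "(\<Sum>p\<in>{p. p permutes {0..<n}}. if p = id then f ^ n else 0) = f ^ n"
    using permutes_id[of "{0..<n}"] by (simp add: finite_permutations)
  finally have eq: "f ^ n + (\<Sum>p\<in>{p. p permutes {0..<n}}. signof p * w p) = 0" by simp
  have "(\<Sum>p\<in>{p. p permutes {0..<n}}. signof p * w p) \<in> lower_terms I f n"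
    using w(1) by (intro lower_terms_sum lower_terms_scale) auto
  then obtain a where a: "(\<Sum>p\<in>{p. p permutes {0..<n}}. signof p * w p) = (\<Sum>i=1..n. a i * f ^ (n - i))"
    "\<forall>i\<in>{1..n}. a i \<in> ideal_power I i"
    unfolding lower_terms_def by (elim CollectE exE conjE)
  show ?thesis unfolding integral_closure_def
    by (intro CollectI exI[of _ n] exI[of _ a] conjI n a(2) eq[unfolded a(1)])
qed

section \<open>Monomials of integral elements lie in the Newton polyhedron\<close>

definition weight_part :: "(expo \<Rightarrow> real) \<Rightarrow> real \<Rightarrow> 'k::field pol \<Rightarrow> 'k pol" where
  "weight_part L x p = Poly_Mapping.mapp (\<lambda>m c. if L m = x then c else 0) p"

lemma lookup_weight_part:
  "lookup (weight_part L x p) m = (if L m = x then lookup p m else 0)"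
  by (auto simp: weight_part_def lookup_mapp when_def in_keys_iff)

lemma weight_part_add: "weight_part L x (p + q) = weight_part L x p + weight_part L x q"
  by (rule poly_mapping_eqI) (simp add: lookup_weight_part lookup_add)

lemma weight_part_sum: "weight_part L x (\<Sum>i\<in>S. p i) = (\<Sum>i\<in>S. weight_part L x (p i))"
proof (induction S rule: infinite_finite_induct)
  case (insert x F) then show ?case by (simp add: weight_part_add)
qed (auto intro: poly_mapping_eqI simp: lookup_weight_part)

lemma weight_part_eq_0: "(\<And>m. m \<in> keys p \<Longrightarrow> L m \<noteq> x) \<Longrightarrow> weight_part L x p = 0"
  by (rule poly_mapping_eqI) (auto simp: lookup_weight_part in_keys_iff)

lemma keys_mult_weight:
  fixes p q :: "'k::field pol"
  assumes add: "\<And>m n. L (m + n) = L m + (L n :: real)"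
    and "\<forall>m\<in>keys p. x \<le> L m" "\<forall>m\<in>keys q. y \<le> L m"
  shows "\<forall>m\<in>keys (p * q). x + y \<le> L m"
proof
  fix m assume "m \<in> keys (p * q)"
  then obtain a b where "m = a + b" "a \<in> keys p" "b \<in> keys q"
    using keys_mult by blast
  then show "x + y \<le> L m" using assms by (simp add: add_mono)
qed

text \<open>At the lower bounds for the weights only initial forms can contribute; every other
  product of terms has strictly larger weight.\<close>

lemma weight_part_mult:
  fixes p q :: "'k::field pol"
  assumes add: "\<And>m n. L (m + n) = L m + (L n :: real)"
    and p: "\<forall>m\<in>keys p. x \<le> L m" and q: "\<forall>m\<in>keys q. y \<le> L m"
  shows "weight_part L (x + y) (p * q) = weight_part L x p * weight_part L y q"
proof -
  let ?p = "weight_part L x p" and ?q = "weight_part L y q"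
  have pp: "L m = x" if "m \<in> keys ?p" for m
    using that by (auto simp: in_keys_iff lookup_weight_part split: if_splits)
  have qq: "L m = y" if "m \<in> keys ?q" for m
    using that by (auto simp: in_keys_iff lookup_weight_part split: if_splits)
  have p': "L m > x" if "m \<in> keys (p - ?p)" for m
    using that p by (force simp: in_keys_iff lookup_weight_part lookup_minus split: if_splits)
  have q': "L m > y" if "m \<in> keys (q - ?q)" for m
    using that q by (force simp: in_keys_iff lookup_weight_part lookup_minus split: if_splits)
  have "weight_part L (x + y) (?p * ?q) = ?p * ?q"
  proof (rule poly_mapping_eqI)
    fix m
    show "lookup (weight_part L (x + y) (?p * ?q)) m = lookup (?p * ?q) m"
    proof (cases "m \<in> keys (?p * ?q)")
      case True
      then obtain a b where "m = a + b" "a \<in> keys ?p" "b \<in> keys ?q"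
        using keys_mult by blast
      then show ?thesis using pp qq by (simp add: lookup_weight_part add)
    qed (simp add: lookup_weight_part in_keys_iff)
  qed
  moreover have "weight_part L (x + y) (?p * (q - ?q)) = 0"
  proof (rule weight_part_eq_0)
    fix m assume "m \<in> keys (?p * (q - ?q))"
    then obtain a b where "m = a + b" "a \<in> keys ?p" "b \<in> keys (q - ?q)"
      using keys_mult by blast
    then show "L m \<noteq> x + y" using pp[of a] q'[of b] by (simp add: add)
  qed
  moreover have "weight_part L (x + y) ((p - ?p) * q) = 0"
  proof (rule weight_part_eq_0)
    fix m assume "m \<in> keys ((p - ?p) * q)"
    then obtain a b where "m = a + b" "a \<in> keys (p - ?p)" "b \<in> keys q"
      using keys_mult by blast
    then show "L m \<noteq> x + y" using p'[of a] q by (force simp: add)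
  qed
  moreover have "p * q = ?p * ?q + (?p * (q - ?q) + (p - ?p) * q)"
    by (simp add: algebra_simps)
  ultimately show ?thesis by (metis weight_part_add add.right_neutral)
qed

lemma weight_part_power:
  fixes p :: "'k::field pol"
  assumes add: "\<And>m n. L (m + n) = L m + (L n :: real)" and p: "\<forall>m\<in>keys p. x \<le> L m"
  shows "(\<forall>m\<in>keys (p ^ n). n * x \<le> L m) \<and> weight_part L (n * x) (p ^ n) = weight_part L x p ^ n"
proof (induction n)
  case 0
  have "L 0 = 0" using add[of 0 0] by simp
  then show ?case by (auto intro!: poly_mapping_eqI simp: lookup_weight_part lookup_one when_def)
next
  case (Suc n)
  have eq: "real (Suc n) * x = x + real n * x" by (simp add: algebra_simps)
  show ?case
    unfolding eq power_Suc
    using keys_mult_weight[OF add p conjunct1[OF Suc]] weight_part_mult[OF add p conjunct1[OF Suc]] Suc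
    by simp
qed

context newton
begin

definition E :: "expo set" where "E = {a + u | a u. a \<in> A}"

lemma A_subset_E: "a \<in> A \<Longrightarrow> a \<in> E"
  unfolding E_def by (metis (mono_tags, lifting) add.right_neutral mem_Collect_eq)

lemma upclosed_E: "upclosed E"
  unfolding upclosed_def E_def by (auto simp: add.assoc) blast

text \<open>\<open>P\<close> plus the orthant is closed and convex, so a hyperplane separates it
  from \<open>w\<close>. The functional is nonnegative because the set is unbounded in all
  coordinate directions.\<close>

lemma separating_weight:
  assumes "w \<notin> NP"
  obtains L and \<beta> :: real where "\<And>m n. L (m + n) = L m + L n" "\<And>m. L m \<ge> 0" "L w < \<beta>" "\<And>m. m \<in> E \<Longrightarrow> L m > \<beta>"
proof -
  define Q :: "(real ^ 3) set" where "Q = {y. \<forall>i. 0 \<le> y $ i}"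
  define S where "S = (\<Union>x\<in>P. \<Union>y\<in>Q. {x + y})"
  have Q: "convex Q" "closed Q"
    unfolding Q_def by (auto simp: convex_def) (intro closed_Collect_all closed_Collect_le continuous_intros)
  have "compact P" unfolding P_def by (simp add: finite_A finite_imp_compact_convex_hull)
  then have "closed S" unfolding S_def using Q(2) by (rule compact_closed_sums)
  moreover have "convex S" unfolding S_def using convex_P Q(1) by (rule convex_sums)
  moreover have "real_vec w \<notin> S"
  proof
    assume "real_vec w \<in> S"
    then obtain x y where "x \<in> P" "y \<in> Q" "real_vec w = x + y" by (auto simp: S_def)
    then have "coord w i = x $ i + y $ i" for i by (metis real_vec_nth vector_add_component)
    then have "x $ i \<le> coord w i" for i using \<open>y \<in> Q\<close> by (simp add: Q_def)
    then show False using assms NP_I[OF \<open>x \<in> P\<close>] by blast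
  qed
  ultimately obtain l \<beta> where l: "inner l (real_vec w) < \<beta>" "\<forall>x\<in>S. inner l x > \<beta>"
    using separating_hyperplane_closed_point by blast
  define L where "L m = inner l (real_vec m)" for m
  obtain a0 where a0: "a0 \<in> A" using A_nonempty by blast
  have l0: "l $ i \<ge> 0" for i
  proof (rule ccontr)
    assume neg: "\<not> l $ i \<ge> 0"
    \<comment> \<open>If l_i were negative, moving this far along axis i would bring the functional
      down to at most \<open>\<beta>\<close> inside the set.\<close>
    define t where "t = \<bar>inner l (real_vec a0) - \<beta>\<bar> / (- (l $ i))"
    have "t \<ge> 0" unfolding t_def using neg by (intro divide_nonneg_nonneg) auto
    then have "t *\<^sub>R axis i 1 \<in> Q" by (auto simp: Q_def axis_def)
    then have "real_vec a0 + t *\<^sub>R axis i 1 \<in> S" using real_vec_in_P[OF a0] by (auto simp: S_def)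
    then have "\<beta> < inner l (real_vec a0) + t * (l $ i)"
      using l(2) by (auto simp: inner_add_right inner_axis)
    also have "t * (l $ i) = - \<bar>inner l (real_vec a0) - \<beta>\<bar>" using neg by (simp add: t_def)
    finally show False by linarith
  qed
  show thesis
  proof
    show add: "L (m + n) = L m + L n" for m n
    proof -
      have "real_vec (m + n) = real_vec m + real_vec n" by (simp add: vec_eq_iff lookup_add)
      then show ?thesis by (simp add: L_def inner_add_right)
    qed
    show nonneg: "L m \<ge> 0" for m
      unfolding L_def inner_vec_def using l0 by (intro sum_nonneg) simp
    show "L w < \<beta>" using l(1) by (simp add: L_def)
    show "L m > \<beta>" if m: "m \<in> E" for m
    proof -
      obtain a u where au: "m = a + u" "a \<in> A" using m by (auto simp: E_def)
      have "0 \<in> Q" by (simp add: Q_def)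
      then have "real_vec a + 0 \<in> S" unfolding S_def using real_vec_in_P[OF au(2)] by blast
      then have "L a > \<beta>" using l(2) by (simp add: L_def)
      then show ?thesis using add[of a u] nonneg[of u] unfolding au(1) by linarith
    qed
  qed
qed

text \<open>A valuation argument: the least weight x in \<open>f\<close> is below
  \<open>\<beta>\<close>, while elements of the i-th power of the ideal have weight at least i
  \<open>\<beta>\<close>. In an integral equation all lower terms then have weight above n x, so the
  n-th power of the initial form of \<open>f\<close> would vanish.\<close>

lemma integral_imp_NP:
  fixes f :: "'k::field pol"
  assumes f: "f \<in> integral_closure (monomial_span E)"
  shows "f \<in> monomial_span NP"
proof (rule monomial_spanI, rule ccontr)
  fix w assume w: "lookup f w \<noteq> 0" "w \<notin> NP"
  obtain L \<beta> where L: "\<And>m n. L (m + n) = L m + L n" "\<And>m. L m \<ge> 0" "L w < \<beta>" "\<And>m. m \<in> E \<Longrightarrow> L m > (\<beta> :: real)"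
    using separating_weight[OF w(2)] by metis
  obtain n a where n: "n > 0" and a: "\<And>i. i \<in> {1..n} \<Longrightarrow> a i \<in> ideal_power (monomial_span E) i"
    and eq: "f ^ n + (\<Sum>i=1..n. a i * f ^ (n - i)) = 0"
    using f unfolding integral_closure_def by blast
  have wf: "w \<in> keys f" using w by (simp add: in_keys_iff)
  define x where "x = Min (L ` keys f)"
  have x: "\<forall>m\<in>keys f. x \<le> L m" by (simp add: x_def)
  have "x \<le> L w" using x wf by blast
  then have xb: "x < \<beta>" using L(3) by simp
  have "x \<in> L ` keys f" unfolding x_def using wf by (intro Min_in) auto
  then obtain m where m: "m \<in> keys f" "L m = x" by auto
  then have "lookup (weight_part L x f) m \<noteq> 0" by (simp add: lookup_weight_part in_keys_iff)
  then have nz: "weight_part L x f \<noteq> 0" by auto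
  have ip: "\<forall>m\<in>keys p. i * \<beta> \<le> L m" if "p \<in> ideal_power (monomial_span E) i" for p :: "'k pol" and i :: nat
  proof -
    let ?S = "{p :: 'k pol. \<forall>m\<in>keys p. i * \<beta> \<le> L m}"
    have "rm.subspace ?S"
    proof (rule rm.subspaceI)
      show "p + q \<in> ?S" if "p \<in> ?S" "q \<in> ?S" for p q
        using that Poly_Mapping.keys_add[of p q] by auto
      show "c * p \<in> ?S" if "p \<in> ?S" for c p
        using keys_mult_weight[OF L(1), of c 0 p "i * \<beta>"] that L(2) by simp
    qed simp
    moreover have "(\<Prod>k<j. g k) \<in> {p. \<forall>m\<in>keys p. j * \<beta> \<le> L m}" 
      if "\<forall>k<j. g k \<in> monomial_span E" for g :: "nat \<Rightarrow> 'k pol" and j :: nat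
      using that
    proof (induction j)
      case 0 then show ?case using L(2) by simp
    next
      case (Suc j)
      have "\<forall>m\<in>keys (g j). \<beta> \<le> L m"
        using Suc.prems L(4) by (auto simp: monomial_span_def intro!: less_imp_le)
      with Suc have "\<forall>m\<in>keys ((\<Prod>k<j. g k) * g j). j * \<beta> + \<beta> \<le> L m"
        by (intro keys_mult_weight[OF L(1)]) auto
      then show ?case by (simp add: algebra_simps)
    qed
    ultimately have "ideal_power (monomial_span E) i \<subseteq> ?S"
      unfolding ideal_power_def by (intro rm.span_minimal) auto
    then show ?thesis using that by blast
  qed
  have "weight_part L (n * x) (a i * f ^ (n - i)) = 0" if i: "i \<in> {1..n}" for i
  proof (rule weight_part_eq_0)
    fix m assume "m \<in> keys (a i * f ^ (n - i))"
    then have "i * \<beta> + real (n - i) * x \<le> L m"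
      using keys_mult_weight[OF L(1) ip[OF a[OF i]] conjunct1[OF weight_part_power[OF L(1) x, of "n - i"]]] by blast
    moreover have "real n * x < i * \<beta> + real (n - i) * x"
      using i xb by (simp add: of_nat_diff algebra_simps)
    ultimately show "L m \<noteq> n * x" by simp
  qed
  then have "weight_part L (n * x) (\<Sum>i=1..n. a i * f ^ (n - i)) = 0"
    unfolding weight_part_sum by (intro sum.neutral) blast
  moreover have "weight_part L (n * x) (f ^ n) = weight_part L x f ^ n"
    using weight_part_power[OF L(1) x, of n] by blast
  moreover have "weight_part L (n * x) (f ^ n + (\<Sum>i=1..n. a i * f ^ (n - i))) = 0"
    unfolding eq by (rule weight_part_eq_0) simp
  ultimately have "weight_part L x f ^ n = 0"
    unfolding weight_part_add by simp
  then show False using nz by simp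
qed

section \<open>Polynomials supported in the Newton polyhedron are integral\<close>

definition dilate :: "nat \<Rightarrow> expo set" where
  "dilate N = {w. \<exists>\<mu>. (\<forall>a\<in>A. \<mu> a \<ge> 0) \<and> (\<Sum>a\<in>A. \<mu> a) = real N \<and> (\<forall>i. (\<Sum>a\<in>A. \<mu> a * coord a i) \<le> coord w i)}"

lemma NP_imp_dilate: "NP \<subseteq> dilate 1"
proof
  fix w assume "w \<in> NP"
  then obtain p where p: "p \<in> P" "\<And>i. p $ i \<le> coord w i" by (auto simp: NP_def)
  have inj: "inj_on real_vec A"
    by (rule inj_onI) (auto intro!: poly_mapping_eqI simp: vec_eq_iff)
  obtain u where u: "\<forall>x\<in>real_vec ` A. 0 \<le> u x" "sum u (real_vec ` A) = 1" "(\<Sum>x\<in>real_vec ` A. u x *\<^sub>R x) = p"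
    using p(1) finite_A unfolding P_def by (auto simp: convex_hull_finite)
  have "(\<Sum>a\<in>A. u (real_vec a) * coord a i) = p $ i" for i
    using u(3) unfolding sum.reindex[OF inj] by auto
  then show "w \<in> dilate 1"
    using u p(2) unfolding dilate_def sum.reindex[OF inj] by (intro CollectI exI[of _ "\<lambda>a. u (real_vec a)"]) auto
qed

lemma dilate_add:
  assumes "m \<in> dilate M" "n \<in> dilate N" shows "m + n \<in> dilate (M + N)"
proof -
  obtain \<mu> \<nu> where "\<forall>a\<in>A. \<mu> a \<ge> 0" "(\<Sum>a\<in>A. \<mu> a) = real M" "\<forall>i. (\<Sum>a\<in>A. \<mu> a * coord a i) \<le> coord m i"
    "\<forall>a\<in>A. \<nu> a \<ge> 0" "(\<Sum>a\<in>A. \<nu> a) = real N" "\<forall>i. (\<Sum>a\<in>A. \<nu> a * coord a i) \<le> coord n i"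
    using assms unfolding dilate_def by auto
  then show ?thesis unfolding dilate_def
    by (intro CollectI exI[of _ "\<lambda>a. \<mu> a + \<nu> a"])
      (auto simp: sum.distrib distrib_right lookup_add intro: add_mono)
qed

text \<open>A finite truncation that still has an element below every element of the dilate:
  coordinates of points of \<open>A\<close> are at most d, hence those of the N-fold combinations at
  most N d.\<close>

definition dilate_box :: "nat \<Rightarrow> expo set" where
  "dilate_box N = {w \<in> dilate N. \<forall>i. lookup w i \<le> N * nat d}"

lemma finite_dilate_box: "finite (dilate_box N)"
proof (rule finite_imageD)
  have "lookup ` dilate_box N \<subseteq> {f. \<forall>x. (x \<in> UNIV \<longrightarrow> f x \<in> {..N * nat d}) \<and> (x \<notin> UNIV \<longrightarrow> f x = 0)}"
    by (auto simp: dilate_box_def)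
  then show "finite (lookup ` dilate_box N)"
    by (rule finite_subset) (rule finite_set_of_finite_funs; simp)
  show "inj_on lookup (dilate_box N)" by (simp add: inj_on_def)
qed

lemma coord_le_d: "a \<in> A \<Longrightarrow> coord a i \<le> real (nat d)"
proof -
  assume a: "a \<in> A"
  have "int (lookup a i) \<le> deg a"
    unfolding deg_def by (rule member_le_sum) auto
  then show ?thesis using deg_A[OF a] by simp
qed

text \<open>Rounding the combination up to integers respects every integral upper bound, both
  \<open>g\<close> and the size of the box.\<close>

lemma dilate_ge_dilate_box:
  assumes \<mu>: "\<forall>a\<in>A. \<mu> a \<ge> 0" "(\<Sum>a\<in>A. \<mu> a) = real N" "\<And>i. (\<Sum>a\<in>A. \<mu> a * coord a i) \<le> real (g i)"
  obtains w where "w \<in> dilate_box N" "\<And>i. lookup w i \<le> g i"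
proof
  let ?h = "\<lambda>i. nat \<lceil>\<Sum>a\<in>A. \<mu> a * coord a i\<rceil>"
  define w :: expo where "w = Abs_poly_mapping ?h"
  have w: "lookup w i = ?h i" for i
    unfolding w_def by (subst Abs_poly_mapping_inverse) auto
  show "lookup w i \<le> g i" for i
    using \<mu>(3)[of i] unfolding w by (simp add: ceiling_le_iff nat_le_iff)
  have "(\<Sum>a\<in>A. \<mu> a * coord a i) \<le> (\<Sum>a\<in>A. \<mu> a * real (nat d))" for i
    using \<mu>(1) coord_le_d by (intro sum_mono mult_left_mono) auto
  then have "(\<Sum>a\<in>A. \<mu> a * coord a i) \<le> real (N * nat d)" for i
    unfolding sum_distrib_right[symmetric] \<mu>(2) by simp
  then have "?h i \<le> N * nat d" for i
    by (simp add: ceiling_le_iff nat_le_iff del: of_nat_mult)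
  moreover have "(\<Sum>a\<in>A. \<mu> a * coord a i) \<le> coord w i" for i
    unfolding w by (rule real_nat_ceiling_ge)
  then have "w \<in> dilate N" using \<mu>(1,2) unfolding dilate_def by (intro CollectI exI[of _ \<mu>]) auto
  ultimately show "w \<in> dilate_box N" by (simp add: dilate_box_def w)
qed

text \<open>In a nonnegative combination with total weight at least the number of points some point has weight at
  least 1 and can be split off.\<close>

lemma split_dilate_box:
  assumes m: "m \<in> NP" and w: "w \<in> dilate_box (card A)"
  shows "\<exists>x w'. m + w = x + w' \<and> x \<in> E \<and> w' \<in> dilate_box (card A)"
proof -
  have "m + w \<in> dilate (1 + card A)"
    using m w NP_imp_dilate by (intro dilate_add) (auto simp: dilate_box_def)
  then obtain \<mu> where \<mu>: "\<forall>a\<in>A. \<mu> a \<ge> 0" "(\<Sum>a\<in>A. \<mu> a) = real (1 + card A)"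
    "\<And>i. (\<Sum>a\<in>A. \<mu> a * coord a i) \<le> coord (m + w) i" unfolding dilate_def by auto
  have "\<exists>a\<in>A. \<mu> a \<ge> 1"
  proof (rule ccontr)
    assume "\<not> ?thesis"
    then have "(\<Sum>a\<in>A. \<mu> a) \<le> (\<Sum>a\<in>A. 1)" by (intro sum_mono) auto
    then show False using \<mu>(2) by simp
  qed
  then obtain a where a: "a \<in> A" "\<mu> a \<ge> 1" by blast
  define \<nu> where "\<nu> b = \<mu> b - (if b = a then 1 else 0)" for b
  have s: "(\<Sum>b\<in>A. \<nu> b * h b) = (\<Sum>b\<in>A. \<mu> b * h b) - h a" for h
  proof -
    have "(\<Sum>b\<in>A. \<nu> b * h b) = (\<Sum>b\<in>A. \<mu> b * h b - (if b = a then h a else 0))"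
      by (rule sum.cong) (auto simp: \<nu>_def algebra_simps)
    then show ?thesis using a finite_A by (simp add: sum_subtractf)
  qed
  have \<nu>0: "\<forall>b\<in>A. \<nu> b \<ge> 0" using \<mu>(1) a by (auto simp: \<nu>_def)
  have \<nu>1: "(\<Sum>b\<in>A. \<nu> b) = real (card A)" using s[of "\<lambda>_. 1"] \<mu>(2) by simp
  have le: "coord a i + (\<Sum>b\<in>A. \<nu> b * coord b i) \<le> coord (m + w) i" for i
    using s[of "\<lambda>b. coord b i"] \<mu>(3)[of i] by simp
  have \<nu>i: "(\<Sum>b\<in>A. \<nu> b * coord b i) \<ge> 0" for i using \<nu>0 by (intro sum_nonneg) auto
  let ?g = "\<lambda>i. lookup (m + w) i - lookup a i"
  have ge: "lookup a i \<le> lookup (m + w) i" for i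
    using le[of i] \<nu>i[of i] by linarith
  have g: "(\<Sum>b\<in>A. \<nu> b * coord b i) \<le> real (?g i)" for i
    using le[of i] ge[of i] by (simp add: of_nat_diff)
  \<comment> \<open>Returning to the box may lose part of the exponent; the loss is absorbed by the
    factor in \<open>E\<close>.\<close>
  obtain w' where w': "w' \<in> dilate_box (card A)" "\<And>i. lookup w' i \<le> ?g i"
    using dilate_ge_dilate_box[OF \<nu>0 \<nu>1 g] by metis
  define u where "u = m + w - a - w'"
  have "m + w = (a + u) + w'"
  proof (rule poly_mapping_eqI)
    fix i
    show "lookup (m + w) i = lookup ((a + u) + w') i"
      using ge[of i] w'(2)[of i] unfolding u_def lookup_add lookup_minus by linarith
  qed
  moreover have "a + u \<in> E" using a by (auto simp: E_def)
  ultimately show ?thesis using w' by blast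
qed

lemma dilate_box_nonempty: "dilate_box N \<noteq> {}"
proof -
  obtain a where a: "a \<in> A" using A_nonempty by blast
  have s: "(\<Sum>b\<in>A. (if b = a then real N else 0) * h b) = N * h a" for h :: "expo \<Rightarrow> real"
  proof -
    have "(\<Sum>b\<in>A. (if b = a then real N else 0) * h b) = (\<Sum>b\<in>A. (if b = a then N * h a else 0))"
      by (rule sum.cong) auto
    then show ?thesis using a finite_A by simp
  qed
  obtain w where "w \<in> dilate_box N"
    by (rule dilate_ge_dilate_box[of "\<lambda>b. if b = a then real N else 0" N "\<lambda>i. N * lookup a i"])
      (use s[of "\<lambda>_. 1"] s in auto)
  then show ?thesis by blast
qed

text \<open>The module generated by the monomials of the box is mapped by \<open>f\<close> into the
  ideal times itself, so the determinant criterion applies.\<close>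

lemma NP_imp_integral:
  fixes f :: "'k::field pol"
  assumes f: "f \<in> monomial_span NP"
  shows "f \<in> integral_closure (monomial_span E)"
proof -
  let ?W = "dilate_box (card A)"
  let ?mon = "\<lambda>w. single w (1 :: 'k)"
  define I where "I = (monomial_span E :: 'k pol set)"
  have "\<exists>x w'. m + w = x + w' \<and> x \<in> E \<and> w' \<in> ?W" if "m \<in> keys f" "w \<in> ?W" for m w
    using f that by (intro split_dilate_box) (auto simp: monomial_span_def)
  then obtain x w' where xw: "\<And>m w. m \<in> keys f \<Longrightarrow> w \<in> ?W \<Longrightarrow>
      m + w = x m w + w' m w \<and> x m w \<in> E \<and> w' m w \<in> ?W" by metis
  \<comment> \<open>Each term of \<open>f\<close> times the monomial of \<open>w\<close> is split
    into an ideal monomial and a box monomial; collecting by the box monomial gives a row of the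
    matrix.\<close>
  define C where "C w v = (if w \<in> ?W then \<Sum>m\<in>{m \<in> keys f. w' m w = v}.
      single (x m w) (lookup f m) else 0)" for w v
  have CI: "C w v \<in> I" for w v
    unfolding C_def I_def using xw by (auto intro!: monomial_span_sum monomial_span_single)
  have eq: "f * ?mon w = (\<Sum>v\<in>?W. C w v * ?mon v)" if w: "w \<in> ?W" for w
  proof -
    have "(\<Sum>v\<in>?W. C w v * ?mon v) = (\<Sum>v\<in>?W. \<Sum>m\<in>{m \<in> keys f. w' m w = v}.
        single (m + w) (lookup f m))"
      using w by (auto simp: C_def sum_distrib_right mult_single xw intro!: sum.cong)
    also have "\<dots> = (\<Sum>m\<in>keys f. single (m + w) (lookup f m))"
      using xw w finite_dilate_box by (intro sum.group) auto
    also have "\<dots> = (\<Sum>m\<in>keys f. single m (lookup f m)) * ?mon w"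
      by (simp add: sum_distrib_right mult_single)
    also have "\<dots> = f * ?mon w" using sum_monomials[of f] by simp
    finally show ?thesis ..
  qed
  have inj: "inj_on ?mon ?W"
    by (rule inj_onI) (metis keys_single singleton_inject zero_neq_one)
  have "f \<in> integral_closure I"
  proof (rule integral_if_stable)
    show "- p \<in> I" if "p \<in> I" for p using that by (auto simp: I_def monomial_span_def)
    show "finite (?mon ` ?W)" "?mon ` ?W \<noteq> {}" using finite_dilate_box dilate_box_nonempty by auto
    have "?mon w \<noteq> 0" for w by (metis lookup_single_eq lookup_zero zero_neq_one)
    then show "0 \<notin> ?mon ` ?W" by (metis imageE)
    show "C (the_inv_into ?W ?mon u) (the_inv_into ?W ?mon v) \<in> I" for u v by (rule CI)
    show "f * u = (\<Sum>v\<in>?mon ` ?W. C (the_inv_into ?W ?mon u) (the_inv_into ?W ?mon v) * v)"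
      if "u \<in> ?mon ` ?W" for u
      using that eq by (auto simp: sum.reindex[OF inj] the_inv_into_f_f[OF inj] intro!: sum.cong)
  qed
  then show ?thesis by (simp add: I_def)
qed

lemma integral_closure_monomial_span: "integral_closure (monomial_span E :: 'k::field pol set) = monomial_span NP"
  using integral_imp_NP NP_imp_integral by blast

end

section \<open>Regularity\<close>

lemma exponent_le_iff:
  "(\<exists>u. m = a + u) \<longleftrightarrow> (\<forall>i. lookup a i \<le> lookup (m :: expo) i)"
proof
  assume "\<forall>i. lookup a i \<le> lookup m i"
  then have "m = a + (m - a)"
    by (intro poly_mapping_eqI) (simp add: lookup_add lookup_minus)
  then show "\<exists>u. m = a + u" by blast
qed (auto simp: lookup_add)

lemma minimal_exponent:
  fixes w :: expo
  assumes "w \<in> E"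
  shows "\<exists>a u. a \<in> E \<and> w = a + u \<and> (\<forall>v\<in>E. \<forall>u. a = v + u \<longrightarrow> v = a)"
  using assms
proof (induction "nat (deg w)" arbitrary: w rule: less_induct)
  case less
  show ?case
  proof (cases "\<forall>v\<in>E. \<forall>u. w = v + u \<longrightarrow> v = w")
    case True
    then show ?thesis using less.prems by (intro exI[of _ w] exI[of _ 0]) auto
  next
    case False
    then obtain v u where v: "v \<in> E" "w = v + u" "v \<noteq> w" by blast
    then have "u \<noteq> 0" by auto
    then have "deg u \<noteq> 0" by simp
    then have "deg u > 0" using deg_nonneg[of u] by linarith
    then have "nat (deg v) < nat (deg w)" using v deg_nonneg[of v] by simp
    from less.hyps[OF this v(1)] obtain a u' where
      "a \<in> E" "v = a + u'" "\<forall>v\<in>E. \<forall>u. a = v + u \<longrightarrow> v = a" by blast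
    then show ?thesis using v(2) by (intro exI[of _ a] exI[of _ "u' + u"]) (auto simp: add.assoc)
  qed
qed

text \<open>Finiteness and nonemptiness accompany the bound because \<open>Max\<close> carries
  information only for finite nonempty sets.\<close>

lemma regularity_le:
  assumes up: "upclosed E" and ne: "E \<noteq> {}"
    and res: "minimal_resolution [0] (embed ` monomial_span E :: 'k::field fvec set) bb ZZ"
    and 0: "\<And>w. w \<in> E \<Longrightarrow> deg w > N \<Longrightarrow> \<exists>i u. w = u + uexp i \<and> u \<in> E"
    and 1: "\<And>j. j > N + 1 \<Longrightarrow> connected_at E j"
    and 2: "\<And>c. (\<And>i. c + uexp i \<in> E) \<Longrightarrow> deg c \<ge> N \<Longrightarrow> c \<in> E"
  shows "finite {j - int i | i j. j \<in> set (bb (Suc i))} \<and> {j - int i | i j. j \<in> set (bb (Suc i))} \<noteq> {} \<and>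
    Max {j - int i | i j. j \<in> set (bb (Suc i))} \<le> N"
proof -
  let ?S = "{j - int i | i j. j \<in> set (bb (Suc i))}"
  have bound: "i \<le> 2 \<and> j \<le> N + int i" if "j \<in> set (bb (Suc i))" for i j
  proof (rule minimal_resolution_bound[OF res _ _ _ that])
    show "H0_vanishes [0] (embed ` monomial_span E :: 'k fvec set) j" if "j > N" for j
      unfolding H0_monomial_iff[OF up] using 0 that by blast
    show "H1_vanishes [0] (embed ` monomial_span E :: 'k fvec set) j" if "j > N + 1" for j
      by (rule connected_imp_H1_monomial[OF up 1[OF that]])
    show "H2_vanishes [0] (embed ` monomial_span E :: 'k fvec set) j" if j: "j > N + 2" for j
      by (rule H2_monomial[OF up 2]) (use j in auto)
  qed
  have "?S \<subseteq> (\<Union>i\<in>{..2}. (\<lambda>j. j - int i) ` set (bb (Suc i)))"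
    using bound by blast
  then have fin: "finite ?S" by (rule finite_subset) auto
  have ne: "?S \<noteq> {}"
  proof
    assume "?S = {}"
    then have "j \<notin> set (bb (Suc 0))" for j by blast
    moreover obtain E0 where "syzygy_step (bb 0) (ZZ 0) (bb (Suc 0)) E0 (ZZ (Suc 0))"
      using res unfolding minimal_resolution_def by blast
    moreover have "bb 0 = [0]" "ZZ 0 = embed ` monomial_span E"
      using res by (auto simp: minimal_resolution_def)
    ultimately have H0: "H0_vanishes [0] (embed ` monomial_span E :: 'k fvec set) j" for j
      using step_no_generator[of "bb 0" "ZZ 0" "bb (Suc 0)" E0 "ZZ (Suc 0)" j] by metis
    \<comment> \<open>A minimal exponent is a generator, so some degree must occur in the first free
      module.\<close>
    obtain w where "w \<in> E" using ne by blast
    then obtain a u where a: "a \<in> E" "\<forall>v\<in>E. \<forall>u. a = v + u \<longrightarrow> v = a"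
      using minimal_exponent by metis
    then obtain i u where u: "a = u + uexp i" "u \<in> E"
      using H0[of "deg a"] unfolding H0_monomial_iff[OF up] by blast
    then have "u = a" using a(2) by blast
    then show False using arg_cong[OF u(1), of deg] by simp
  qed
  have "x \<le> N" if x: "x \<in> ?S" for x
  proof -
    obtain i j where "x = j - int i" "j \<in> set (bb (Suc i))" using x by blast
    then show ?thesis using bound[of j i] by linarith
  qed
  then have "Max ?S \<le> N" using fin ne by (subst Max_le_iff) blast+
  then show ?thesis using fin ne by blast
qed

lemma monomial_span_minimal_resolution:
  assumes up: "upclosed E"
    and 0: "\<And>w. w \<in> E \<Longrightarrow> deg w > N \<Longrightarrow> \<exists>i u. w = u + uexp i \<and> u \<in> E"
    and 1: "\<And>j. j > N + 1 \<Longrightarrow> connected_at E j"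
    and 2: "\<And>c. (\<And>i. c + uexp i \<in> E) \<Longrightarrow> deg c \<ge> N \<Longrightarrow> c \<in> E"
  shows "\<exists>bb ZZ. minimal_resolution [0] (embed ` monomial_span E :: 'k::field fvec set) bb ZZ"
proof (rule exists_minimal_resolution[OF monomial_span_graded_submodule[OF up], of "N + 2"])
  fix j assume j: "j > N + 2"
  show "H0_vanishes [0] (embed ` monomial_span E :: 'k fvec set) j"
    unfolding H0_monomial_iff[OF up] using 0 j by force
  show "H1_vanishes [0] (embed ` monomial_span E :: 'k fvec set) j"
    using j by (intro connected_imp_H1_monomial[OF up 1]) auto
  show "H2_vanishes [0] (embed ` monomial_span E :: 'k fvec set) j"
    by (rule H2_monomial[OF up 2]) (use j in auto)
qed

section \<open>Syzygies of the ideal itself and the comparison of regularities\<close>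

context newton
begin

lemma E_iff: "w \<in> E \<longleftrightarrow> (\<exists>a\<in>A. \<forall>i. lookup a i \<le> lookup w i)"
  unfolding E_def using exponent_le_iff[of w] by blast

lemma d_nonneg: "d \<ge> 0"
  using A_nonempty deg_A deg_nonneg by force

lemma E_deg: "w \<in> E \<Longrightarrow> deg w \<ge> d"
  unfolding E_def using deg_A deg_nonneg by force

lemma E_reducible: 
  assumes "w \<in> E" "deg w > d" shows "\<exists>i u. w = u + uexp i \<and> u \<in> E"
proof -
  obtain a u where au: "a \<in> A" "w = a + u" using assms by (auto simp: E_def)
  then have "u \<noteq> 0" using assms deg_A by auto
  then obtain i where "lookup u i \<noteq> 0" by (metis poly_mapping_eqI lookup_zero)
  then obtain v where "u = v + uexp i" by (rule exponent_split)
  then show ?thesis using au by (intro exI[of _ i] exI[of _ "a + v"]) (auto simp: E_def add.assoc)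
qed

text \<open>Points of \<open>A\<close> have coordinates at most d, so raising a coordinate that is
  already at least d does not affect membership in \<open>E\<close>. This yields crude vanishing
  bounds near 3 d, enough for a resolution of the ideal to exist.\<close>

lemma E_drop:
  assumes "x + uexp l \<in> E" "lookup x l \<ge> nat d" shows "x \<in> E"
proof -
  obtain a where a: "a \<in> A" "\<And>i. lookup a i \<le> lookup (x + uexp l) i"
    using assms(1) E_iff by blast
  have "lookup a l \<le> nat d" using coord_le_d[OF a(1), of l] by simp
  then have "lookup a i \<le> lookup x i" for i
    using a(2)[of i] assms(2) by (cases "i = l") (auto simp: lookup_add lookup_uexp)
  then show ?thesis using a(1) E_iff by blast
qed

lemma large_coordinate:
  assumes "deg c > 3 * d" shows "\<exists>l. lookup c l > nat d"
proof (rule ccontr)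
  assume "\<not> ?thesis"
  then have "int (lookup c l) \<le> d" for l
    using d_nonneg by (metis int_nat_eq not_le of_nat_mono)
  then have "deg c \<le> (\<Sum>l\<in>(UNIV :: 3 set). d)" unfolding deg_def by (intro sum_mono)
  then show False using assms by simp
qed

lemma E_connected_large: "j > 3 * d + 2 \<Longrightarrow> connected_at E j"
  unfolding connected_at_def
proof (intro allI impI, elim conjE)
  fix k c
  assume c: "j > 3 * d + 2" "deg c + 2 = j" "c + uexp (k + 1) \<in> E" "c + uexp (k + 2) \<in> E"
  obtain l where l: "lookup c l > nat d" using large_coordinate c by force
  show "c \<in> E \<or> (\<exists>u. c = u + uexp k \<and> u + uexp (k + 1) \<in> E \<and> u + uexp (k + 2) \<in> E)"
  proof (cases rule: cyclic_cases[of l k])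
    case 1
    then have "lookup c k \<noteq> 0" using l by auto
    then obtain u where u: "c = u + uexp k" by (rule exponent_split)
    have "nat d \<le> lookup u k" using l 1 by (simp add: u lookup_add lookup_uexp)
    then have "u + uexp i \<in> E" if "c + uexp i \<in> E" "i \<noteq> k" for i
      using that by (intro E_drop[of "u + uexp i" k]) (auto simp: u ac_simps lookup_add lookup_uexp)
    then show ?thesis using u c by auto
  qed (use E_drop l c in auto)
qed

lemma E_socle_large: "(\<And>i. c + uexp i \<in> E) \<Longrightarrow> deg c \<ge> 3 * d + 1 \<Longrightarrow> c \<in> E"
  using large_coordinate[of c] E_drop[of c] by (metis less_imp_le zless_iff_Suc_zadd zle_add1_eq_le add.commute add_strict_increasing zero_less_one order_less_le_trans less_add_one)

text \<open>Induction on the degree of a common multiple \<open>M\<close>: connectedness below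
  \<open>M\<close> gives a chain of generators from \<open>a\<close> to \<open>b\<close> whose
  successive members have common multiples of smaller degree.\<close>

lemma connected_imp_paths:
  assumes conn: "\<And>j. j \<ge> d + 2 \<Longrightarrow> connected_at E j"
  shows "a \<in> A \<Longrightarrow> b \<in> A \<Longrightarrow> M = a + u \<Longrightarrow> M = b + v \<Longrightarrow> (a, b) \<in> steps\<^sup>*"
proof (induction "nat (deg M)" arbitrary: a b M u v rule: less_induct)
  case less
  have IH: "(x, y) \<in> steps\<^sup>*" if "x \<in> A" "y \<in> A" "m = x + p" "m = y + q" "deg m < deg M" for m x y p q
  proof -
    have "nat (deg m) < nat (deg M)" using that(5) deg_nonneg[of m] by linarith
    from less.hyps[OF this that(1-4)] show ?thesis .
  qed
  show ?case
  proof (cases "a = b")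
    case False
    have ne: "\<exists>i. lookup x i < lookup y i" if xy: "x \<in> A" "y \<in> A" "x \<noteq> y" for x y
    proof (rule ccontr)
      assume "\<not> ?thesis"
      then obtain z where "x = y + z" using exponent_le_iff[of x y] by (auto simp: not_less)
      then show False using xy deg_A[of x] deg_A[of y] by auto
    qed
    \<comment> \<open>With this choice M / x_i is still a multiple of \<open>a\<close>, and M / x_j
      of \<open>b\<close>.\<close>
    obtain i j where i: "lookup a i < lookup b i"
      and j: "lookup b j < lookup a j"
      using ne[of a b] ne[of b a] less.prems False by metis
    then have ij: "i \<noteq> j" by auto
    have aM: "lookup a l \<le> lookup M l" and bM: "lookup b l \<le> lookup M l" for l
      using exponent_le_iff[of M] less.prems by blast+
    have "lookup M i \<noteq> 0" using i bM[of i] by linarith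
    then obtain m where m: "M = m + uexp i" by (rule exponent_split)
    have "lookup m j \<noteq> 0" using j aM[of j] ij by (auto simp: m lookup_add lookup_uexp)
    then obtain c where c': "m = c + uexp j" by (rule exponent_split)
    have M: "M = c + uexp j + uexp i" using m c' by simp
    have "lookup a l \<le> lookup (c + uexp j) l" for l
      using aM[of l] i bM[of i] by (cases "l = i") (auto simp: M lookup_add lookup_uexp split: if_splits)
    then obtain p where p: "c + uexp j = a + p" using exponent_le_iff by blast
    have "lookup b l \<le> lookup (c + uexp i) l" for l
      using bM[of l] j aM[of j] by (cases "l = j") (auto simp: M lookup_add lookup_uexp split: if_splits)
    then obtain q where q: "c + uexp i = b + q" using exponent_le_iff by blast
    have E: "c + uexp j \<in> E" "c + uexp i \<in> E" using p q less.prems by (auto simp: E_def)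
    have degM: "deg M = deg c + 2" by (simp add: M)
    show ?thesis
    proof (cases "deg c + 2 \<ge> d + 2")
      \<comment> \<open>Below the range of the hypothesis \<open>M\<close> has degree d + 1, so
        \<open>a\<close> and \<open>b\<close> differ by a unit step.\<close>
      case False
      have "deg c + 1 = d + deg p" "deg c + 1 = d + deg q"
        using arg_cong[OF p, of deg] arg_cong[OF q, of deg] deg_A less.prems(1,2) by simp_all
      then have "deg p = 0" "deg q = 0" using False deg_nonneg[of p] deg_nonneg[of q] by linarith+
      then have "a = c + uexp j" "b = c + uexp i" using p q by simp_all
      then have "a + uexp i = b + uexp j" by (simp add: ac_simps)
      then show ?thesis using less.prems by (auto simp: steps_def)
    next
      case True
      \<comment> \<open>Either one generator dividing \<open>c\<close> links \<open>a\<close> and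
        \<open>b\<close>, or two do, one below \<open>u + uexp j\<close> and one below
        \<open>u + uexp i\<close>; these two share the multiple \<open>u + uexp j + uexp i\<close>,
        of degree one less than \<open>M\<close>.\<close>
      have "c \<in> E \<or> (\<exists>u k. k \<noteq> j \<and> k \<noteq> i \<and> c = u + uexp k \<and> u + uexp j \<in> E \<and> u + uexp i \<in> E)"
        by (rule connected_atD[OF conn[OF True] E ij[symmetric] refl])
      then show ?thesis
      proof
        assume "c \<in> E"
        then obtain w r where w: "w \<in> A" "c = w + r" by (auto simp: E_def)
        have "(a, w) \<in> steps\<^sup>*"
          by (rule IH[OF _ _ p, of w "r + uexp j"]) (use less.prems w degM in \<open>auto simp: add.assoc\<close>)
        moreover have "(w, b) \<in> steps\<^sup>*"
          by (rule IH[OF _ _ _ q, of w "r + uexp i"]) (use less.prems w degM in \<open>auto simp: add.assoc\<close>)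
        ultimately show ?thesis by (rule rtrancl_trans)
      next
        assume "\<exists>u k. k \<noteq> j \<and> k \<noteq> i \<and> c = u + uexp k \<and> u + uexp j \<in> E \<and> u + uexp i \<in> E"
        then obtain u k where u: "c = u + uexp k" "u + uexp j \<in> E" "u + uexp i \<in> E" by blast
        obtain w r where w: "w \<in> A" "u + uexp j = w + r" using u by (auto simp: E_def)
        obtain w' r' where w': "w' \<in> A" "u + uexp i = w' + r'" using u by (auto simp: E_def)
        have "c + uexp j = w + (r + uexp k)"
          by (simp add: u(1) w(2)[symmetric] add.assoc[symmetric]) (simp add: ac_simps)
        then have "(a, w) \<in> steps\<^sup>*"
          by (rule IH[OF _ _ p, rotated 2]) (use less.prems w degM in auto)
        also have "(w, w') \<in> steps\<^sup>*"
        proof (rule IH[of w w' "u + uexp j + uexp i" "r + uexp i" "r' + uexp j"])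
          show "u + uexp j + uexp i = w + (r + uexp i)" by (simp add: w(2) add.assoc)
          show "u + uexp j + uexp i = w' + (r' + uexp j)" 
            using w'(2) by (metis (no_types, lifting) add.assoc add.commute)
          show "deg (u + uexp j + uexp i) < deg M" unfolding degM u(1) by simp
        qed (use w w' in simp_all)
        also have "c + uexp i = w' + (r' + uexp k)"
          by (simp add: u(1) w'(2)[symmetric] add.assoc[symmetric]) (simp add: ac_simps)
        then have "(w', b) \<in> steps\<^sup>*"
          by (rule IH[OF _ _ _ q, rotated 2]) (use less.prems w' degM in auto)
        finally show ?thesis .
      qed
    qed
  qed simp
qed

lemma NP_nonempty: "NP \<noteq> {}"
proof -
  obtain a where "a \<in> A" using A_nonempty by blast
  then have "a \<in> NP" by (intro NP_I[OF real_vec_in_P]) auto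
  then show ?thesis by blast
qed

lemma regularity_integral_closure_le:
  "ideal_regularity (monomial_span NP :: 'k::field pol set) \<le> ideal_regularity (monomial_span E :: 'k pol set)"
proof -
  have NP0: "\<exists>i u. w = u + uexp i \<and> u \<in> NP" if "w \<in> NP" "deg w > d + 1" for w
    using reducible_high that by simp
  have NP1: "connected_at NP j" if "j > d + 1 + 1" for j using connected_high that by simp
  have NP2: "c \<in> NP" if "\<And>i. c + uexp i \<in> NP" "deg c \<ge> d + 1" for c using socle[of c] that by simp
  have "\<exists>bb ZZ. minimal_resolution [0] (embed ` monomial_span NP :: 'k fvec set) bb ZZ"
    by (rule monomial_span_minimal_resolution[OF upclosed_NP NP0 NP1 NP2]) auto
  then obtain bb' ZZ' where res': "minimal_resolution [0] (embed ` monomial_span NP :: 'k fvec set) bb' ZZ'"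
    and reg': "ideal_regularity (monomial_span NP :: 'k pol set) = Max {j - int i | i j. j \<in> set (bb' (Suc i))}"
    by (rule ideal_regularity_eq)
  have le1: "ideal_regularity (monomial_span NP :: 'k pol set) \<le> d + 1"
    unfolding reg'
    by (rule regularity_le[OF upclosed_NP NP_nonempty res', THEN conjunct2, THEN conjunct2])
      (use NP0 NP1 NP2 in blast)+
  have E0: "\<exists>i u. w = u + uexp i \<and> u \<in> E" if "w \<in> E" "deg w > 3 * d + 1" for w
    using E_reducible that d_nonneg by auto
  have E1: "connected_at E j" if "j > 3 * d + 1 + 1" for j using E_connected_large that by simp
  have "\<exists>bb ZZ. minimal_resolution [0] (embed ` monomial_span E :: 'k fvec set) bb ZZ"
    by (rule monomial_span_minimal_resolution[OF upclosed_E E0 E1 E_socle_large]) auto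
  then obtain bb ZZ where res: "minimal_resolution [0] (embed ` monomial_span E :: 'k fvec set) bb ZZ"
    and reg: "ideal_regularity (monomial_span E :: 'k pol set) = Max {j - int i | i j. j \<in> set (bb (Suc i))}"
    by (rule ideal_regularity_eq)
  have Ene: "E \<noteq> {}" using A_nonempty A_subset_E by blast
  have fin: "finite {j - int i | i j. j \<in> set (bb (Suc i))}"
    using regularity_le[OF upclosed_E Ene res E0 E1 E_socle_large] by auto
  have le: "j - int i \<le> ideal_regularity (monomial_span E :: 'k pol set)" if "j \<in> set (bb (Suc i))" for i j
    unfolding reg using fin that by (intro Max_ge) auto
  have bz: "bb 0 = [0]" "ZZ 0 = embed ` monomial_span E" using res by (auto simp: minimal_resolution_def)
  obtain M where M: "syzygy_step [0] (embed ` monomial_span E) (bb (Suc 0)) M (ZZ (Suc 0))"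
    using res bz unfolding minimal_resolution_def by metis
  obtain M' where M': "syzygy_step (bb (Suc 0)) (ZZ (Suc 0)) (bb (Suc (Suc 0))) M' (ZZ (Suc (Suc 0)))"
    using res unfolding minimal_resolution_def by metis
  \<comment> \<open>Elements of \<open>A\<close> have the least degree in \<open>E\<close>, so they
    are not multiples of other elements and force a generator of degree d.\<close>
  have "d \<in> set (bb (Suc 0))"
  proof (rule ccontr)
    assume "d \<notin> set (bb (Suc 0))"
    then have H0: "H0_vanishes [0] (embed ` monomial_span E :: 'k fvec set) d" by (rule step_no_generator[OF M])
    obtain a where a: "a \<in> A" using A_nonempty by blast
    then obtain i u where "a = u + uexp i" "u \<in> E"
      using H0 A_subset_E deg_A unfolding H0_monomial_iff[OF upclosed_E] by blast
    then show False using E_deg[of u] deg_A[OF a] by simp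
  qed
  from le[OF this] have d: "d \<le> ideal_regularity (monomial_span E :: 'k pol set)" by simp
  show ?thesis
  proof (cases "ideal_regularity (monomial_span E :: 'k pol set) = d")
    case False then show ?thesis using le1 d by linarith
  next
    case True
    have conn: "connected_at E j" if j: "j \<ge> d + 2" for j
    proof -
      \<comment> \<open>A first syzygy of degree at least d + 2 would give regularity at least d +
        1.\<close>
      have "j \<notin> set (bb (Suc (Suc 0)))" using le[of j "Suc 0"] True j by auto
      then have "H0_vanishes (bb (Suc 0)) (ZZ (Suc 0)) j" by (rule step_no_generator[OF M'])
      then have "H1_vanishes [0] (embed ` monomial_span E :: 'k fvec set) j" by (rule step_H1_converse[OF M])
      then show ?thesis by (rule H1_monomial_imp_connected[OF upclosed_E])
    qed
    have "(a, b) \<in> steps\<^sup>*" if "a \<in> A" "b \<in> A" for a b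
      by (rule connected_imp_paths[OF conn that refl add.commute])
    then interpret connected_newton A d by unfold_locales
    have NP0: "\<exists>i u. w = u + uexp i \<and> u \<in> NP" if "w \<in> NP" "deg w > d" for w
      using reducible reducible_high that by (cases "deg w = d + 1") auto
    have NP1: "connected_at NP j" if "j > d + 1" for j
      using connected_high connected_low that by (cases "j = d + 2") auto
    have "ideal_regularity (monomial_span NP :: 'k pol set) \<le> d"
      unfolding reg'
      by (rule regularity_le[OF upclosed_NP NP_nonempty res', THEN conjunct2, THEN conjunct2])
        (use NP0 NP1 socle in blast)+
    then show ?thesis using True by simp
  qed
qed

end

lemma ideal_generated_monomials:
  assumes "S \<subseteq> monomials"
  shows "\<exists>E. upclosed E \<and> ideal_generated S = (monomial_span E :: 'k::field pol set)"
proof -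
  define E where "E = {g + u | g u. single g (1 :: 'k) \<in> S}"
  have up: "upclosed E" unfolding upclosed_def E_def by (auto simp: add.assoc) blast
  have "rm.span S \<subseteq> monomial_span E"
  proof (rule rm.span_minimal)
    show "S \<subseteq> monomial_span E"
    proof
      fix s assume s: "s \<in> S"
      then obtain g where "s = single g 1" using assms by (auto simp: monomials_def)
      moreover from this have "g + 0 \<in> E" unfolding E_def using s by blast
      ultimately show "s \<in> monomial_span E" by (simp add: monomial_span_single)
    qed
    show "rm.subspace (monomial_span E :: 'k pol set)"
      using up by (intro rm.subspaceI) (auto intro: monomial_span_add monomial_span_mult)
  qed
  moreover have "p \<in> rm.span S" if p: "p \<in> monomial_span E" for p
  proof -
    have "single m c \<in> rm.span S" if m: "m \<in> E" for m c
    proof -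
      obtain g u where gu: "m = g + u" "single g 1 \<in> S" using m by (auto simp: E_def)
      have "single u c * single g 1 \<in> rm.span S"
        using gu by (intro rm.span_scale rm.span_base)
      then show ?thesis by (simp add: mult_single gu add.commute)
    qed
    then have "(\<Sum>m\<in>keys p. single m (lookup p m)) \<in> rm.span S"
      using p by (intro rm.span_sum) (auto simp: monomial_span_def)
    then show ?thesis using sum_monomials[of p] by simp
  qed
  ultimately show ?thesis using up by blast
qed

lemma integral_closure_zero: "integral_closure {0 :: 'r::idom} = {0}"
proof -
  have ip: "p = 0" if "p \<in> ideal_power {0 :: 'r} i" "i \<ge> 1" for p i
  proof -
    have "ideal_power {0 :: 'r} i \<subseteq> {0}"
      unfolding ideal_power_def
    proof (rule rm.span_minimal)
      show "rm.subspace {0 :: 'r}" by (rule rm.subspaceI) auto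
      show "{\<Prod>k<i. f k | f. \<forall>k<i. f k \<in> {0 :: 'r}} \<subseteq> {0}"
        using that(2) by (auto intro!: prod_zero bexI[of _ 0])
    qed
    then show ?thesis using that(1) by blast
  qed
  have "f = 0" if f: "f \<in> integral_closure {0 :: 'r}" for f
  proof -
    obtain n a where a: "n > 0" "\<forall>i\<in>{1..n}. a i \<in> ideal_power {0 :: 'r} i"
      "f ^ n + (\<Sum>i=1..n. a i * f ^ (n - i)) = 0"
      using f unfolding integral_closure_def by (elim CollectE exE conjE)
    have "(\<Sum>i=1..n. a i * f ^ (n - i)) = 0"
      using a(2) ip by (intro sum.neutral) auto
    then show ?thesis using a by simp
  qed
  moreover have "0 \<in> integral_closure {0 :: 'r}"
    unfolding integral_closure_def
    by (intro CollectI exI[of _ 1] exI[of _ "\<lambda>_. 0"]) simp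
  ultimately show ?thesis by blast
qed

theorem theorem3p5:
  fixes I :: "(3, 'k::field) mpoly set"
  assumes "monomial_ideal I" and "equigenerated I"
  shows "ideal_regularity (integral_closure I) \<le> ideal_regularity I"
proof -
  obtain F where F: "upclosed F" "I = monomial_span F"
    using assms(1) ideal_generated_monomials unfolding monomial_ideal_def by metis
  show ?thesis
  proof (cases "F = {}")
    \<comment> \<open>The zero ideal has no Newton polygon and unspecified regularity; it equals its
      integral closure, so both sides coincide.\<close>
    case True
    then have "I = {0}" using F by (auto simp: monomial_span_def)
    then show ?thesis by (simp add: integral_closure_zero)
  next
    case False
    define A where "A = {a \<in> F. \<forall>v\<in>F. \<forall>u. a = v + u \<longrightarrow> v = a}"
    have single_I: "single m 1 \<in> I \<longleftrightarrow> m \<in> F" for m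
      using F by (simp add: monomial_span_def)
    obtain d where d: "\<And>u. u \<in> minimal_monomial_generators I \<Longrightarrow> homogeneous d u"
      using assms(2) unfolding equigenerated_def by blast
    have degA: "deg a = d" if a: "a \<in> A" for a
    proof -
      have "single a 1 \<in> minimal_monomial_generators I"
        unfolding minimal_monomial_generators_def
      proof (intro CollectI conjI ballI impI)
        show "single a 1 \<in> monomials \<inter> I" using a single_I by (auto simp: monomials_def A_def)
        fix v :: "'k pol" assume v: "v \<in> monomials \<inter> I" and dvd: "v dvd single a 1"
        obtain m where m: "v = single m 1" "m \<in> F" using v single_I by (auto simp: monomials_def)
        obtain q where q: "single a 1 = v * q" using dvd by (rule dvdE)
        have "a \<in> keys (single m 1 * q)"
          unfolding m(1)[symmetric] q[symmetric] by simp
        then obtain u where "a = m + u" using keys_monom_mult by blast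
        then show "v = single a 1" using a m by (auto simp: A_def)
      qed
      from d[OF this] show ?thesis by (simp add: homogeneous_iff)
    qed
    \<comment> \<open>Equigeneration confines the minimal exponents to a single degree, which
      contains finitely many monomials.\<close>
    have "finite A" by (rule finite_subset[OF _ finite_deg[of d]]) (use degA in auto)
    moreover have "A \<noteq> {}" using False minimal_exponent[of _ F] unfolding A_def by blast
    ultimately interpret newton A d using degA by unfold_locales
    have "F = newton.E A"
    proof (intro equalityI subsetI)
      fix w assume "w \<in> F"
      then obtain a u where "a \<in> F" "w = a + u" "\<forall>v\<in>F. \<forall>u. a = v + u \<longrightarrow> v = a"
        using minimal_exponent by blast
      moreover from this have "a \<in> A" by (simp add: A_def)
      ultimately show "w \<in> newton.E A" by (auto simp: E_def)
    next
      fix w assume "w \<in> newton.E A"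
      then obtain a u where "a \<in> A" "w = a + u" by (auto simp: E_def)
      then show "w \<in> F" using upclosed_add[OF F(1)] by (auto simp: A_def)
    qed
    then show ?thesis
      unfolding F(2) using regularity_integral_closure_le integral_closure_monomial_span by metis
  qed
qed

end
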